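(* Let $J$ be a bounded open interval of $\mathbb{R}$. Let $k>0$ satisfy $k^2\le\lambda_{1,1}(J)$ and let $d\in S^2$ be fixed. Then an obstacle $D\subset\mathbb{R}^3$ with $\overline D\subset\mathbb{R}^2\times J$ is uniquely determined by its far-field pattern $F_D(\,\cdot\,,d;k)$; that is, if $D_1$ and $D_2$ are two obstacles in $\mathbb{R}^3$ with $\overline{D_1}\subset\mathbb{R}^2\times J$ and $\overline{D_2}\subset\mathbb{R}^2\times J$, and $F_{D_1}(\varphi,d;k)=F_{D_2}(\varphi,d;k)$ for all $\varphi\in S^2$, then $D_1=D_2$.
   Context: For a bounded open interval $J\subset\mathbb{R}$, $\lambda_{1,1}(J)$ denotes the first Dirichlet eigenvalue of $-\frac{d^2}{dx^2}$ in $J$. An obstacle is a (nonempty) bounded domain $D\subset\mathbb{R}^3$ (open and connected) with $C^2$ boundary such that $\mathbb{R}^3\setminus\overline D$ is connected. For $k>0$ and $d\in S^2$ (the unit sphere in $\mathbb{R}^3$), the total wave field outside the sound-soft obstacle $D$ is the (unique, classical, complex-valued, continuous up to $\partial D$) function $u(x;d,k)=e^{ikx\cdot d}+w(x)$ satisfying $$\triangle u+k^2u=0\ \text{in}\ \mathbb{R}^3\setminus\overline D,\qquad u=0\ \text{on}\ \partial D,$$ and the Sommerfeld radiation condition $$\lim_{r\to\infty}r\left(\frac{\partial w}{\partial r}-ikw\right)=0,\qquad r=|x|$$ (uniformly in all directions $x/|x|$). The scattered wave $w=u-e^{ikx\cdot d}$ has the asymptotic behaviour $$w(r\varphi)=\frac{e^{ikr}}{r}F_D(\varphi,d;k)+O\left(\frac{1}{r^{2}}\right),\quad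 r\to\infty,$$ uniformly for $\varphi\in S^2$; the coefficient $F_D(\varphi,d;k)$ is called the far-field pattern of $D$. *)

theory Defs
  imports "HOL-Analysis.Analysis"
begin

definition C1_on :: "'a::euclidean_space set \<Rightarrow> ('a \<Rightarrow> 'b::real_normed_vector) \<Rightarrow> bool" where
  "C1_on S f \<longleftrightarrow> (\<forall>x\<in>S. f differentiable (at x)) \<and>
     (\<forall>v. continuous_on S (\<lambda>x. frechet_derivative f (at x) v))"

(* C1_on and C2_on are meant for open S.  Since the domain is finite-dimensional, continuity of
   all directional derivatives is continuity of the Frechet derivative. *)
definition C2_on :: "'a::euclidean_space set \<Rightarrow> ('a \<Rightarrow> 'b::real_normed_vector) \<Rightarrow> bool" where
  "C2_on S f \<longleftrightarrow> C1_on S f \<and> (\<forall>v. C1_on S (\<lambda>x. frechet_derivative f (at x) v))"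

definition laplacian :: "('a::euclidean_space \<Rightarrow> 'b::real_normed_vector) \<Rightarrow> 'a \<Rightarrow> 'b" where
  "laplacian f x =
     (\<Sum>b\<in>Basis. frechet_derivative (\<lambda>y. frechet_derivative f (at y) b) (at x) b)"

definition dirichlet_eigenvalue :: "real set \<Rightarrow> real \<Rightarrow> bool" where
  "dirichlet_eigenvalue J \<mu> \<longleftrightarrow>
     (\<exists>v :: real \<Rightarrow> real. continuous_on (closure J) v \<and> C2_on J v \<and>
        (\<exists>t\<in>J. v t \<noteq> 0) \<and> (\<forall>t\<in>frontier J. v t = 0) \<and>
        (\<forall>t\<in>J. - deriv (deriv v) t = \<mu> * v t))"

definition first_dirichlet_eigenvalue :: "real set \<Rightarrow> real" where
  "first_dirichlet_eigenvalue J = (LEAST \<mu>. dirichlet_eigenvalue J \<mu>)"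

(* Near each boundary point, after an orthogonal change T of coordinates, D is the open region
   on one side of the graph of a C^2 function of two variables. *)
definition C2_boundary :: "(real^3) set \<Rightarrow> bool" where
  "C2_boundary D \<longleftrightarrow>
     (\<forall>p\<in>frontier D. \<exists>r>0. \<exists>(T :: real^3 \<Rightarrow> real^3) (\<gamma> :: real \<times> real \<Rightarrow> real).
        orthogonal_transformation T \<and> C2_on UNIV \<gamma> \<and>
        D \<inter> ball p r = {x \<in> ball p r. T x $ 3 > \<gamma> (T x $ 1, T x $ 2)})"

definition obstacle :: "(real^3) set \<Rightarrow> bool" where
  "obstacle D \<longleftrightarrow> D \<noteq> {} \<and> open D \<and> connected D \<and> bounded D \<and>
     C2_boundary D \<and> connected (- closure D)"

definition incident_wave :: "real^3 \<Rightarrow> real \<Rightarrow> real^3 \<Rightarrow> complex" where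
  "incident_wave d k x = exp (\<i> * of_real (k * (x \<bullet> d)))"

definition radiating :: "real \<Rightarrow> (real^3 \<Rightarrow> complex) \<Rightarrow> bool" where
  "radiating k w \<longleftrightarrow>
     uniform_limit (sphere 0 1)
       (\<lambda>r \<phi>. of_real r * (vector_derivative (\<lambda>s. w (s *\<^sub>R \<phi>)) (at r)
                            - \<i> * of_real k * w (r *\<^sub>R \<phi>)))
       (\<lambda>\<phi>. 0) at_top"

(* Only the values of u on - D, the union of the exterior of D and the boundary of D (D is open),
   are constrained; the values inside D are irrelevant. *)
definition total_field :: "(real^3) set \<Rightarrow> real^3 \<Rightarrow> real \<Rightarrow> (real^3 \<Rightarrow> complex) \<Rightarrow> bool" where
  "total_field D d k u \<longleftrightarrow>
     C2_on (- closure D) u \<and> continuous_on (- D) u \<and>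
     (\<forall>x\<in>- closure D. laplacian u x + of_real (k\<^sup>2) * u x = 0) \<and>
     (\<forall>x\<in>frontier D. u x = 0) \<and>
     radiating k (\<lambda>x. u x - incident_wave d k x)"

(* F is the far-field pattern of D for direction d and wave number k.  Stated as a relation
   because the total field is given by its characterising properties; F is determined on the
   unit sphere only. *)
definition far_field_pattern ::
  "(real^3) set \<Rightarrow> real^3 \<Rightarrow> real \<Rightarrow> (real^3 \<Rightarrow> complex) \<Rightarrow> bool" where
  "far_field_pattern D d k F \<longleftrightarrow>
     (\<exists>u. total_field D d k u \<and>
        (\<exists>C R. R > 0 \<and> (\<forall>r\<ge>R. \<forall>\<phi>\<in>sphere 0 1.
           norm ((u (r *\<^sub>R \<phi>) - incident_wave d k (r *\<^sub>R \<phi>))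
                 - exp (\<i> * of_real (k * r)) / of_real r * F \<phi>) \<le> C / r\<^sup>2)))"

end

theory Submission
  imports Defs
begin

text \<open>The difference \<open>w\<close> of the two total fields solves the Helmholtz equation outside a large ball, and
since the far-field patterns agree it is of order \<open>1 / r\<^sup>2\<close> there. Rellich's lemma forces such a
solution to vanish, and unique continuation spreads the equality of the two fields over the unbounded
component \<open>\<Omega>\<close> of the complement of both closed obstacles. Suppose that some point outside \<open>D\<^sub>1\<close> and its
boundary is not in the closure of \<open>\<Omega>\<close>, and let \<open>A\<close> be the open set of all such points. It is bounded
and lies in the slab, because a half-space that meets neither obstacle belongs to \<open>\<Omega>\<close>. The total field
of \<open>D\<^sub>1\<close> vanishes on the boundary of \<open>A\<close>: a boundary point of \<open>A\<close> lies on the boundary of \<open>D\<^sub>1\<close>, or else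
it lies on the boundaries of \<open>\<Omega>\<close> and \<open>D\<^sub>2\<close>, where both fields agree and the second one vanishes. So the
field is a Dirichlet solution in \<open>A\<close>, and the slab is too thin to carry one with this wave number. By
unique continuation the field then vanishes in the whole exterior of \<open>D\<^sub>1\<close>, although the incident wave
has modulus 1 and the scattered wave decays. Hence the exterior of either obstacle lies in
the closure of \<open>\<Omega>\<close>, each obstacle lies in the interior of the closure of the other one, and this
interior is the obstacle itself because its boundary is locally a graph.

Rellich's lemma and unique continuation come from one and the same elementary device, used here in place
of spherical harmonics or real analyticity. For a monomial \<open>P\<close> of degree \<open>n\<close> and a radial test function
\<open>\<rho>\<close> with support in a shell inside the domain of a solution \<open>w\<close>, integration by parts gives
\<open>\<integral> w P (\<rho>'' + (2 n + 2) / r \<rho>' + k\<^sup>2 \<rho>) = - \<integral> w (\<Delta> P) \<rho>\<close> (lemma \<open>moment_radial_operator\<close>), where the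
right-hand side involves monomials of degree \<open>n - 2\<close> only. Each radial \<open>\<psi>\<close> can be written as
\<open>\<rho>'' + (2 n + 2) / r \<rho>' + k\<^sup>2 \<rho>\<close>, with \<open>\<rho>\<close> vanishing on one chosen side of the support of \<open>\<psi>\<close> (lemma
\<open>radial_ode\<close>). On the other side a cut-off makes \<open>\<rho>\<close> compactly supported; the error is invisible if \<open>w\<close>
vanishes there (unique continuation) and tends to zero if \<open>w\<close> decays (Rellich). By induction on the
degree all integrals \<open>\<integral> w P \<psi>\<close> vanish, and by the Stone-Weierstrass theorem \<open>w\<close> vanishes.

The slab enters through a maximum principle, lemma \<open>slab_maximum_principle\<close>: the function
\<open>cos (\<kappa> (x \<bullet> e - c))\<close> is a positive supersolution of the Helmholtz equation in a thin slab, which excludes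
nonzero Dirichlet solutions. Its one-dimensional case also identifies the first Dirichlet eigenvalue of
an interval of length \<open>L\<close> as \<open>(\<pi> / L)\<^sup>2\<close>.\<close>

section \<open>Directional derivatives\<close>

text \<open>A derivative along a single line is all that integration by parts in one direction and the second
derivative test need, and for products of monomials with radial functions it reduces every computation
to calculus in one variable.\<close>

definition has_dirderiv ::
  "('a::real_normed_vector \<Rightarrow> 'b::real_normed_vector) \<Rightarrow> 'a \<Rightarrow> 'b \<Rightarrow> 'a \<Rightarrow> bool" where
  "has_dirderiv f b f' x \<longleftrightarrow> ((\<lambda>t. f (x + t *\<^sub>R b)) has_vector_derivative f') (at 0)"

lemma has_dirderiv_line:
  assumes "has_dirderiv f b f' (x + t *\<^sub>R b)"
  shows "((\<lambda>s. f (x + s *\<^sub>R b)) has_vector_derivative f') (at t)"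
proof -
  have "((\<lambda>s. s - t) has_vector_derivative 1) (at t)"
    by (auto intro!: derivative_eq_intros)
  moreover have "((\<lambda>s. f (x + t *\<^sub>R b + s *\<^sub>R b)) has_vector_derivative f') (at (t - t))"
    using assms by (simp add: has_dirderiv_def)
  ultimately have "((\<lambda>s. f (x + t *\<^sub>R b + s *\<^sub>R b)) \<circ> (\<lambda>s. s - t) has_vector_derivative 1 *\<^sub>R f') (at t)"
    by (rule vector_diff_chain_at)
  moreover have "(\<lambda>s. f (x + t *\<^sub>R b + s *\<^sub>R b)) \<circ> (\<lambda>s. s - t) = (\<lambda>s. f (x + s *\<^sub>R b))"
    by (auto simp: algebra_simps)
  ultimately show ?thesis by simp
qed

lemma has_dirderiv_real_line:
  fixes f :: "'a::real_normed_vector \<Rightarrow> real"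
  assumes "has_dirderiv f b f' (x + t *\<^sub>R b)"
  shows "((\<lambda>s. f (x + s *\<^sub>R b)) has_real_derivative f') (at t)"
  using has_dirderiv_line[OF assms] by (simp add: has_real_derivative_iff_has_vector_derivative)

lemma has_dirderiv_mult:
  fixes f g :: "'a::real_normed_vector \<Rightarrow> 'b::real_normed_algebra"
  assumes "has_dirderiv f b f' x" "has_dirderiv g b g' x"
  shows "has_dirderiv (\<lambda>y. f y * g y) b (f x * g' + f' * g x) x"
  using has_vector_derivative_mult[OF assms[unfolded has_dirderiv_def]]
  by (simp add: has_dirderiv_def)

lemma has_dirderiv_diff:
  assumes "has_dirderiv f b f' x" "has_dirderiv g b g' x"
  shows "has_dirderiv (\<lambda>y. f y - g y) b (f' - g') x"
  using assms by (auto simp: has_dirderiv_def intro!: derivative_eq_intros)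

lemma has_dirderiv_add:
  assumes "has_dirderiv f b f' x" "has_dirderiv g b g' x"
  shows "has_dirderiv (\<lambda>y. f y + g y) b (f' + g') x"
  using assms by (auto simp: has_dirderiv_def intro!: derivative_eq_intros)

lemma has_dirderiv_cmult:
  fixes f :: "'a::real_normed_vector \<Rightarrow> 'b::real_normed_algebra"
  assumes "has_dirderiv f b f' x"
  shows "has_dirderiv (\<lambda>y. c * f y) b (c * f') x"
  using assms by (auto simp: has_dirderiv_def intro!: derivative_eq_intros)

lemma has_dirderiv_cong_open:
  assumes "has_dirderiv f b f' x" "open U" "x \<in> U" "\<And>y. y \<in> U \<Longrightarrow> f y = g y"
  shows "has_dirderiv g b f' x"
  unfolding has_dirderiv_def
proof (rule has_vector_derivative_transform_within_open)
  show "((\<lambda>t. f (x + t *\<^sub>R b)) has_vector_derivative f') (at 0)"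
    using assms(1) by (simp add: has_dirderiv_def)
  show "open ((\<lambda>t. x + t *\<^sub>R b) -` U)"
    by (intro open_vimage assms(2) continuous_intros)
qed (use assms(3,4) in auto)

lemma has_dirderiv_0: "has_dirderiv (\<lambda>y. 0) b 0 x"
  by (simp add: has_dirderiv_def)

lemma has_dirderiv_unique:
  "has_dirderiv f b f' x \<Longrightarrow> has_dirderiv f b f'' x \<Longrightarrow> f' = f''"
  unfolding has_dirderiv_def by (rule vector_derivative_unique_at)

lemma differentiable_imp_has_dirderiv:
  assumes "f differentiable (at x)"
  shows "has_dirderiv f b (frechet_derivative f (at x) b) x"
proof -
  have d: "(f has_derivative frechet_derivative f (at x)) (at x)"
    using assms by (simp add: frechet_derivative_works)
  have "((\<lambda>t. f (x + t *\<^sub>R b)) has_derivative (\<lambda>t. frechet_derivative f (at x) (t *\<^sub>R b))) (at 0)"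
    using d by (intro has_derivative_compose[of "\<lambda>t. x + t *\<^sub>R b" "\<lambda>t. t *\<^sub>R b" 0 UNIV f])
      (auto intro!: derivative_eq_intros)
  then show ?thesis
    unfolding has_dirderiv_def has_vector_derivative_def
    using has_derivative_linear[OF d] by (simp add: linear_scale)
qed

section \<open>Twice continuously differentiable functions\<close>

lemma C2_on_dirderiv:
  assumes "C2_on U u" "x \<in> U"
  shows "has_dirderiv u b (frechet_derivative u (at x) b) x"
    "has_dirderiv (\<lambda>y. frechet_derivative u (at y) b) b
       (frechet_derivative (\<lambda>y. frechet_derivative u (at y) b) (at x) b) x"
  using assms by (auto simp: C2_on_def C1_on_def intro!: differentiable_imp_has_dirderiv)

lemma C2_on_continuous:
  assumes "C2_on U u"
  shows "continuous_on U u" "continuous_on U (\<lambda>y. frechet_derivative u (at y) b)"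
    "continuous_on U (\<lambda>y. frechet_derivative (\<lambda>y. frechet_derivative u (at y) b) (at y) b)"
  using assms
  by (auto simp: C2_on_def C1_on_def intro!: differentiable_imp_continuous_on differentiable_at_imp_differentiable_on)

lemma C2_on_subset: "C2_on U u \<Longrightarrow> V \<subseteq> U \<Longrightarrow> C2_on V u"
  unfolding C2_on_def C1_on_def by (meson continuous_on_subset subsetD)

text \<open>An equivalence for every candidate \<open>D\<close> carries over to \<open>frechet_derivative\<close>, which is defined by a choice
among the candidates, as an unconditional equation.\<close>

lemma has_derivative_translate:
  fixes u :: "'a::real_normed_vector \<Rightarrow> 'b::real_normed_vector"
  shows "((\<lambda>y. u (a + y)) has_derivative D) (at x) \<longleftrightarrow> (u has_derivative D) (at (a + x))"
  unfolding has_derivative_at by (simp add: add.assoc)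

lemma frechet_derivative_translate:
  "frechet_derivative (\<lambda>y. u (a + y)) (at x) = frechet_derivative u (at (a + x))"
  unfolding frechet_derivative_def has_derivative_translate ..

lemma C1_on_translate:
  assumes "C1_on U u" "\<And>x. x \<in> S \<Longrightarrow> a + x \<in> U"
  shows "C1_on S (\<lambda>x. u (a + x))"
  unfolding C1_on_def
proof (intro conjI ballI allI)
  show "(\<lambda>x. u (a + x)) differentiable at x" if "x \<in> S" for x
    using assms that unfolding C1_on_def differentiable_def has_derivative_translate by blast
  have c: "continuous_on U (\<lambda>x. frechet_derivative u (at x) v)" for v
    using assms(1) by (simp add: C1_on_def)
  show "continuous_on S (\<lambda>x. frechet_derivative (\<lambda>x. u (a + x)) (at x) v)" for v
    unfolding frechet_derivative_translate
    by (rule continuous_on_compose2[OF c]) (use assms(2) in \<open>auto intro!: continuous_intros\<close>)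
qed

lemma C2_on_translate:
  assumes "C2_on U u" "\<And>x. x \<in> S \<Longrightarrow> a + x \<in> U"
  shows "C2_on S (\<lambda>x. u (a + x))"
  using assms C1_on_translate[of U _ S a] unfolding C2_on_def frechet_derivative_translate by blast

lemma laplacian_translate: "laplacian (\<lambda>x. u (a + x)) x = laplacian u (a + x)"
  unfolding laplacian_def frechet_derivative_translate
  using frechet_derivative_translate[of "\<lambda>y. frechet_derivative u (at y) b" a x for b] by simp

lemma frechet_derivative_cong_open:
  assumes "open U" "x \<in> U" "\<And>y. y \<in> U \<Longrightarrow> f y = g y"
  shows "frechet_derivative f (at x) = frechet_derivative g (at x)"
proof -
  have "(f has_derivative D) (at x) \<longleftrightarrow> (g has_derivative D) (at x)" for D
    using has_derivative_transform_within_open[of f D x UNIV U g]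
      has_derivative_transform_within_open[of g D x UNIV U f] assms by metis
  then show ?thesis unfolding frechet_derivative_def by simp
qed

lemma C1_on_cong_open:
  assumes "open U" "\<And>y. y \<in> U \<Longrightarrow> f y = g y" "C1_on U f"
  shows "C1_on U g"
  unfolding C1_on_def
proof (intro conjI ballI allI)
  show "g differentiable at x" if "x \<in> U" for x
    using assms that has_derivative_transform_within_open[of f _ x UNIV U g]
    unfolding C1_on_def differentiable_def by metis
  have "continuous_on U (\<lambda>x. frechet_derivative f (at x) v)" for v
    using assms(3) by (simp add: C1_on_def)
  then show "continuous_on U (\<lambda>x. frechet_derivative g (at x) v)" for v
    using frechet_derivative_cong_open[OF assms(1) _ assms(2)] by (simp cong: continuous_on_cong)
qed

lemma frechet_derivative_diff_apply:
  assumes "f differentiable (at x)" "g differentiable (at x)"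
  shows "frechet_derivative (\<lambda>y. f y - g y) (at x) v = frechet_derivative f (at x) v - frechet_derivative g (at x) v"
proof -
  have "((\<lambda>y. f y - g y) has_derivative (\<lambda>h. frechet_derivative f (at x) h - frechet_derivative g (at x) h)) (at x)"
    by (intro has_derivative_diff) (use assms frechet_derivative_works in blast)+
  from frechet_derivative_at[OF this] show ?thesis by metis
qed

lemma C1_on_diff:
  assumes "C1_on U f" "C1_on U g"
  shows "C1_on U (\<lambda>x. f x - g x)"
  unfolding C1_on_def
proof (intro conjI ballI allI)
  show "(\<lambda>x. f x - g x) differentiable at x" if "x \<in> U" for x
    using assms that by (auto simp: C1_on_def intro: differentiable_diff)
  have "continuous_on U (\<lambda>x. frechet_derivative f (at x) v - frechet_derivative g (at x) v)" for v
    using assms by (auto simp: C1_on_def intro: continuous_on_diff)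
  moreover have "frechet_derivative (\<lambda>y. f y - g y) (at x) v = frechet_derivative f (at x) v - frechet_derivative g (at x) v"
    if "x \<in> U" for x v
    using assms that by (intro frechet_derivative_diff_apply) (auto simp: C1_on_def)
  ultimately show "continuous_on U (\<lambda>x. frechet_derivative (\<lambda>x. f x - g x) (at x) v)" for v
    by (simp cong: continuous_on_cong)
qed

lemma C2_on_diff:
  assumes U: "open U" and f: "C2_on U f" and g: "C2_on U g"
  shows "C2_on U (\<lambda>x. f x - g x)"
    and "x \<in> U \<Longrightarrow> laplacian (\<lambda>x. f x - g x) x = laplacian f x - laplacian g x"
proof -
  have d: "h differentiable (at x)" "(\<lambda>y. frechet_derivative h (at y) v) differentiable (at x)"
    if "C2_on U h" "x \<in> U" for h :: "'a \<Rightarrow> 'b" and x v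
    using that by (auto simp: C2_on_def C1_on_def)
  have eq: "frechet_derivative (\<lambda>y. f y - g y) (at x) v = frechet_derivative f (at x) v - frechet_derivative g (at x) v"
    if "x \<in> U" for x v
    by (rule frechet_derivative_diff_apply) (use that d f g in blast)+
  have "C1_on U (\<lambda>x. frechet_derivative (\<lambda>y. f y - g y) (at x) v)" for v
    by (rule C1_on_cong_open[OF U _ C1_on_diff[of U "\<lambda>x. frechet_derivative f (at x) v" "\<lambda>x. frechet_derivative g (at x) v"]])
      (use eq f g in \<open>auto simp: C2_on_def\<close>)
  moreover have "C1_on U (\<lambda>x. f x - g x)" using f g by (auto simp: C2_on_def intro: C1_on_diff)
  ultimately show "C2_on U (\<lambda>x. f x - g x)" by (simp add: C2_on_def)
  show "laplacian (\<lambda>x. f x - g x) x = laplacian f x - laplacian g x" if "x \<in> U"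
    unfolding laplacian_def sum_subtractf[symmetric]
  proof (rule sum.cong[OF refl])
    fix b :: 'a
    have "frechet_derivative (\<lambda>y. frechet_derivative (\<lambda>x. f x - g x) (at y) b) (at x) b
      = frechet_derivative (\<lambda>y. frechet_derivative f (at y) b - frechet_derivative g (at y) b) (at x) b"
      by (rule fun_cong[OF frechet_derivative_cong_open[OF U that eq]])
    also have "\<dots> = frechet_derivative (\<lambda>y. frechet_derivative f (at y) b) (at x) b
      - frechet_derivative (\<lambda>y. frechet_derivative g (at y) b) (at x) b"
      by (rule frechet_derivative_diff_apply) (use that d f g in blast)+
    finally show "frechet_derivative (\<lambda>y. frechet_derivative (\<lambda>x. f x - g x) (at y) b) (at x) b = \<dots>" .
  qed
qed

section \<open>Integration by parts for compactly supported functions\<close>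

text \<open>Translating a compactly supported function does not change its integral.  The difference
  quotients therefore all have integral zero, and dominated convergence passes this on to the
  derivative.\<close>

lemma integral_dirderiv_eq_0:
  fixes g g' :: "'a::euclidean_space \<Rightarrow> 'b::euclidean_space"
  assumes der: "\<And>x. has_dirderiv g b (g' x) x"
    and g: "continuous_on UNIV g" and g': "continuous_on UNIV g'"
    and K: "compact K" and supp: "\<And>x. x \<notin> K \<Longrightarrow> g x = 0"
  shows "(LINT x|lborel. g' x) = 0"
proof -
  have g'0: "g' x = 0" if "x \<notin> K" for x
  proof (rule has_dirderiv_unique[OF der])
    show "has_dirderiv g b 0 x"
      by (rule has_dirderiv_cong_open[OF has_dirderiv_0, of "- K"])
        (use that K supp in \<open>auto simp: compact_imp_closed\<close>)
  qed
  have "bounded (g' ` K)"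
    using g' K by (meson compact_continuous_image compact_imp_bounded continuous_on_subset subset_UNIV)
  then obtain M where M: "M > 0" "\<And>x. x \<in> K \<Longrightarrow> norm (g' x) \<le> M"
    by (auto simp: bounded_pos)
  then have M': "norm (g' x) \<le> M" for x
    using g'0[of x] by (cases "x \<in> K") auto
  obtain R where R: "\<And>x. x \<in> K \<Longrightarrow> norm x \<le> R"
    using compact_imp_bounded[OF K] unfolding bounded_iff by auto
  have intg: "integrable lborel g"
  proof -
    have "integrable lborel (\<lambda>x. indicator K x *\<^sub>R g x)"
      by (intro borel_integrable_compact K continuous_on_subset[OF g]) auto
    moreover have "(\<lambda>x. indicator K x *\<^sub>R g x) = g"
      using supp by (auto simp: indicator_def)
    ultimately show ?thesis by simp
  qed
  have trans: "integrable lborel (\<lambda>x. g (x + h))" "(LINT x|lborel. g (x + h)) = (LINT x|lborel. g x)" for h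
  proof -
    have d: "distr lborel borel (\<lambda>x. h + x) = lborel" by (rule lborel_distr_plus)
    have m: "g \<in> borel_measurable borel" using g by (rule borel_measurable_continuous_onI)
    have "integrable (distr lborel borel (\<lambda>x. h + x)) g" using intg d by simp
    then show "integrable lborel (\<lambda>x. g (x + h))"
      using m by (subst (asm) integrable_distr_eq) (auto simp: add.commute)
    have "(LINT x|distr lborel borel (\<lambda>x. h + x). g x) = (LINT x|lborel. g (h + x))"
      using m by (intro integral_distr) auto
    then show "(LINT x|lborel. g (x + h)) = (LINT x|lborel. g x)"
      using d by (simp add: add.commute)
  qed
  \<comment> \<open>dominated convergence needs a sequence of step widths, bounded by 1 so that all shifted supports lie in one ball\<close>
  define e where "e = (\<lambda>m. inverse (real (Suc m)))"
  define q where "q = (\<lambda>m x. (1 / e m) *\<^sub>R (g (x + e m *\<^sub>R b) - g x))"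
  have e: "0 < e m" "e m \<le> 1" for m by (auto simp: e_def field_simps)
  have q0: "(LINT x|lborel. q m x) = 0" for m
    unfolding q_def by (simp add: trans intg)
  have qb: "norm (q m x) \<le> M * norm (indicat_real (cball 0 (R + norm b)) x)" for m x
  proof (cases "x \<in> cball 0 (R + norm b)")
    case True
    have "norm (g (x + e m *\<^sub>R b) - g (x + 0 *\<^sub>R b)) \<le> M * norm (e m - 0)"
    proof (rule differentiable_bound[where f' = "\<lambda>t s. s *\<^sub>R g' (x + t *\<^sub>R b)" and S = UNIV])
      fix t :: real
      show "((\<lambda>t. g (x + t *\<^sub>R b)) has_derivative (\<lambda>s. s *\<^sub>R g' (x + t *\<^sub>R b))) (at t within UNIV)"
        using has_dirderiv_line[OF der] by (auto simp: has_vector_derivative_def)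
      show "onorm (\<lambda>s. s *\<^sub>R g' (x + t *\<^sub>R b)) \<le> M"
        by (rule onorm_le) (simp add: mult.commute[of M] mult_left_mono M')
    qed auto
    then have "norm (g (x + e m *\<^sub>R b) - g x) / e m \<le> M"
      using e[of m] by (simp add: field_simps)
    then show ?thesis using True e[of m] by (simp add: q_def)
  next
    case False
    then have big: "norm x > R + norm b" by auto
    have "norm x \<le> norm (x + e m *\<^sub>R b) + norm (e m *\<^sub>R b)"
      by (metis add_diff_cancel_right' norm_triangle_ineq4)
    also have "norm (e m *\<^sub>R b) \<le> norm b"
      using e[of m] by (simp add: mult_left_le_one_le)
    finally have "x + e m *\<^sub>R b \<notin> K" "x \<notin> K"
      using big R[of x] R[of "x + e m *\<^sub>R b"] norm_ge_zero[of b] by linarith+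
    then show ?thesis using M(1) by (simp add: q_def supp)
  qed
  have lim: "(\<lambda>m. q m x) \<longlonglongrightarrow> g' x" for x
  proof -
    have "(\<lambda>h. norm (g (x + (0 + h) *\<^sub>R b) - g (x + 0 *\<^sub>R b) - h *\<^sub>R g' x) / norm h) \<midarrow>0\<rightarrow> 0"
      using der[of x] unfolding has_dirderiv_def has_vector_derivative_def has_derivative_at by blast
    then have "(\<lambda>h. norm ((g (x + (0 + h) *\<^sub>R b) - g (x + 0 *\<^sub>R b)) /\<^sub>R h - g' x)) \<midarrow>0\<rightarrow> 0"
    proof (rule Lim_transform_eventually)
      have "norm (y - h *\<^sub>R z) / norm h = norm (y /\<^sub>R h - z)" if "h \<noteq> 0" for h :: real and y z :: 'b
      proof -
        have "y - h *\<^sub>R z = h *\<^sub>R (y /\<^sub>R h - z)" using that by (simp add: scaleR_diff_right)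
        then show ?thesis using that by simp
      qed
      then show "\<forall>\<^sub>F h in at 0. norm (g (x + (0 + h) *\<^sub>R b) - g (x + 0 *\<^sub>R b) - h *\<^sub>R g' x) / norm h
          = norm ((g (x + (0 + h) *\<^sub>R b) - g (x + 0 *\<^sub>R b)) /\<^sub>R h - g' x)"
        by (auto simp: eventually_at_filter)
    qed
    then have "((\<lambda>h. (g (x + (0 + h) *\<^sub>R b) - g (x + 0 *\<^sub>R b)) /\<^sub>R h) \<longlongrightarrow> g' x) (at 0)"
      by (rule LIM_zero_cancel[OF tendsto_norm_zero_cancel])
    moreover have "filterlim e (at 0) sequentially"
      unfolding e_def filterlim_at using LIMSEQ_inverse_real_of_nat by auto
    ultimately have "((\<lambda>m. (g (x + (0 + e m) *\<^sub>R b) - g (x + 0 *\<^sub>R b)) /\<^sub>R e m) \<longlongrightarrow> g' x) sequentially"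
      by (rule filterlim_compose)
    then show ?thesis by (simp add: q_def inverse_eq_divide)
  qed
  have "(\<lambda>m. LINT x|lborel. q m x) \<longlonglongrightarrow> (LINT x|lborel. g' x)"
  proof (rule integral_dominated_convergence[where w = "\<lambda>x. M * norm (indicat_real (cball 0 (R + norm b)) x)"])
    show "g' \<in> borel_measurable lborel"
      using g' by (simp add: borel_measurable_continuous_onI)
    show "q m \<in> borel_measurable lborel" for m
      unfolding q_def using borel_measurable_integrable[OF trans(1)] borel_measurable_integrable[OF intg]
      by (intro borel_measurable_scaleR borel_measurable_diff) auto
    show "integrable lborel (\<lambda>x::'a. M * norm (indicat_real (cball 0 (R + norm b)) x))"
      using emeasure_lborel_cball_finite[of "0::'a" "R + norm b"]
      by (intro integrable_mult_right integrable_norm integrable_real_indicator) auto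
    show "AE x in lborel. (\<lambda>m. q m x) \<longlonglongrightarrow> g' x" by (rule AE_I2) (rule lim)
    show "AE x in lborel. norm (q m x) \<le> M * norm (indicat_real (cball 0 (R + norm b)) x)" for m
      by (rule AE_I2) (rule qb)
  qed
  then have "(\<lambda>m. 0) \<longlonglongrightarrow> (LINT x|lborel. g' x)" by (simp add: q0)
  then show ?thesis by (simp add: LIMSEQ_const_iff)
qed

text \<open>Extending by zero produces no jump because the support is compact inside the open set \<open>U\<close>.\<close>

lemma continuous_on_zero_extension:
  fixes g :: "'a::t2_space \<Rightarrow> 'b::real_normed_vector"
  assumes "open U" "compact K" "K \<subseteq> U" "continuous_on U f"
    and "\<And>x. x \<in> U \<Longrightarrow> g x = f x" "\<And>x. x \<notin> K \<Longrightarrow> g x = 0"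
  shows "continuous_on UNIV g"
proof -
  have "continuous_on U g" using assms(4,5) by (simp cong: continuous_on_cong)
  moreover have "continuous_on (- K) g"
    using assms(6) by (subst continuous_on_cong[OF refl, of _ g "\<lambda>_. 0"]) auto
  ultimately have "continuous_on (U \<union> - K) g"
    using assms(1,2) by (intro continuous_on_open_Un) (auto simp: compact_imp_closed)
  moreover have "U \<union> - K = UNIV" using assms(3) by auto
  ultimately show ?thesis by simp
qed

text \<open>Apply lemma \<open>integral_dirderiv_eq_0\<close> to \<open>f w1 - f1 w\<close>, whose derivative along \<open>b\<close> is \<open>f w2 - f2 w\<close>. Only \<open>f\<close> has
compact support; \<open>w\<close> is defined on \<open>U\<close> and arbitrary elsewhere, so all functions are cut off to \<open>K\<close>.\<close>

lemma green_dirderiv: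
  fixes f w f1 w1 f2 w2 :: "'a::euclidean_space \<Rightarrow> complex"
  assumes U: "open U" and K: "compact K" "K \<subseteq> U"
    and f: "\<And>x. x \<in> U \<Longrightarrow> has_dirderiv f b (f1 x) x" "\<And>x. x \<in> U \<Longrightarrow> has_dirderiv f1 b (f2 x) x"
    and w: "\<And>x. x \<in> U \<Longrightarrow> has_dirderiv w b (w1 x) x" "\<And>x. x \<in> U \<Longrightarrow> has_dirderiv w1 b (w2 x) x"
    and cf: "continuous_on U f" "continuous_on U f1" "continuous_on U f2"
    and cw: "continuous_on U w" "continuous_on U w1" "continuous_on U w2"
    and f0: "\<And>x. x \<in> U - K \<Longrightarrow> f x = 0"
  shows "(LINT x:K|lborel. f x * w2 x) = (LINT x:K|lborel. f2 x * w x)"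
proof -
  have UK: "open (U - K)" using U K by (simp add: compact_imp_closed open_Diff)
  have z: "has_dirderiv g b 0 x" if "x \<in> U - K" "\<And>y. y \<in> U - K \<Longrightarrow> g y = 0" 
    for x and g :: "'a \<Rightarrow> complex"
    by (rule has_dirderiv_cong_open[OF has_dirderiv_0 UK]) (use that in auto)
  have f10: "f1 x = 0" if "x \<in> U - K" for x
    using has_dirderiv_unique[OF f(1) z[of x f]] f0 that by auto
  have f20: "f2 x = 0" if "x \<in> U - K" for x
    using has_dirderiv_unique[OF f(2) z[of x f1]] f10 that by auto
  define g where "g = (\<lambda>x. if x \<in> K then f x * w1 x - f1 x * w x else 0)"
  define g' where "g' = (\<lambda>x. if x \<in> K then f x * w2 x - f2 x * w x else 0)"
  have gU: "g x = f x * w1 x - f1 x * w x" "g' x = f x * w2 x - f2 x * w x" if "x \<in> U" for x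
    using that by (auto simp: g_def g'_def f0 f10 f20)
  have "(LINT x|lborel. g' x) = 0"
  proof (rule integral_dirderiv_eq_0)
    show "has_dirderiv g b (g' x) x" for x
    proof (cases "x \<in> U")
      case True
      have "has_dirderiv (\<lambda>x. f x * w1 x - f1 x * w x) b
              (f x * w2 x + f1 x * w1 x - (f1 x * w1 x + f2 x * w x)) x"
        using True by (intro has_dirderiv_diff has_dirderiv_mult f w)
      then show ?thesis
        using has_dirderiv_cong_open[OF _ U True] gU True by fastforce
    next
      case False
      then have "x \<in> - K" "g' x = 0" "open (- K)"
        using K by (auto simp: g'_def compact_imp_closed)
      then show ?thesis
        using has_dirderiv_cong_open[OF has_dirderiv_0, of "- K" x g b] by (auto simp: g_def)
    qed
    show "continuous_on UNIV g" "continuous_on UNIV g'"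
      by (rule continuous_on_zero_extension[OF U K _ gU(1)] continuous_on_zero_extension[OF U K _ gU(2)];
          auto intro!: continuous_intros cf cw simp: g_def g'_def)+
  qed (use K in \<open>auto simp: g_def\<close>)
  also have "(LINT x|lborel. g' x) = (LINT x:K|lborel. f x * w2 x - f2 x * w x)"
    unfolding set_lebesgue_integral_def by (intro Bochner_Integration.integral_cong) (auto simp: g'_def)
  also have "\<dots> = (LINT x:K|lborel. f x * w2 x) - (LINT x:K|lborel. f2 x * w x)"
    by (intro set_integral_diff; unfold set_integrable_def; intro borel_integrable_compact K;
        intro continuous_on_subset[OF _ K(2)] continuous_intros cf cw)
  finally show ?thesis by simp
qed

section \<open>Monomials and radial functions\<close>

definition monomial :: "('n::finite \<Rightarrow> nat) \<Rightarrow> real^'n \<Rightarrow> real" where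
  "monomial \<alpha> x = (\<Prod>i\<in>UNIV. x $ i ^ \<alpha> i)"

lemma sum_Basis_axis:
  fixes f :: "real^'n::finite \<Rightarrow> 'b::comm_monoid_add"
  shows "(\<Sum>b\<in>Basis. f b) = (\<Sum>j\<in>UNIV. f (axis j 1))"
proof -
  have "(Basis :: (real^'n) set) = range (\<lambda>j. axis j 1)" by (auto simp: Basis_vec_def)
  moreover have "inj (\<lambda>j::'n. axis j (1::real))" by (auto simp: inj_on_def axis_eq_axis)
  ultimately show ?thesis using sum.reindex[of "\<lambda>j. axis j 1" UNIV f] by (simp add: o_def)
qed

lemma monomial_remove: "monomial \<alpha> x = x $ j ^ \<alpha> j * (\<Prod>i\<in>UNIV - {j}. x $ i ^ \<alpha> i)"
  unfolding monomial_def by (rule prod.remove) auto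

lemma monomial_upd: "monomial (\<alpha>(j := m)) x = x $ j ^ m * (\<Prod>i\<in>UNIV - {j}. x $ i ^ \<alpha> i)"
  unfolding monomial_remove[of "\<alpha>(j := m)" x j] by (auto intro: prod.cong)

lemma monomial_mult: "monomial \<alpha> x * monomial \<beta> x = monomial (\<lambda>i. \<alpha> i + \<beta> i) x"
  by (simp add: monomial_def power_add prod.distrib)

lemma continuous_on_monomial [continuous_intros]:
  "continuous_on S g \<Longrightarrow> continuous_on S (\<lambda>x. monomial \<alpha> (g x))"
  unfolding monomial_def by (intro continuous_intros)

lemma abs_monomial_le: "\<bar>monomial \<alpha> x\<bar> \<le> norm x ^ (\<Sum>i\<in>UNIV. \<alpha> i)"
proof -
  have "\<bar>monomial \<alpha> x\<bar> = (\<Prod>i\<in>UNIV. \<bar>x $ i\<bar> ^ \<alpha> i)"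
    by (simp add: monomial_def abs_prod power_abs)
  also have "\<dots> \<le> (\<Prod>i\<in>UNIV. norm x ^ \<alpha> i)"
    by (intro prod_mono) (auto intro: power_mono component_le_norm_cart)
  finally show ?thesis by (simp add: power_sum)
qed

lemma has_dirderiv_monomial:
  "has_dirderiv (\<lambda>x. of_real (monomial \<alpha> x) :: complex) (axis j 1)
     (of_nat (\<alpha> j) * of_real (monomial (\<alpha>(j := \<alpha> j - 1)) x)) x"
proof -
  define C where "C = (\<Prod>i\<in>UNIV - {j}. x $ i ^ \<alpha> i)"
  have "(\<lambda>t. of_real (monomial \<alpha> (x + t *\<^sub>R axis j 1)) :: complex) = (\<lambda>t. of_real ((x $ j + t) ^ \<alpha> j * C))"
    unfolding monomial_remove[of \<alpha> _ j] C_def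
    by (intro ext arg_cong[of _ _ of_real] arg_cong2[of _ _ _ _ "(*)"] prod.cong) (auto simp: axis_def)
  moreover have "((\<lambda>t. of_real ((x $ j + t) ^ \<alpha> j * C) :: complex) has_vector_derivative
      of_real (real (\<alpha> j) * x $ j ^ (\<alpha> j - 1) * C)) (at 0)"
    by (rule has_vector_derivative_of_real)
      (auto intro!: derivative_eq_intros simp flip: has_real_derivative_iff_has_vector_derivative)
  ultimately show ?thesis
    by (simp add: has_dirderiv_def monomial_upd C_def mult.assoc)
qed

text \<open>Euler's identity for homogeneous functions. It is what turns the mixed term
\<open>2 \<nabla> P \<bullet> \<nabla> \<rho>\<close> in the Laplacian of \<open>P \<rho>\<close> into the multiple \<open>2 n \<rho>' / r\<close> of \<open>P\<close>.\<close>

lemma sum_component_dirderiv_monomial: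
  "(\<Sum>j\<in>UNIV. x $ j * (real (\<alpha> j) * monomial (\<alpha>(j := \<alpha> j - 1)) x)) = real (\<Sum>j\<in>UNIV. \<alpha> j) * monomial \<alpha> x"
proof -
  have "x $ j * (real (\<alpha> j) * monomial (\<alpha>(j := \<alpha> j - 1)) x) = real (\<alpha> j) * monomial \<alpha> x" for j
    unfolding monomial_upd monomial_remove[of \<alpha> x j]
    by (cases "\<alpha> j") (auto simp: algebra_simps)
  then have "(\<Sum>j\<in>UNIV. x $ j * (real (\<alpha> j) * monomial (\<alpha>(j := \<alpha> j - 1)) x)) =
      (\<Sum>j\<in>UNIV. real (\<alpha> j) * monomial \<alpha> x)"
    by (intro sum.cong) auto
  then show ?thesis by (simp add: sum_distrib_right)
qed

lemma has_dirderiv_norm: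
  fixes x :: "'a::real_inner"
  assumes "x \<noteq> 0"
  shows "has_dirderiv norm b (x \<bullet> b / norm x) x"
proof -
  have "(norm has_derivative (\<lambda>h. h \<bullet> sgn x)) (at x)"
    using has_derivative_norm[OF assms] .
  then have "((\<lambda>t. norm (x + t *\<^sub>R b)) has_derivative (\<lambda>t. (t *\<^sub>R b) \<bullet> sgn x)) (at 0)"
    by (intro has_derivative_compose[of "\<lambda>t. x + t *\<^sub>R b" "\<lambda>t. t *\<^sub>R b" 0 UNIV norm])
      (auto intro!: derivative_eq_intros)
  then show ?thesis
    unfolding has_dirderiv_def has_vector_derivative_def
    by (simp add: sgn_div_norm inner_commute field_simps)
qed

lemma has_dirderiv_radial:
  fixes \<rho> :: "real \<Rightarrow> complex" and x :: "'a::real_inner"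
  assumes "x \<noteq> 0" "(\<rho> has_vector_derivative \<rho>') (at (norm x))"
  shows "has_dirderiv (\<lambda>x. \<rho> (norm x)) b (\<rho>' * of_real (x \<bullet> b / norm x)) x"
proof -
  have "(\<rho> \<circ> (\<lambda>t. norm (x + t *\<^sub>R b)) has_vector_derivative (x \<bullet> b / norm x) *\<^sub>R \<rho>') (at 0)"
    using has_dirderiv_norm[OF assms(1), of b] assms(2)
    by (intro vector_diff_chain_at) (auto simp: has_dirderiv_def)
  then show ?thesis
    by (simp add: has_dirderiv_def o_def scaleR_conv_of_real mult.commute)
qed

lemma has_dirderiv_direction:
  fixes x :: "'a::real_inner"
  assumes "x \<noteq> 0"
  shows "has_dirderiv (\<lambda>x. of_real (x \<bullet> b / norm x) :: complex) b
           (of_real (b \<bullet> b / norm x - (x \<bullet> b)\<^sup>2 / norm x ^ 3)) x"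
proof -
  have n: "((\<lambda>t. norm (x + t *\<^sub>R b)) has_real_derivative x \<bullet> b / norm x) (at 0)"
    using has_dirderiv_norm[OF assms, of b]
    by (simp add: has_dirderiv_def has_real_derivative_iff_has_vector_derivative)
  have i: "((\<lambda>t. (x + t *\<^sub>R b) \<bullet> b) has_real_derivative b \<bullet> b) (at 0)"
    by (auto intro!: derivative_eq_intros simp: inner_add_left)
  have "((\<lambda>t. (x + t *\<^sub>R b) \<bullet> b / norm (x + t *\<^sub>R b)) has_real_derivative
     (b \<bullet> b) / norm x - (x \<bullet> b)\<^sup>2 / norm x ^ 3) (at 0)"
    using DERIV_divide[OF i n] assms
    by (rule_tac DERIV_cong) (auto simp: field_simps power2_eq_square power3_eq_cube)
  then show ?thesis
    unfolding has_dirderiv_def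
    by (intro has_vector_derivative_of_real) (simp add: has_real_derivative_iff_has_vector_derivative)
qed

section \<open>The radial equation\<close>

text \<open>Solutions of the homogeneous radial equation that behave like \<open>exp (\<i> k r) / r ^ (n + 1)\<close> at infinity;
up to a power of \<open>r\<close> they are the spherical Hankel functions. The induction starts with
\<open>exp (\<i> k z) / z\<close>. If \<open>h\<close> solves the equation of order \<open>n\<close>, then \<open>h' / z\<close> solves that of order \<open>n + 1\<close>, and
this step multiplies the leading coefficient by \<open>\<i> k\<close>, so it stays nonzero. The argument
is complex so that both steps are computations with ordinary field derivatives.\<close>

lemma spherical_hankel:
  fixes k :: real
  assumes "k \<noteq> 0"
  shows "\<exists>h h1 c. (\<forall>z\<noteq>0. (h has_field_derivative h1 z) (at z)) \<and>
     (\<forall>z\<noteq>0. (h1 has_field_derivative - (2 * of_nat n + 2) / z * h1 z - (of_real k)\<^sup>2 * h z) (at z)) \<and>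
     c \<noteq> 0 \<and>
     ((\<lambda>r. of_real r ^ (n + 1) * exp (- \<i> * of_real (k * r)) * h (of_real r)) \<longlongrightarrow> c) at_top \<and>
     ((\<lambda>r. of_real r ^ (n + 1) * exp (- \<i> * of_real (k * r)) * h1 (of_real r)) \<longlongrightarrow> \<i> * of_real k * (c :: complex)) at_top"
proof (induction n)
  case 0
  define K :: complex where "K = of_real k"
  define h where "h = (\<lambda>z. exp (\<i> * K * z) / z)"
  define h1 where "h1 = (\<lambda>z. exp (\<i> * K * z) * (\<i> * K / z - 1 / z\<^sup>2))"
  have a: "(h has_field_derivative h1 z) (at z)" if "z \<noteq> 0" for z
    unfolding h_def h1_def using that
    by (auto intro!: derivative_eq_intros simp: field_simps power2_eq_square)
  have b: "(h1 has_field_derivative - (2 * of_nat 0 + 2) / z * h1 z - K\<^sup>2 * h z) (at z)"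
    if "z \<noteq> 0" for z
    unfolding h_def h1_def using that
    by (auto intro!: derivative_eq_intros simp: field_simps power2_eq_square power3_eq_cube)
  have c: "((\<lambda>r. of_real r ^ (0 + 1) * exp (- \<i> * of_real (k * r)) * h (of_real r)) \<longlongrightarrow> 1) at_top"
  proof (rule tendsto_eventually)
    show "\<forall>\<^sub>F r in at_top. of_real r ^ (0 + 1) * exp (- \<i> * of_real (k * r)) * h (of_real r) = 1"
      using eventually_gt_at_top[of 0]
      by eventually_elim (auto simp: h_def K_def exp_minus field_simps)
  qed
  have d: "((\<lambda>r. of_real r ^ (0 + 1) * exp (- \<i> * of_real (k * r)) * h1 (of_real r)) \<longlongrightarrow> \<i> * K * 1) at_top"
  proof (rule Lim_transform_eventually)
    have "((\<lambda>r. inverse r) \<longlongrightarrow> (0 :: real)) at_top" by (rule tendsto_inverse_0_at_top) (rule filterlim_ident)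
    from tendsto_of_real[OF this] have "((\<lambda>r. of_real (inverse r) :: complex) \<longlongrightarrow> 0) at_top" by (simp only: of_real_0)
    from tendsto_diff[OF tendsto_const this]
    show "((\<lambda>r. \<i> * K - of_real (inverse r)) \<longlongrightarrow> \<i> * K * 1) at_top"
      by (simp only: mult_1_right diff_0_right)
    show "\<forall>\<^sub>F r in at_top. \<i> * K - of_real (inverse r) =
        of_real r ^ (0 + 1) * exp (- \<i> * of_real (k * r)) * h1 (of_real r)"
      using eventually_gt_at_top[of 0]
      by eventually_elim (auto simp: h1_def K_def exp_minus field_simps power2_eq_square)
  qed
  show ?case
    using a b c d unfolding K_def
    by (intro exI[of _ h] exI[of _ h1] exI[of _ "1 :: complex"] conjI allI impI one_neq_zero)
next
  case (Suc n)
  define K :: complex where "K = of_real k"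
  obtain h h1 c where h: "\<And>z. z \<noteq> 0 \<Longrightarrow> (h has_field_derivative h1 z) (at z)"
    and h1: "\<And>z. z \<noteq> 0 \<Longrightarrow> (h1 has_field_derivative - (2 * of_nat n + 2) / z * h1 z - K\<^sup>2 * h z) (at z)"
    and c: "c \<noteq> 0"
    and l: "((\<lambda>r. of_real r ^ (n + 1) * exp (- \<i> * of_real (k * r)) * h (of_real r)) \<longlongrightarrow> c) at_top"
    and l1: "((\<lambda>r. of_real r ^ (n + 1) * exp (- \<i> * of_real (k * r)) * h1 (of_real r)) \<longlongrightarrow> \<i> * K * c) at_top"
    using Suc unfolding K_def by blast
  define H where "H = (\<lambda>z. h1 z / z)"
  define H1 where "H1 = (\<lambda>z. - (2 * of_nat n + 3) / z\<^sup>2 * h1 z - K\<^sup>2 * (h z / z))"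
  have a: "(H has_field_derivative H1 z) (at z)" if "z \<noteq> 0" for z
    unfolding H_def H1_def using that
    by (auto intro!: derivative_eq_intros h1 simp: field_simps power2_eq_square)
  have b: "(H1 has_field_derivative - (2 * of_nat (Suc n) + 2) / z * H1 z - K\<^sup>2 * H z) (at z)"
    if "z \<noteq> 0" for z
    unfolding H_def H1_def using that
    by (auto intro!: derivative_eq_intros h h1 simp: field_simps power2_eq_square power4_eq_xxxx)
  have d: "((\<lambda>r. of_real r ^ (Suc n + 1) * exp (- \<i> * of_real (k * r)) * H (of_real r)) \<longlongrightarrow> \<i> * K * c) at_top"
  proof (rule Lim_transform_eventually[OF l1])
    show "\<forall>\<^sub>F r in at_top. of_real r ^ (n + 1) * exp (- \<i> * of_real (k * r)) * h1 (of_real r) =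
        of_real r ^ (Suc n + 1) * exp (- \<i> * of_real (k * r)) * H (of_real r)"
      using eventually_gt_at_top[of 0]
      by eventually_elim (auto simp: H_def field_simps)
  qed
  have e: "((\<lambda>r. of_real r ^ (Suc n + 1) * exp (- \<i> * of_real (k * r)) * H1 (of_real r)) \<longlongrightarrow> \<i> * K * (\<i> * K * c)) at_top"
  proof (rule Lim_transform_eventually)
    have "((\<lambda>r. inverse r) \<longlongrightarrow> (0 :: real)) at_top" by (rule tendsto_inverse_0_at_top) (rule filterlim_ident)
    from tendsto_of_real[OF this] have i: "((\<lambda>r. of_real (inverse r) :: complex) \<longlongrightarrow> 0) at_top" by (simp only: of_real_0)
    show "((\<lambda>r. - (2 * of_nat n + 3) * of_real (inverse r) *
         (of_real r ^ (n + 1) * exp (- \<i> * of_real (k * r)) * h1 (of_real r))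
        - K\<^sup>2 * (of_real r ^ (n + 1) * exp (- \<i> * of_real (k * r)) * h (of_real r)))
        \<longlongrightarrow> \<i> * K * (\<i> * K * c)) at_top"
      by (rule tendsto_eq_rhs[OF tendsto_diff[OF tendsto_mult[OF tendsto_mult[OF tendsto_const i] l1]
            tendsto_mult[OF tendsto_const l]]]) (simp add: power2_eq_square algebra_simps)
    show "\<forall>\<^sub>F r in at_top. - (2 * of_nat n + 3) * of_real (inverse r) *
         (of_real r ^ (n + 1) * exp (- \<i> * of_real (k * r)) * h1 (of_real r))
        - K\<^sup>2 * (of_real r ^ (n + 1) * exp (- \<i> * of_real (k * r)) * h (of_real r)) =
        of_real r ^ (Suc n + 1) * exp (- \<i> * of_real (k * r)) * H1 (of_real r)"
      using eventually_gt_at_top[of 0]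
      by eventually_elim (auto simp: H1_def field_simps power2_eq_square)
  qed
  have f: "\<i> * K * c \<noteq> 0" using c assms by (simp add: K_def)
  show ?case
    using a b d e f unfolding K_def
    by (intro exI[of _ H] exI[of _ H1] exI[of _ "\<i> * of_real k * c"] conjI allI impI)
qed

lemma antiderivative_vanishing_left:
  fixes f :: "real \<Rightarrow> complex"
  assumes "continuous_on {0<..} f" "0 < p" "p \<le> q" "\<And>r. r > 0 \<Longrightarrow> r \<notin> {p..q} \<Longrightarrow> f r = 0"
  obtains A where "\<And>r. r > 0 \<Longrightarrow> (A has_vector_derivative f r) (at r)"
    "\<And>r. 0 < r \<Longrightarrow> r < p \<Longrightarrow> A r = 0" "\<And>r. r > q \<Longrightarrow> A r = A q"
proof -
  define A where "A = (\<lambda>r. integral {p/2..r} f)"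
  have left: "A r = 0" if "0 < r" "r < p" for r
  proof -
    have "integral {p/2..r} f = integral {p/2..r} (\<lambda>_. 0)"
      using assms that by (intro Henstock_Kurzweil_Integration.integral_cong) auto
    then show ?thesis by (simp add: A_def)
  qed
  have der: "(A has_vector_derivative f r) (at r)" if "r > 0" for r
  proof (cases "r < p")
    case True
    have "((\<lambda>_. 0) has_vector_derivative 0) (at r)" by simp
    then have "(A has_vector_derivative 0) (at r)"
      by (rule has_vector_derivative_transform_within_open[of _ _ _ "{0<..<p}"]) (use left True that in auto)
    then show ?thesis using assms(4)[of r] True that by simp
  next
    case False
    have "continuous_on {p/2..r+1} f"
      using assms(1) by (rule continuous_on_subset) (use assms(2) in auto)
    then have "(A has_vector_derivative f r) (at r within {p/2..r+1})"
      unfolding A_def by (rule integral_has_vector_derivative) (use False assms(2) in auto)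
    then have "(A has_vector_derivative f r) (at r within {p/2<..<r+1})"
      by (rule has_vector_derivative_within_subset) auto
    then show ?thesis
      using has_vector_derivative_within_open[of r "{p/2<..<r+1}"] False assms(2) by auto
  qed
  moreover have "A r = A q" if "r > q" for r
  proof -
    have "continuous_on {p/2..r} f"
      using assms(1) by (rule continuous_on_subset) (use assms(2) in auto)
    then have "A q + integral {q..r} f = A r"
      unfolding A_def using assms(2,3) that
      by (intro Henstock_Kurzweil_Integration.integral_combine integrable_continuous_real) auto
    moreover have "integral {q..r} f = integral {q..r} (\<lambda>_. 0)"
      using assms by (intro integral_spike[of "{q}"]) auto
    ultimately show ?thesis by simp
  qed
  ultimately show ?thesis using left that by blast
qed

text \<open>The function \<open>\<rho>\<close> solves \<open>\<rho>'' + (2 n + 2) / r \<rho>' + k\<^sup>2 \<rho> = \<psi>\<close> on the positive half-line, written as a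
first-order system with \<open>\<rho>1\<close> as the derivative. This is the equation for which \<open>P(x) \<rho>(|x|)\<close>, with \<open>P\<close> a
harmonic homogeneous polynomial of degree \<open>n\<close> in three variables, solves the inhomogeneous Helmholtz
equation with right-hand side \<open>P(x) \<psi>(|x|)\<close>.\<close>

definition radial_solution ::
  "real \<Rightarrow> nat \<Rightarrow> (real \<Rightarrow> complex) \<Rightarrow> (real \<Rightarrow> complex) \<Rightarrow> (real \<Rightarrow> complex) \<Rightarrow> bool" where
  "radial_solution k n \<psi> \<rho> \<rho>1 \<longleftrightarrow> (\<forall>r>0. (\<rho> has_vector_derivative \<rho>1 r) (at r)) \<and>
     (\<forall>r>0. (\<rho>1 has_vector_derivative
        \<psi> r - of_real ((2 * real n + 2) / r) * \<rho>1 r - of_real (k\<^sup>2) * \<rho> r) (at r))"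

text \<open>Variation of parameters with the outgoing solution \<open>g\<close> from lemma \<open>spherical_hankel\<close> and its conjugate. Their
Wronskian times \<open>r ^ (2 n + 2)\<close> is constant, and its limit at infinity, \<open>2 \<i> k |c|\<^sup>2\<close>, is not zero. The
two coefficient functions are constant on either side of the support of \<open>\<psi>\<close>. Normalising them to vanish
on the left gives the first solution, which on the right is a combination of \<open>g\<close> and its conjugate
and hence decays; normalising them to vanish on the right gives the second one.\<close>

lemma radial_ode:
  fixes \<psi> :: "real \<Rightarrow> complex"
  assumes k: "k \<noteq> 0" and \<psi>: "continuous_on {0<..} \<psi>" and pq: "0 < p" "p \<le> q"
    and supp: "\<And>r. r > 0 \<Longrightarrow> r \<notin> {p..q} \<Longrightarrow> \<psi> r = 0"
  shows "\<exists>\<rho> \<rho>1. radial_solution k n \<psi> \<rho> \<rho>1 \<and> (\<forall>r. 0 < r \<and> r < p \<longrightarrow> \<rho> r = 0) \<and>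
     (\<exists>C R. \<forall>r\<ge>R. norm (\<rho> r) \<le> C / r ^ (n + 1) \<and> norm (\<rho>1 r) \<le> C / r ^ (n + 1))"
    and "\<exists>\<rho> \<rho>1. radial_solution k n \<psi> \<rho> \<rho>1 \<and> (\<forall>r>q. \<rho> r = 0)"
proof -
  define K :: complex where "K = of_real k"
  obtain h h1 c where h: "\<And>z. z \<noteq> 0 \<Longrightarrow> (h has_field_derivative h1 z) (at z)"
    and h1: "\<And>z. z \<noteq> 0 \<Longrightarrow> (h1 has_field_derivative - (2 * of_nat n + 2) / z * h1 z - K\<^sup>2 * h z) (at z)"
    and c: "c \<noteq> 0"
    and l: "((\<lambda>r. of_real r ^ (n + 1) * exp (- \<i> * of_real (k * r)) * h (of_real r)) \<longlongrightarrow> c) at_top"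
    and l1: "((\<lambda>r. of_real r ^ (n + 1) * exp (- \<i> * of_real (k * r)) * h1 (of_real r)) \<longlongrightarrow> \<i> * K * c) at_top"
    using spherical_hankel[OF k, of n] unfolding K_def by blast
  define g where "g = (\<lambda>r. h (of_real r))"
  define g1 where "g1 = (\<lambda>r. h1 (of_real r))"
  define \<kappa> where "\<kappa> = (\<lambda>r. complex_of_real ((2 * real n + 2) / r))"
  have g: "(g has_vector_derivative g1 r) (at r)" if "r > 0" for r
    unfolding g_def g1_def using that by (intro has_vector_derivative_real_field h) auto
  have g1: "(g1 has_vector_derivative - \<kappa> r * g1 r - K\<^sup>2 * g r) (at r)" if "r > 0" for r
    unfolding g_def g1_def
    by (rule has_vector_derivative_eq_rhs, rule has_vector_derivative_real_field, rule h1)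
      (use that in \<open>simp_all add: \<kappa>_def field_simps\<close>)
  have cg: "((\<lambda>r. cnj (g r)) has_vector_derivative cnj (g1 r)) (at r)" if "r > 0" for r
    using g[OF that] by (rule has_vector_derivative_cnj)
  have cg1: "((\<lambda>r. cnj (g1 r)) has_vector_derivative - \<kappa> r * cnj (g1 r) - K\<^sup>2 * cnj (g r)) (at r)" if "r > 0" for r
    using has_vector_derivative_cnj[OF g1[OF that]] by (simp add: \<kappa>_def K_def)
  define W where "W = (\<lambda>r. g1 r * cnj (g r) - g r * cnj (g1 r))"
  have W: "(W has_vector_derivative - \<kappa> r * W r) (at r)" if "r > 0" for r
    unfolding W_def
    by (rule has_vector_derivative_eq_rhs, (rule derivative_intros g g1 cg cg1 that)+)
      (simp add: algebra_simps)
  define V where "V = (\<lambda>r. of_real (r ^ (2 * n + 2)) * W r)"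
  have pw: "((\<lambda>r. complex_of_real (r ^ (2 * n + 2))) has_vector_derivative
      of_real (r ^ (2 * n + 2)) * \<kappa> r) (at r)" if "r > 0" for r
  proof -
    have "((\<lambda>r. r ^ (2 * n + 2)) has_real_derivative r ^ (2 * n + 2) * ((2 * real n + 2) / r)) (at r)"
      by (rule DERIV_cong[OF DERIV_pow]) (use that in \<open>simp add: field_simps\<close>)
    then have "((\<lambda>r. complex_of_real (r ^ (2 * n + 2))) has_vector_derivative
      of_real (r ^ (2 * n + 2) * ((2 * real n + 2) / r))) (at r)"
      by (intro has_vector_derivative_of_real) (simp add: has_real_derivative_iff_has_vector_derivative)
    then show ?thesis by (simp only: \<kappa>_def of_real_mult)
  qed
  have V0: "(V has_vector_derivative 0) (at r)" if "r > 0" for r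
    unfolding V_def
    by (rule has_vector_derivative_eq_rhs, rule has_vector_derivative_mult[OF pw[OF that] W[OF that]])
      (simp add: algebra_simps)
  obtain \<omega> where \<omega>: "\<And>r. r > 0 \<Longrightarrow> V r = \<omega>"
  proof -
    have "\<And>r. r \<in> {0<..} \<Longrightarrow> (V has_vector_derivative 0) (at r within {0<..})"
      using V0 by (auto intro: has_vector_derivative_at_within)
    from has_vector_derivative_zero_constant[OF convex_real_interval(3) this]
    obtain a where "\<And>r. r \<in> {0<..} \<Longrightarrow> V r = a" by blast
    then show ?thesis using that by auto
  qed
  \<comment> \<open>the oscillating factor \<open>exp (- \<i> k r)\<close> has modulus 1 and cancels in the Wronskian\<close>
  have "\<omega> = 2 * \<i> * K * (c * cnj c)"
  proof (rule tendsto_unique[OF trivial_limit_at_top_linorder])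
    define e where "e = (\<lambda>r. exp (- \<i> * of_real (k * r)))"
    have ee: "e r * cnj (e r) = 1" for r
      by (simp add: e_def exp_cnj flip: exp_add)
    have "((\<lambda>r. (of_real r ^ (n + 1) * e r * g1 r) * cnj (of_real r ^ (n + 1) * e r * g r)
        - (of_real r ^ (n + 1) * e r * g r) * cnj (of_real r ^ (n + 1) * e r * g1 r))
        \<longlongrightarrow> (\<i> * K * c) * cnj c - c * cnj (\<i> * K * c)) at_top"
      unfolding e_def g_def g1_def by (intro tendsto_intros l l1)
    moreover have "(of_real r ^ (n + 1) * e r * g1 r) * cnj (of_real r ^ (n + 1) * e r * g r)
        - (of_real r ^ (n + 1) * e r * g r) * cnj (of_real r ^ (n + 1) * e r * g1 r) = V r" for r
    proof -
      have "(of_real r ^ (n + 1) * e r * g1 r) * cnj (of_real r ^ (n + 1) * e r * g r)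
        - (of_real r ^ (n + 1) * e r * g r) * cnj (of_real r ^ (n + 1) * e r * g1 r)
        = (of_real r ^ (n + 1) * of_real r ^ (n + 1)) * (e r * cnj (e r)) * W r"
        by (simp add: W_def algebra_simps)
      also have "\<dots> = V r"
        by (simp only: ee V_def) (simp add: power_add mult_2)
      finally show ?thesis .
    qed
    ultimately have "(V \<longlongrightarrow> (\<i> * K * c) * cnj c - c * cnj (\<i> * K * c)) at_top"
      by simp
    then show "(V \<longlongrightarrow> 2 * \<i> * K * (c * cnj c)) at_top"
      by (simp add: K_def algebra_simps)
    show "(V \<longlongrightarrow> \<omega>) at_top"
      by (rule tendsto_eventually, rule eventually_mono[OF eventually_gt_at_top[of 0]]) (rule \<omega>)
  qed
  then have \<omega>0: "\<omega> \<noteq> 0" using c k by (simp add: K_def)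
  define F where "F = (\<lambda>r. \<psi> r * of_real (r ^ (2 * n + 2)) / \<omega>)"
  have FW: "F r * W r = \<psi> r" if "r > 0" for r
    using \<omega>[OF that] \<omega>0 by (simp add: F_def V_def field_simps)
  have cont: "continuous_on {0<..} g" 
    using g by (intro continuous_at_imp_continuous_on ballI) (auto intro: has_vector_derivative_continuous)
  obtain A where A: "\<And>r. r > 0 \<Longrightarrow> (A has_vector_derivative cnj (g r) * F r) (at r)"
    "\<And>r. 0 < r \<Longrightarrow> r < p \<Longrightarrow> A r = 0" "\<And>r. r > q \<Longrightarrow> A r = A q"
  proof (rule antiderivative_vanishing_left[of "\<lambda>r. cnj (g r) * F r" p q])
    show "continuous_on {0<..} (\<lambda>r. cnj (g r) * F r)"
      unfolding F_def by (intro continuous_intros cont \<psi>) (use \<omega>0 in auto)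
  qed (use pq supp in \<open>auto simp: F_def\<close>)
  obtain B where B: "\<And>r. r > 0 \<Longrightarrow> (B has_vector_derivative g r * F r) (at r)"
    "\<And>r. 0 < r \<Longrightarrow> r < p \<Longrightarrow> B r = 0" "\<And>r. r > q \<Longrightarrow> B r = B q"
  proof (rule antiderivative_vanishing_left[of "\<lambda>r. g r * F r" p q])
    show "continuous_on {0<..} (\<lambda>r. g r * F r)"
      unfolding F_def by (intro continuous_intros cont \<psi>) (use \<omega>0 in auto)
  qed (use pq supp in \<open>auto simp: F_def\<close>)
  define \<rho> where "\<rho> = (\<lambda>a b r. g r * (A r - a) - cnj (g r) * (B r - b))"
  define \<rho>1 where "\<rho>1 = (\<lambda>a b r. g1 r * (A r - a) - cnj (g1 r) * (B r - b))"
  have S: "radial_solution k n \<psi> (\<rho> a b) (\<rho>1 a b)" for a b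
    unfolding radial_solution_def
  proof (intro conjI allI impI)
    fix r :: real assume r: "r > 0"
    have A': "((\<lambda>r. A r - a) has_vector_derivative cnj (g r) * F r) (at r)"
      using A(1)[OF r] by (auto intro!: derivative_eq_intros)
    have B': "((\<lambda>r. B r - b) has_vector_derivative g r * F r) (at r)"
      using B(1)[OF r] by (auto intro!: derivative_eq_intros)
    show "(\<rho> a b has_vector_derivative \<rho>1 a b r) (at r)"
      unfolding \<rho>_def
      by (rule has_vector_derivative_eq_rhs, (rule has_vector_derivative_diff has_vector_derivative_mult g[OF r] cg[OF r] A' B')+)
        (simp add: \<rho>1_def algebra_simps)
    have "(\<rho>1 a b has_vector_derivative F r * W r - \<kappa> r * \<rho>1 a b r - K\<^sup>2 * \<rho> a b r) (at r)"
      unfolding \<rho>1_def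
      by (rule has_vector_derivative_eq_rhs, (rule has_vector_derivative_diff has_vector_derivative_mult g1[OF r] cg1[OF r] A' B')+)
        (simp add: \<rho>_def W_def algebra_simps)
    then show "(\<rho>1 a b has_vector_derivative
        \<psi> r - of_real ((2 * real n + 2) / r) * \<rho>1 a b r - of_real (k\<^sup>2) * \<rho> a b r) (at r)"
      using FW[OF r] by (simp add: \<kappa>_def K_def)
  qed
  have "\<forall>\<^sub>F r in at_top. norm (g r) \<le> (norm c + 1) / r ^ (n + 1)"
  proof -
    have "\<forall>\<^sub>F r in at_top. norm (of_real r ^ (n + 1) * exp (- \<i> * of_real (k * r)) * h (of_real r)) < norm c + 1"
      by (rule order_tendstoD(2)[OF tendsto_norm[OF l]]) auto
    then show ?thesis using eventually_gt_at_top[of 0]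
      by eventually_elim (simp add: norm_mult norm_power g_def field_simps)
  qed
  moreover have "\<forall>\<^sub>F r in at_top. norm (g1 r) \<le> (norm (\<i> * K * c) + 1) / r ^ (n + 1)"
  proof -
    have "\<forall>\<^sub>F r in at_top. norm (of_real r ^ (n + 1) * exp (- \<i> * of_real (k * r)) * h1 (of_real r)) < norm (\<i> * K * c) + 1"
      by (rule order_tendstoD(2)[OF tendsto_norm[OF l1]]) auto
    then show ?thesis using eventually_gt_at_top[of 0]
      by eventually_elim (simp add: norm_mult norm_power g1_def field_simps)
  qed
  ultimately have "\<forall>\<^sub>F r in at_top. r > q \<and> r > 0 \<and> norm (g r) \<le> (norm c + 1) / r ^ (n + 1) \<and>
      norm (g1 r) \<le> (norm (\<i> * K * c) + 1) / r ^ (n + 1)"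
    using eventually_gt_at_top[of q] eventually_gt_at_top[of "0::real"] by eventually_elim auto
  then obtain R where R: "\<And>r. r \<ge> R \<Longrightarrow> r > q \<and> r > 0 \<and> norm (g r) \<le> (norm c + 1) / r ^ (n + 1) \<and>
      norm (g1 r) \<le> (norm (\<i> * K * c) + 1) / r ^ (n + 1)"
    unfolding eventually_at_top_linorder by blast
  define M where "M = max (norm c + 1) (norm (\<i> * K * c) + 1)"
  define N where "N = norm (A q) + norm (B q)"
  have "norm (\<rho> 0 0 r) \<le> M * N / r ^ (n + 1) \<and> norm (\<rho>1 0 0 r) \<le> M * N / r ^ (n + 1)" if "r \<ge> R" for r
  proof -
    note Rr = R[OF that]
    have AB: "A r = A q" "B r = B q" using A(3) B(3) Rr by blast+
    have M: "norm (g r) \<le> M / r ^ (n + 1)" "norm (g1 r) \<le> M / r ^ (n + 1)"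
    proof -
      have "(norm c + 1) / r ^ (n + 1) \<le> M / r ^ (n + 1)"
        "(norm (\<i> * K * c) + 1) / r ^ (n + 1) \<le> M / r ^ (n + 1)"
        using Rr by (intro divide_right_mono; simp add: M_def)+
      with Rr show "norm (g r) \<le> M / r ^ (n + 1)" "norm (g1 r) \<le> M / r ^ (n + 1)"
        by linarith+
    qed
    have tri: "norm (x * A q - cnj x * B q) \<le> norm x * N" for x
      unfolding N_def using norm_triangle_ineq4[of "x * A q" "cnj x * B q"]
      by (simp add: norm_mult algebra_simps)
    have N: "N \<ge> 0" by (simp add: N_def)
    show ?thesis
      using tri[of "g r"] tri[of "g1 r"] mult_right_mono[OF M(1) N] mult_right_mono[OF M(2) N]
      by (auto simp: \<rho>_def \<rho>1_def AB)
  qed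
  moreover have "\<rho> 0 0 r = 0" if "0 < r" "r < p" for r
    using A(2) B(2) that by (simp add: \<rho>_def)
  ultimately show "\<exists>\<rho> \<rho>1. radial_solution k n \<psi> \<rho> \<rho>1 \<and> (\<forall>r. 0 < r \<and> r < p \<longrightarrow> \<rho> r = 0) \<and>
     (\<exists>C R. \<forall>r\<ge>R. norm (\<rho> r) \<le> C / r ^ (n + 1) \<and> norm (\<rho>1 r) \<le> C / r ^ (n + 1))"
    using S[of 0 0] by blast
  have "\<rho> (A q) (B q) r = 0" if "r > q" for r
    using A(3) B(3) that by (simp add: \<rho>_def)
  then show "\<exists>\<rho> \<rho>1. radial_solution k n \<psi> \<rho> \<rho>1 \<and> (\<forall>r>q. \<rho> r = 0)"
    using S[of "A q" "B q"] by blast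
qed

section \<open>Moments of a Helmholtz solution\<close>

definition shell :: "real \<Rightarrow> real \<Rightarrow> 'a::real_normed_vector set" where
  "shell p q = {x. norm x \<in> {p..q}}"

text \<open>Omitting the origin makes only the values of \<open>\<psi>\<close> at positive radii matter.\<close>

definition moment :: "(real^3 \<Rightarrow> complex) \<Rightarrow> (3 \<Rightarrow> nat) \<Rightarrow> (real \<Rightarrow> complex) \<Rightarrow> complex" where
  "moment w \<alpha> \<psi> = (LINT x:- {0}|lborel. w x * (of_real (monomial \<alpha> x) * \<psi> (norm x)))"

lemma compact_shell: "compact (shell p q :: 'a::euclidean_space set)"
proof -
  have "(shell p q :: 'a set) = cball 0 q - ball 0 p" by (auto simp: shell_def)
  then show ?thesis by (simp add: compact_diff)
qed

lemma continuous_on_radial: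
  assumes "continuous_on {0<..} \<psi>" "0 \<notin> S"
  shows "continuous_on S (\<lambda>x::'a::real_normed_vector. \<psi> (norm x))"
  by (rule continuous_on_compose2[OF assms(1)]) (use assms(2) in \<open>auto intro!: continuous_intros\<close>)

lemma moment_eq_shell:
  assumes "0 < p" "\<And>r. 0 < r \<Longrightarrow> r \<notin> {p..q} \<Longrightarrow> \<psi> r = 0"
  shows "moment w \<alpha> \<psi> = (LINT x:shell p q|lborel. w x * (of_real (monomial \<alpha> x) * \<psi> (norm x)))"
  unfolding moment_def set_lebesgue_integral_def
  by (intro Bochner_Integration.integral_cong) (use assms in \<open>auto simp: shell_def indicator_def\<close>)

lemma moment_cong:
  assumes "\<And>x. x \<noteq> 0 \<Longrightarrow> w x * \<psi> (norm x) = w x * \<psi>' (norm x)"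
  shows "moment w \<alpha> \<psi> = moment w \<alpha> \<psi>'"
proof -
  have "w x * (of_real (monomial \<alpha> x) * \<psi> (norm x)) = w x * (of_real (monomial \<alpha> x) * \<psi>' (norm x))"
    if "x \<noteq> 0" for x
    using arg_cong[OF assms[OF that], of "(*) (of_real (monomial \<alpha> x))"] by (simp add: algebra_simps)
  then show ?thesis
    unfolding moment_def set_lebesgue_integral_def
    by (intro Bochner_Integration.integral_cong) (auto simp: indicator_def)
qed

lemma moment_add:
  assumes pq: "0 < p" and w: "continuous_on (shell p q) w"
    and \<psi>: "continuous_on {0<..} \<psi>" "\<And>r. 0 < r \<Longrightarrow> r \<notin> {p..q} \<Longrightarrow> \<psi> r = 0"
    and \<psi>': "continuous_on {0<..} \<psi>'" "\<And>r. 0 < r \<Longrightarrow> r \<notin> {p..q} \<Longrightarrow> \<psi>' r = 0"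
  shows "moment w \<alpha> (\<lambda>r. \<psi> r + \<psi>' r) = moment w \<alpha> \<psi> + moment w \<alpha> \<psi>'"
proof -
  have 0: "0 \<notin> (shell p q :: (real^3) set)" using pq by (auto simp: shell_def)
  have i: "set_integrable lborel (shell p q) (\<lambda>x. w x * (of_real (monomial \<alpha> x) * \<phi> (norm x)))"
    if "continuous_on {0<..} \<phi>" for \<phi>
    unfolding set_integrable_def
    by (intro borel_integrable_compact compact_shell continuous_intros w continuous_on_radial that 0)
  show ?thesis
  proof -
    have "moment w \<alpha> (\<lambda>r. \<psi> r + \<psi>' r)
        = (LINT x:shell p q|lborel. w x * (of_real (monomial \<alpha> x) * (\<psi> (norm x) + \<psi>' (norm x))))"
      by (rule moment_eq_shell[OF pq]) (use \<psi>(2) \<psi>'(2) in simp)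
    also have "\<dots> = (LINT x:shell p q|lborel. w x * (of_real (monomial \<alpha> x) * \<psi> (norm x)))
        + (LINT x:shell p q|lborel. w x * (of_real (monomial \<alpha> x) * \<psi>' (norm x)))"
      using set_integral_add(2)[OF i[OF \<psi>(1)] i[OF \<psi>'(1)]] by (simp add: distrib_left)
    also have "\<dots> = moment w \<alpha> \<psi> + moment w \<alpha> \<psi>'"
      using \<psi>(2) \<psi>'(2) by (intro arg_cong2[of _ _ _ _ "(+)"] moment_eq_shell[OF pq, symmetric]) auto
    finally show ?thesis .
  qed
qed

text \<open>Green's identity for \<open>w\<close> and \<open>P(x) \<rho>(|x|)\<close>, where \<open>P\<close> is the monomial. The Laplacian of the product is
\<open>P (\<rho>'' + (2 n + 2) / r \<rho>') + (\<Delta> P) \<rho>\<close>: of the coefficient of \<open>\<rho>' / r\<close>, the part 2 comes from the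
Laplacian of a radial function in three dimensions and the part \<open>2 n\<close> from Euler's identity.\<close>

lemma moment_radial_operator:
  fixes w :: "real^3 \<Rightarrow> complex" and \<rho> \<rho>1 \<rho>2 :: "real \<Rightarrow> complex" and \<alpha> :: "3 \<Rightarrow> nat"
  assumes U: "open U" "C2_on U w" and pde: "\<And>x. x \<in> U \<Longrightarrow> laplacian w x + of_real (k\<^sup>2) * w x = 0"
    and p: "0 < p" and sub: "shell p q \<subseteq> U"
    and \<rho>: "\<And>r. 0 < r \<Longrightarrow> (\<rho> has_vector_derivative \<rho>1 r) (at r)"
    and \<rho>1: "\<And>r. 0 < r \<Longrightarrow> (\<rho>1 has_vector_derivative \<rho>2 r) (at r)"
    and \<rho>2: "continuous_on {0<..} \<rho>2"
    and supp: "\<And>r. 0 < r \<Longrightarrow> r \<notin> {p..q} \<Longrightarrow> \<rho> r = 0"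
  shows "moment w \<alpha> (\<lambda>r. \<rho>2 r + of_real ((2 * real (\<Sum>j\<in>UNIV. \<alpha> j) + 2) / r) * \<rho>1 r + of_real (k\<^sup>2) * \<rho> r) =
    - (\<Sum>j\<in>UNIV. of_nat (\<alpha> j * (\<alpha> j - 1)) * moment w (\<alpha>(j := \<alpha> j - 2)) \<rho>)"
proof -
  define n where "n = (\<Sum>j\<in>UNIV. \<alpha> j)"
  define K where "K = (shell p q :: (real^3) set)"
  define V where "V = U - {0}"
  define m where "m = (\<lambda>\<beta> x. complex_of_real (monomial (\<beta> :: 3 \<Rightarrow> nat) x))"
  define e where "e = (\<lambda>j::3. axis j 1 :: real^3)"
  define dd where "dd = (\<lambda>j (x::real^3). complex_of_real (x \<bullet> e j / norm x))"
  define dd1 where "dd1 = (\<lambda>j (x::real^3). complex_of_real (e j \<bullet> e j / norm x - (x \<bullet> e j)\<^sup>2 / norm x ^ 3))"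
  define m1 where "m1 = (\<lambda>j x. of_nat (\<alpha> j) * m (\<alpha>(j := \<alpha> j - 1)) x)"
  define m2 where "m2 = (\<lambda>j x. of_nat (\<alpha> j) * (of_nat (\<alpha> j - 1) * m (\<alpha>(j := \<alpha> j - 2)) x))"
  define f where "f = (\<lambda>x::real^3. m \<alpha> x * \<rho> (norm x))"
  define f1 where "f1 = (\<lambda>j x. m \<alpha> x * (\<rho>1 (norm x) * dd j x) + m1 j x * \<rho> (norm x))"
  define f2 where "f2 = (\<lambda>j x. (m \<alpha> x * (\<rho>1 (norm x) * dd1 j x + (\<rho>2 (norm x) * dd j x) * dd j x)
     + m1 j x * (\<rho>1 (norm x) * dd j x)) + (m1 j x * (\<rho>1 (norm x) * dd j x) + m2 j x * \<rho> (norm x)))"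
  define w1 where "w1 = (\<lambda>j x. frechet_derivative w (at x) (e j))"
  define w2 where "w2 = (\<lambda>j x. frechet_derivative (\<lambda>y. frechet_derivative w (at y) (e j)) (at x) (e j))"
  have V: "open V" "K \<subseteq> V" "0 \<notin> V" "V \<subseteq> U"
    using U sub p by (auto simp: V_def K_def shell_def)
  have K: "compact K" by (simp add: K_def compact_shell)
  have Vpos: "x \<noteq> 0" "norm x > 0" if "x \<in> V" for x using that by (auto simp: V_def)
  have dm: "has_dirderiv (m \<beta>) (e j) (of_nat (\<beta> j) * m (\<beta>(j := \<beta> j - 1)) x) x" for \<beta> j x
    unfolding m_def e_def using has_dirderiv_monomial by blast
  have df: "has_dirderiv f (e j) (f1 j x) x" if "x \<in> V" for j x
    unfolding f_def f1_def dd_def m1_def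
    by (rule has_dirderiv_mult[OF dm] has_dirderiv_radial \<rho> Vpos[OF that])+
  have dm1: "has_dirderiv (m1 j) (e j) (m2 j x) x" for j x
    using has_dirderiv_cmult[OF dm[of "\<alpha>(j := \<alpha> j - 1)" j x], of "of_nat (\<alpha> j)"]
    by (simp add: m1_def m2_def numeral_2_eq_2)
  have dm0: "has_dirderiv (m \<alpha>) (e j) (m1 j x) x" for j x
    using dm by (simp add: m1_def)
  have d\<rho>: "has_dirderiv (\<lambda>x. \<rho> (norm x)) (e j) (\<rho>1 (norm x) * dd j x) x"
    "has_dirderiv (\<lambda>x. \<rho>1 (norm x)) (e j) (\<rho>2 (norm x) * dd j x) x"
    "has_dirderiv (dd j) (e j) (dd1 j x) x" if "x \<in> V" for j x
    using Vpos[OF that] unfolding dd_def dd1_def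
    by (auto intro!: has_dirderiv_radial has_dirderiv_direction \<rho> \<rho>1 simp del: of_real_divide of_real_diff)
  have df1: "has_dirderiv (f1 j) (e j) (f2 j x) x" if "x \<in> V" for j x
    unfolding f1_def f2_def
    by (intro has_dirderiv_add has_dirderiv_mult dm0 dm1 d\<rho> that)
  have cm: "continuous_on V (m \<beta>)" for \<beta>
    unfolding m_def by (intro continuous_intros)
  have c\<rho>: "continuous_on {0<..} \<rho>" "continuous_on {0<..} \<rho>1"
    using \<rho> \<rho>1 by (auto intro!: continuous_at_imp_continuous_on has_vector_derivative_continuous)
  have c: "continuous_on V (\<lambda>x. \<rho> (norm x))" "continuous_on V (\<lambda>x. \<rho>1 (norm x))" "continuous_on V (\<lambda>x. \<rho>2 (norm x))"
    using c\<rho> \<rho>2 V by (auto intro: continuous_on_radial)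
  have cd: "continuous_on V (dd j)" "continuous_on V (dd1 j)" for j
    unfolding dd_def dd1_def using Vpos by (auto intro!: continuous_intros)
  have cf: "continuous_on V f" "continuous_on V (f1 j)" "continuous_on V (f2 j)" for j
    unfolding f_def f1_def f2_def m1_def m2_def by (intro continuous_intros cm c cd)+
  have C2: "C2_on V w" using C2_on_subset U(2) V(4) by blast
  have cw: "continuous_on V w" "continuous_on V (w1 j)" "continuous_on V (w2 j)" for j
    unfolding w1_def w2_def using C2_on_continuous[OF C2] by auto
  have green: "(LINT x:K|lborel. f x * w2 j x) = (LINT x:K|lborel. f2 j x * w x)" for j
  proof (rule green_dirderiv[OF V(1) K V(2) df df1 _ _ cf cw])
    show "has_dirderiv w (e j) (w1 j x) x" "has_dirderiv (w1 j) (e j) (w2 j x) x" if "x \<in> V" for x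
      unfolding w1_def w2_def using C2_on_dirderiv[OF C2 that] by auto
    show "f x = 0" if "x \<in> V - K" for x
      using supp[of "norm x"] that Vpos[of x] by (auto simp: f_def K_def shell_def)
  qed
  have int: "set_integrable lborel K g" if "continuous_on V g" for g :: "real^3 \<Rightarrow> complex"
    unfolding set_integrable_def
    by (intro borel_integrable_compact K continuous_on_subset[OF that V(2)])
  have intsum: "(LINT x:K|lborel. (\<Sum>j\<in>UNIV. g j x)) = (\<Sum>j\<in>UNIV. LINT x:K|lborel. g j x)"
    if "\<And>j. continuous_on V (g j)" for g :: "3 \<Rightarrow> real^3 \<Rightarrow> complex"
    using int[OF that] unfolding set_integrable_def set_lebesgue_integral_def
    by (simp only: scaleR_sum_right Bochner_Integration.integral_sum)
  have "(LINT x:K|lborel. f x * (\<Sum>j\<in>UNIV. w2 j x)) = (LINT x:K|lborel. (\<Sum>j\<in>UNIV. f2 j x) * w x)"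
    unfolding sum_distrib_left sum_distrib_right using green
    by (subst (1 2) intsum) (auto intro!: continuous_intros cf cw)
  moreover have "(LINT x:K|lborel. f x * (\<Sum>j\<in>UNIV. w2 j x)) = (LINT x:K|lborel. - of_real (k\<^sup>2) * (f x * w x))"
  proof (rule set_lebesgue_integral_cong)
    show "\<forall>x. x \<in> K \<longrightarrow> f x * (\<Sum>j\<in>UNIV. w2 j x) = - of_real (k\<^sup>2) * (f x * w x)"
    proof (intro allI impI)
      fix x assume "x \<in> K"
      then have "x \<in> U" using V by auto
      have "(\<Sum>j\<in>UNIV. w2 j x) = laplacian w x"
        unfolding laplacian_def sum_Basis_axis w2_def e_def ..
      also have "\<dots> = - of_real (k\<^sup>2) * w x" 
        using pde[OF \<open>x \<in> U\<close>] by (simp add: eq_neg_iff_add_eq_0)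
      finally show "f x * (\<Sum>j\<in>UNIV. w2 j x) = - of_real (k\<^sup>2) * (f x * w x)" by simp
    qed
  qed (use K in \<open>auto simp: compact_imp_closed\<close>)
  ultimately have "(LINT x:K|lborel. (\<Sum>j\<in>UNIV. f2 j x) * w x) = - of_real (k\<^sup>2) * (LINT x:K|lborel. f x * w x)"
    by (simp only: set_integral_mult_right)
  then have eq: "(LINT x:K|lborel. (\<Sum>j\<in>UNIV. f2 j x) * w x) + (LINT x:K|lborel. of_real (k\<^sup>2) * (f x * w x)) = 0"
    by simp
  define L where "L = (\<lambda>r. \<rho>2 r + of_real ((2 * real n + 2) / r) * \<rho>1 r + of_real (k\<^sup>2) * \<rho> r)"
  have alg: "(\<Sum>j\<in>UNIV. f2 j x) + of_real (k\<^sup>2) * f x = m \<alpha> x * L (norm x) + (\<Sum>j\<in>UNIV. m2 j x) * \<rho> (norm x)"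
    if "x \<in> V" for x
  proof -
    have nx: "norm x \<noteq> 0" using Vpos[OF that] by simp
    have xe: "x \<bullet> e j = x $ j" for j by (simp add: e_def inner_axis)
    have ee: "e j \<bullet> e j = 1" for j by (simp add: e_def inner_axis)
    have sq: "(\<Sum>j\<in>UNIV. (x $ j)\<^sup>2) = (norm x)\<^sup>2"
      unfolding power2_norm_eq_inner inner_vec_def by (simp add: power2_eq_square)
    have s1: "(\<Sum>j\<in>UNIV. dd j x * dd j x) = 1"
    proof -
      have "(\<Sum>j\<in>UNIV. dd j x * dd j x) = of_real (\<Sum>j\<in>UNIV. (x $ j)\<^sup>2 / (norm x)\<^sup>2)"
        by (simp add: dd_def xe power2_eq_square)
      also have "(\<Sum>j\<in>UNIV. (x $ j)\<^sup>2 / (norm x)\<^sup>2) = 1"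
        using nx sq by (simp flip: sum_divide_distrib)
      finally show ?thesis by simp
    qed
    have s2: "(\<Sum>j\<in>UNIV. dd1 j x) = of_real (2 / norm x)"
    proof -
      have "(\<Sum>j\<in>UNIV. dd1 j x) = of_real (\<Sum>j\<in>(UNIV :: 3 set). 1 / norm x - (x $ j)\<^sup>2 / norm x ^ 3)"
        by (simp add: dd1_def xe ee)
      also have "(\<Sum>j\<in>(UNIV :: 3 set). 1 / norm x - (x $ j)\<^sup>2 / norm x ^ 3) = 3 / norm x - (norm x)\<^sup>2 / norm x ^ 3"
        by (simp add: sum_subtractf sq flip: sum_divide_distrib)
      also have "\<dots> = 2 / norm x"
        using nx by (simp add: field_simps power2_eq_square power3_eq_cube)
      finally show ?thesis .
    qed
    have s3: "(\<Sum>j\<in>UNIV. m1 j x * dd j x) = of_real (real n / norm x) * m \<alpha> x"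
    proof -
      have "(\<Sum>j\<in>UNIV. m1 j x * dd j x) = of_real ((\<Sum>j\<in>UNIV. x $ j * (real (\<alpha> j) * monomial (\<alpha>(j := \<alpha> j - 1)) x)) / norm x)"
        by (simp add: m1_def dd_def m_def xe sum_divide_distrib algebra_simps)
      also have "\<dots> = of_real (real n / norm x) * m \<alpha> x"
        unfolding sum_component_dirderiv_monomial by (simp add: n_def m_def)
      finally show ?thesis .
    qed
    have "(\<Sum>j\<in>UNIV. f2 j x) = m \<alpha> x * (\<rho>1 (norm x) * (\<Sum>j\<in>UNIV. dd1 j x) + \<rho>2 (norm x) * (\<Sum>j\<in>UNIV. dd j x * dd j x))
        + 2 * \<rho>1 (norm x) * (\<Sum>j\<in>UNIV. m1 j x * dd j x) + (\<Sum>j\<in>UNIV. m2 j x) * \<rho> (norm x)"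
      unfolding f2_def sum.distrib sum_distrib_left sum_distrib_right
      by (simp add: sum.distrib algebra_simps sum_distrib_left)
    also have "\<dots> = m \<alpha> x * (\<rho>2 (norm x) + of_real ((2 * real n + 2) / norm x) * \<rho>1 (norm x)) + (\<Sum>j\<in>UNIV. m2 j x) * \<rho> (norm x)"
      unfolding s1 s2 s3 using nx by (simp add: field_simps)
    finally show ?thesis by (simp add: L_def f_def algebra_simps)
  qed
  have cL: "continuous_on {0<..} L"
    unfolding L_def by (intro continuous_intros c\<rho> \<rho>2) auto
  have L0: "L r = 0" if "r > 0" "r \<notin> {p..q}" for r
  proof -
    define G where "G = {0<..} \<inter> (- {p..q})"
    have G: "open G" unfolding G_def by (intro open_Int open_greaterThan open_Compl closed_atLeastAtMost)
    have z: "g' = 0" if "(g has_vector_derivative g') (at s)" "s \<in> G" "\<And>t. t \<in> G \<Longrightarrow> g t = 0"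
      for g :: "real \<Rightarrow> complex" and g' s
    proof -
      have "((\<lambda>_. 0) has_vector_derivative g') (at s)"
        by (rule has_vector_derivative_transform_within_open[OF that(1) G that(2,3)])
      then show ?thesis using vector_derivative_unique_at has_vector_derivative_const by blast
    qed
    have r0: "\<rho> t = 0" if "t \<in> G" for t using supp that by (auto simp: G_def)
    have r1: "\<rho>1 t = 0" if "t \<in> G" for t using z[OF \<rho> that r0] that by (auto simp: G_def)
    have r2: "\<rho>2 t = 0" if "t \<in> G" for t using z[OF \<rho>1 that r1] that by (auto simp: G_def)
    have "r \<in> G" using that by (auto simp: G_def)
    then show ?thesis using r0 r1 r2 by (simp add: L_def)
  qed
  have cLn: "continuous_on V (\<lambda>x. L (norm x))" using cL V by (intro continuous_on_radial)
  have mL: "moment w \<alpha> L = (LINT x:K|lborel. w x * (m \<alpha> x * L (norm x)))"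
    unfolding K_def m_def by (rule moment_eq_shell[OF p L0])
  have m\<rho>: "moment w \<beta> \<rho> = (LINT x:K|lborel. w x * (m \<beta> x * \<rho> (norm x)))" for \<beta>
    unfolding K_def m_def by (rule moment_eq_shell[OF p supp])
  have m2: "of_nat (\<alpha> j * (\<alpha> j - 1)) * moment w (\<alpha>(j := \<alpha> j - 2)) \<rho>
      = (LINT x:K|lborel. m2 j x * \<rho> (norm x) * w x)" for j
    unfolding m\<rho> set_integral_mult_right[symmetric]
    by (intro arg_cong[of _ _ "set_lebesgue_integral lborel K"] ext) (simp add: m2_def)
  have cm2: "continuous_on V (\<lambda>x. m2 j x * \<rho> (norm x) * w x)" for j
    unfolding m2_def by (intro continuous_intros cm c cw)
  have "moment w \<alpha> L + (\<Sum>j\<in>UNIV. of_nat (\<alpha> j * (\<alpha> j - 1)) * moment w (\<alpha>(j := \<alpha> j - 2)) \<rho>)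
    = (LINT x:K|lborel. w x * (m \<alpha> x * L (norm x))) + (\<Sum>j\<in>UNIV. LINT x:K|lborel. m2 j x * \<rho> (norm x) * w x)"
    unfolding mL m2 ..
  also have "\<dots> = (LINT x:K|lborel. w x * (m \<alpha> x * L (norm x)) + (\<Sum>j\<in>UNIV. m2 j x * \<rho> (norm x) * w x))"
    by (subst intsum[OF cm2, symmetric], subst set_integral_add(2))
      (auto intro!: int continuous_on_mult continuous_on_sum cw cm cLn cm2)
  also have "\<dots> = (LINT x:K|lborel. (\<Sum>j\<in>UNIV. f2 j x) * w x + of_real (k\<^sup>2) * (f x * w x))"
  proof (rule set_lebesgue_integral_cong)
    show "\<forall>x. x \<in> K \<longrightarrow> w x * (m \<alpha> x * L (norm x)) + (\<Sum>j\<in>UNIV. m2 j x * \<rho> (norm x) * w x) =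
      (\<Sum>j\<in>UNIV. f2 j x) * w x + of_real (k\<^sup>2) * (f x * w x)"
    proof (intro allI impI)
      fix x assume "x \<in> K"
      then have "x \<in> V" using V by auto
      from arg_cong[OF alg[OF this], of "\<lambda>z. z * w x"]
      show "w x * (m \<alpha> x * L (norm x)) + (\<Sum>j\<in>UNIV. m2 j x * \<rho> (norm x) * w x) =
        (\<Sum>j\<in>UNIV. f2 j x) * w x + of_real (k\<^sup>2) * (f x * w x)"
        by (simp add: algebra_simps sum_distrib_left sum_distrib_right)
    qed
  qed (use K in \<open>auto simp: compact_imp_closed\<close>)
  also have "\<dots> = 0"
    by (subst set_integral_add(2))
      (use eq in \<open>auto intro!: int continuous_on_mult continuous_on_sum continuous_on_const cf cw\<close>)
  finally show ?thesis
    unfolding L_def n_def by (simp add: eq_neg_iff_add_eq_0)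
qed

section \<open>Vanishing of the moments\<close>

lemma truncated_power_derivative:
  "((\<lambda>t::real. max 0 t ^ (n + 2)) has_real_derivative real (n + 2) * max 0 t ^ (n + 1)) (at t)"
proof (cases t "0::real" rule: linorder_cases)
  case less
  have "((\<lambda>t::real. 0) has_real_derivative 0) (at t)" by simp
  then have "((\<lambda>t::real. max 0 t ^ (n + 2)) has_real_derivative 0) (at t)"
    by (rule DERIV_cong_ev[THEN iffD1, rotated -1])
      (use less eventually_nhds_in_open[of "{..<0}" t] in \<open>auto elim!: eventually_mono\<close>)
  then show ?thesis using less by simp
next
  case equal
  have "(\<lambda>h::real. max 0 h ^ (n + 1)) \<midarrow>0\<rightarrow> max 0 0 ^ (n + 1)"
    by (intro tendsto_intros)
  then have "(\<lambda>h::real. (max 0 (0 + h) ^ (n + 2) - max 0 0 ^ (n + 2)) / h) \<midarrow>0\<rightarrow> max 0 0 ^ (n + 1)"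
    by (rule Lim_transform_eventually) (auto simp: eventually_at_filter max_def)
  then show ?thesis using equal by (simp add: DERIV_def)
next
  case greater
  have "((\<lambda>t::real. t ^ (n + 2)) has_real_derivative real (n + 2) * t ^ (n + 1)) (at t)"
    by (rule DERIV_cong[OF DERIV_pow]) simp
  then have "((\<lambda>t::real. max 0 t ^ (n + 2)) has_real_derivative real (n + 2) * t ^ (n + 1)) (at t)"
    by (rule DERIV_cong_ev[THEN iffD1, rotated -1])
      (use greater eventually_nhds_in_open[of "{0<..}" t] in \<open>auto elim!: eventually_mono\<close>)
  then show ?thesis using greater by simp
qed

text \<open>The third difference of the cubic truncated power \<open>max 0 t ^ 3\<close>, divided by 6, is twice continuously
differentiable, vanishes for \<open>t \<le> 0\<close> and equals 1 for \<open>t \<ge> 3\<close>, because the third difference of \<open>t ^ 3\<close> is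
the constant 6. The argument is rescaled to the unit interval.\<close>

lemma cutoff_exists:
  obtains \<eta> \<eta>1 \<eta>2 :: "real \<Rightarrow> real" and B where
    "\<And>t. (\<eta> has_real_derivative \<eta>1 t) (at t)" "\<And>t. (\<eta>1 has_real_derivative \<eta>2 t) (at t)"
    "continuous_on UNIV \<eta>2"
    "\<And>t. t \<le> 0 \<Longrightarrow> \<eta> t = 0" "\<And>t. t \<ge> 1 \<Longrightarrow> \<eta> t = 1"
    "\<And>t. t \<notin> {0<..<1} \<Longrightarrow> \<eta>1 t = 0" "\<And>t. t \<notin> {0<..<1} \<Longrightarrow> \<eta>2 t = 0"
    "0 \<le> B" "\<And>t. \<bar>\<eta>1 t\<bar> \<le> B" "\<And>t. \<bar>\<eta>2 t\<bar> \<le> B"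
proof -
  define p where "p = (\<lambda>m (t::real). max 0 t ^ m)"
  define D where "D = (\<lambda>m t. p m (3 * t) - 3 * p m (3 * t - 1) + 3 * p m (3 * t - 2) - p m (3 * t - 3))"
  define \<eta> where "\<eta> = (\<lambda>t. D 3 t / 6)"
  define \<eta>1 where "\<eta>1 = (\<lambda>t. 3 / 2 * D 2 t)"
  define \<eta>2 where "\<eta>2 = (\<lambda>t. 9 * D 1 t)"
  have p: "((\<lambda>t. p (n + 2) (3 * t - a)) has_real_derivative 3 * (real (n + 2) * p (n + 1) (3 * t - a))) (at t)" for n a t
  proof -
    have "((\<lambda>t. 3 * t - a) has_real_derivative 3) (at t)" by (auto intro!: derivative_eq_intros)
    from DERIV_chain2[OF truncated_power_derivative this, of n] show ?thesis
      by (simp add: p_def mult_ac)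
  qed
  have D: "(D (n + 2) has_real_derivative 3 * real (n + 2) * D (n + 1) t) (at t)" for n t
  proof -
    have p0: "((\<lambda>t. p (n + 2) (3 * t)) has_real_derivative 3 * (real (n + 2) * p (n + 1) (3 * t))) (at t)"
      using p[of n 0 t] by simp
    show ?thesis
      unfolding D_def
      by (rule DERIV_cong, (rule DERIV_diff DERIV_add DERIV_cmult p0 p)+) (simp add: algebra_simps)
  qed
  have d1: "(\<eta> has_real_derivative \<eta>1 t) (at t)" for t
    unfolding \<eta>_def \<eta>1_def using D[of 1 t]
    by (auto intro!: derivative_eq_intros simp: numeral_eq_Suc)
  have d2: "(\<eta>1 has_real_derivative \<eta>2 t) (at t)" for t
    unfolding \<eta>1_def \<eta>2_def using D[of 0 t]
    by (auto intro!: derivative_eq_intros simp: numeral_eq_Suc)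
  have c: "continuous_on S \<eta>2" for S
    unfolding \<eta>2_def D_def p_def by (intro continuous_intros)
  have c1: "continuous_on S \<eta>1" for S
    unfolding \<eta>1_def D_def p_def by (intro continuous_intros)
  have l: "\<eta> t = 0" "\<eta>1 t = 0" "\<eta>2 t = 0" if "t \<le> 0" for t
    using that by (auto simp: \<eta>_def \<eta>1_def \<eta>2_def D_def p_def)
  have r: "\<eta> t = 1" "\<eta>1 t = 0" "\<eta>2 t = 0" if "t \<ge> 1" for t
    using that by (auto simp: \<eta>_def \<eta>1_def \<eta>2_def D_def p_def field_simps power2_eq_square power3_eq_cube max_def)
  have bd: "\<exists>B. \<forall>t. \<bar>f t\<bar> \<le> B" if "continuous_on {0..1} f" "\<And>t. t \<le> 0 \<Longrightarrow> f t = 0" "\<And>t. t \<ge> 1 \<Longrightarrow> f t = 0"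
    for f :: "real \<Rightarrow> real"
  proof -
    have "bounded (f ` {0..1})" by (intro compact_imp_bounded compact_continuous_image that) auto
    then obtain B where "B > 0" "\<And>t. t \<in> {0..1} \<Longrightarrow> \<bar>f t\<bar> \<le> B" by (auto simp: bounded_pos)
    then have "\<bar>f t\<bar> \<le> B" for t using that(2,3)[of t] by (cases "t \<in> {0..1}") auto
    then show ?thesis by blast
  qed
  obtain B1 where B1: "\<And>t. \<bar>\<eta>1 t\<bar> \<le> B1" using bd[OF c1 l(2) r(2)] by blast
  obtain B2 where B2: "\<And>t. \<bar>\<eta>2 t\<bar> \<le> B2" using bd[OF c l(3) r(3)] by blast
  show ?thesis
  proof (rule that[OF d1 d2 c l(1) r(1)])
    show "\<eta>1 t = 0" "\<eta>2 t = 0" if "t \<notin> {0<..<1}" for t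
      using l[of t] r[of t] that by fastforce+
    show "0 \<le> max B1 B2" "\<bar>\<eta>1 t\<bar> \<le> max B1 B2" "\<bar>\<eta>2 t\<bar> \<le> max B1 B2" for t
      using B1[of t] B2[of t] by auto
  qed
qed

text \<open>Apply the moment identity to the product \<open>\<rho> \<eta>\<close>. Its right-hand side consists of moments of lower
degree, which vanish by assumption, and the product rule shows by how much the radial operator of \<open>\<rho> \<eta>\<close>
differs from \<open>\<psi> \<eta>\<close>.\<close>

lemma moment_cutoff:
  fixes w :: "real^3 \<Rightarrow> complex" and \<alpha> :: "3 \<Rightarrow> nat" and \<eta> \<eta>1 \<eta>2 :: "real \<Rightarrow> real"
  defines "n \<equiv> (\<Sum>j\<in>UNIV. \<alpha> j)"
  assumes U: "open U" "C2_on U w" and pde: "\<And>x. x \<in> U \<Longrightarrow> laplacian w x + of_real (k\<^sup>2) * w x = 0"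
    and p: "0 < p" and sub: "shell p q \<subseteq> U"
    and \<psi>: "continuous_on {0<..} \<psi>" and \<rho>: "radial_solution k n \<psi> \<rho> \<rho>1"
    and \<eta>: "\<And>t. (\<eta> has_real_derivative \<eta>1 t) (at t)" "\<And>t. (\<eta>1 has_real_derivative \<eta>2 t) (at t)"
      "continuous_on UNIV \<eta>2"
    and supp: "\<And>r. 0 < r \<Longrightarrow> r \<notin> {p..q} \<Longrightarrow> \<rho> r = 0 \<or> \<eta> r = 0"
    and lower: "\<And>\<beta> \<phi>. (\<Sum>j\<in>UNIV. \<beta> j) < n \<Longrightarrow> continuous_on {0<..} \<phi> \<Longrightarrow>
        (\<And>r. 0 < r \<Longrightarrow> r \<notin> {p..q} \<Longrightarrow> \<phi> r = 0) \<Longrightarrow> moment w \<beta> \<phi> = 0"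
  shows "moment w \<alpha> (\<lambda>r. \<psi> r * of_real (\<eta> r) + (2 * \<rho>1 r * of_real (\<eta>1 r) +
      \<rho> r * of_real (\<eta>2 r + (2 * real n + 2) / r * \<eta>1 r))) = 0"
proof -
  define \<kappa> where "\<kappa> = (\<lambda>r. (2 * real n + 2) / r)"
  have \<kappa>: "(2 * real n + 2) / r = \<kappa> r" for r by (simp add: \<kappa>_def)
  define \<rho>2 where "\<rho>2 = (\<lambda>r. \<psi> r - of_real (\<kappa> r) * \<rho>1 r - of_real (k\<^sup>2) * \<rho> r)"
  have d: "(\<rho> has_vector_derivative \<rho>1 r) (at r)" "(\<rho>1 has_vector_derivative \<rho>2 r) (at r)" if "0 < r" for r
    using \<rho> that by (auto simp: radial_solution_def \<rho>2_def \<kappa>_def)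
  have e: "((\<lambda>r. complex_of_real (\<eta> r)) has_vector_derivative of_real (\<eta>1 r)) (at r)"
    "((\<lambda>r. complex_of_real (\<eta>1 r)) has_vector_derivative of_real (\<eta>2 r)) (at r)" for r
    using \<eta>(1,2) by (auto intro!: has_vector_derivative_of_real simp flip: has_real_derivative_iff_has_vector_derivative)
  define X where "X = (\<lambda>r. \<rho> r * of_real (\<eta> r))"
  define X1 where "X1 = (\<lambda>r. \<rho> r * of_real (\<eta>1 r) + \<rho>1 r * of_real (\<eta> r))"
  define X2 where "X2 = (\<lambda>r. (\<rho> r * of_real (\<eta>2 r) + \<rho>1 r * of_real (\<eta>1 r)) +
    (\<rho>1 r * of_real (\<eta>1 r) + \<rho>2 r * of_real (\<eta> r)))"
  have X: "(X has_vector_derivative X1 r) (at r)" "(X1 has_vector_derivative X2 r) (at r)" if "0 < r" for r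
    unfolding X_def X1_def X2_def
    by (rule has_vector_derivative_add has_vector_derivative_mult d[OF that] e)+
  have cont: "continuous_on {0<..} \<rho>" "continuous_on {0<..} \<rho>1"
    using d by (auto intro!: continuous_at_imp_continuous_on has_vector_derivative_continuous)
  have ce: "continuous_on S \<eta>" "continuous_on S \<eta>1" "continuous_on S \<eta>2" for S
    using \<eta>(1,2) continuous_on_subset[OF \<eta>(3) subset_UNIV]
    by (auto intro!: continuous_at_imp_continuous_on intro: DERIV_isCont)
  have cX2: "continuous_on {0<..} X2"
    unfolding X2_def \<rho>2_def \<kappa>_def by (intro continuous_intros cont ce \<psi>) auto
  have cX: "continuous_on {0<..} X" unfolding X_def by (intro continuous_intros cont ce)
  have X0: "X r = 0" if "0 < r" "r \<notin> {p..q}" for r using supp[OF that] by (auto simp: X_def)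
  have "of_nat (\<alpha> j * (\<alpha> j - 1)) * moment w (\<alpha>(j := \<alpha> j - 2)) X = 0" for j
  proof (cases "\<alpha> j < 2")
    case True
    then have "\<alpha> j * (\<alpha> j - 1) = 0" by auto
    then show ?thesis by simp
  next
    case False
    have "(\<Sum>i\<in>UNIV. (\<alpha>(j := \<alpha> j - 2)) i) < n"
      unfolding n_def by (rule sum_strict_mono_ex1) (use False in \<open>auto intro!: exI[of _ j]\<close>)
    then show ?thesis using lower[OF _ cX X0] by simp
  qed
  then have "(\<Sum>j\<in>UNIV. of_nat (\<alpha> j * (\<alpha> j - 1)) * moment w (\<alpha>(j := \<alpha> j - 2)) X) = 0"
    by (intro sum.neutral ballI)
  moreover have "moment w \<alpha> (\<lambda>r. X2 r + of_real ((2 * real n + 2) / r) * X1 r + of_real (k\<^sup>2) * X r)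
      = - (\<Sum>j\<in>UNIV. of_nat (\<alpha> j * (\<alpha> j - 1)) * moment w (\<alpha>(j := \<alpha> j - 2)) X)"
    unfolding n_def by (rule moment_radial_operator[OF U pde p sub X cX2 X0])
  ultimately have "moment w \<alpha> (\<lambda>r. X2 r + of_real ((2 * real n + 2) / r) * X1 r + of_real (k\<^sup>2) * X r) = 0"
    by (simp only: minus_zero)
  also have "(\<lambda>r. X2 r + of_real ((2 * real n + 2) / r) * X1 r + of_real (k\<^sup>2) * X r) =
    (\<lambda>r. \<psi> r * of_real (\<eta> r) + (2 * \<rho>1 r * of_real (\<eta>1 r) +
      \<rho> r * of_real (\<eta>2 r + (2 * real n + 2) / r * \<eta>1 r)))"
    unfolding X_def X1_def X2_def \<rho>2_def \<kappa> by (intro ext) (simp add: algebra_simps)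
  finally show ?thesis .
qed

text \<open>Induction on the degree. Take the solution \<open>\<rho>\<close> of the radial equation that vanishes to the right of the
support of \<open>\<psi>\<close> and cut it off near the origin. The error term of the cut-off is supported where \<open>w\<close>
vanishes.\<close>

lemma moment_eq_0_if_zero_near_center:
  fixes w :: "real^3 \<Rightarrow> complex"
  assumes k: "k \<noteq> 0" and w: "C2_on (ball 0 R) w" 
    and pde: "\<And>x. x \<in> ball 0 R \<Longrightarrow> laplacian w x + of_real (k\<^sup>2) * w x = 0"
    and \<delta>: "0 < \<delta>" "\<And>x. x \<in> ball 0 \<delta> \<Longrightarrow> w x = 0"
    and "0 < p" "p \<le> q" "q < R" "continuous_on {0<..} \<psi>" "\<And>r. 0 < r \<Longrightarrow> r \<notin> {p..q} \<Longrightarrow> \<psi> r = 0"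
  shows "moment w \<alpha> \<psi> = 0"
  using assms(6-)
proof (induction "\<Sum>j\<in>UNIV. \<alpha> j" arbitrary: \<alpha> p q \<psi> rule: less_induct)
  case less
  define n where "n = (\<Sum>j\<in>UNIV. \<alpha> j)"
  obtain \<rho> \<rho>1 where \<rho>: "radial_solution k n \<psi> \<rho> \<rho>1" "\<And>r. r > q \<Longrightarrow> \<rho> r = 0"
    using radial_ode(2)[OF k less.prems(4,1,2,5), of n] by blast
  obtain \<eta> \<eta>1 \<eta>2 :: "real \<Rightarrow> real" where \<eta>:
    "\<And>t. (\<eta> has_real_derivative \<eta>1 t) (at t)" "\<And>t. (\<eta>1 has_real_derivative \<eta>2 t) (at t)"
    "continuous_on UNIV \<eta>2"
    "\<And>t. t \<le> 0 \<Longrightarrow> \<eta> t = 0" "\<And>t. t \<ge> 1 \<Longrightarrow> \<eta> t = 1"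
    "\<And>t. t \<notin> {0<..<1} \<Longrightarrow> \<eta>1 t = 0" "\<And>t. t \<notin> {0<..<1} \<Longrightarrow> \<eta>2 t = 0"
    by (rule cutoff_exists) blast
  \<comment> \<open>the cut-off rises from 0 to 1 between \<open>a\<close> and \<open>2 a\<close>, left of the support of \<open>\<psi>\<close> and inside the zero ball of \<open>w\<close>\<close>
  define a where "a = min p \<delta> / 2"
  have a: "a > 0" "2 * a \<le> p" "2 * a \<le> \<delta>" using less.prems(1) \<delta>(1) by (auto simp: a_def)
  define l where "l = (\<lambda>r. (r - a) / a)"
  have l: "(l has_real_derivative 1 / a) (at r)" for r
    unfolding l_def using a by (auto intro!: derivative_eq_intros)
  have "moment w \<alpha> (\<lambda>r. \<psi> r * of_real (\<eta> (l r)) + (2 * \<rho>1 r * of_real (\<eta>1 (l r) / a) +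
      \<rho> r * of_real (\<eta>2 (l r) / a\<^sup>2 + (2 * real (\<Sum>j\<in>UNIV. \<alpha> j) + 2) / r * (\<eta>1 (l r) / a)))) = 0"
  proof (rule moment_cutoff[OF _ w pde a(1), where q = q])
    show "radial_solution k (\<Sum>j\<in>UNIV. \<alpha> j) \<psi> \<rho> \<rho>1" using \<rho>(1) by (simp add: n_def)
    show "((\<lambda>r. \<eta> (l r)) has_real_derivative \<eta>1 (l t) / a) (at t)" for t
      using DERIV_chain2[OF \<eta>(1) l] by simp
    show "((\<lambda>r. \<eta>1 (l r) / a) has_real_derivative \<eta>2 (l t) / a\<^sup>2) (at t)" for t
      using DERIV_cdivide[OF DERIV_chain2[OF \<eta>(2) l], where c = a] by (simp add: power2_eq_square)
    have "continuous_on UNIV (\<lambda>r. \<eta>2 (l r))"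
      by (rule continuous_on_compose2[OF \<eta>(3)]) (use a(1) in \<open>auto simp: l_def intro!: continuous_intros\<close>)
    then show "continuous_on UNIV (\<lambda>r. \<eta>2 (l r) / a\<^sup>2)"
      by (rule continuous_on_divide[OF _ continuous_on_const]) (use a(1) in simp)
    show "\<rho> r = 0 \<or> \<eta> (l r) = 0" if "0 < r" "r \<notin> {a..q}" for r
      using that \<rho>(2)[of r] \<eta>(4)[of "l r"] a by (auto simp: l_def divide_le_0_iff)
    show "moment w \<beta> \<phi> = 0" if "(\<Sum>j\<in>UNIV. \<beta> j) < (\<Sum>j\<in>UNIV. \<alpha> j)" "continuous_on {0<..} \<phi>"
      "\<And>r. 0 < r \<Longrightarrow> r \<notin> {a..q} \<Longrightarrow> \<phi> r = 0" for \<beta> \<phi>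
      by (rule less.hyps[OF that(1) a(1) _ less.prems(3) that(2,3)]) (use a less.prems in auto)
  qed (use less.prems in \<open>auto simp: shell_def\<close>)
  also have "moment w \<alpha> (\<lambda>r. \<psi> r * of_real (\<eta> (l r)) + (2 * \<rho>1 r * of_real (\<eta>1 (l r) / a) +
      \<rho> r * of_real (\<eta>2 (l r) / a\<^sup>2 + (2 * real (\<Sum>j\<in>UNIV. \<alpha> j) + 2) / r * (\<eta>1 (l r) / a)))) = moment w \<alpha> \<psi>"
  proof (rule moment_cong)
    fix x :: "real^3"
    show "w x * (\<psi> (norm x) * of_real (\<eta> (l (norm x))) + (2 * \<rho>1 (norm x) * of_real (\<eta>1 (l (norm x)) / a) +
      \<rho> (norm x) * of_real (\<eta>2 (l (norm x)) / a\<^sup>2 + (2 * real (\<Sum>j\<in>UNIV. \<alpha> j) + 2) / norm x * (\<eta>1 (l (norm x)) / a))))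
      = w x * \<psi> (norm x)"
    proof (cases "norm x < \<delta>")
      case True
      then show ?thesis using \<delta>(2)[of x] by simp
    next
      case False
      then have "l (norm x) \<ge> 1" using a by (simp add: l_def field_simps)
      then show ?thesis using \<eta>(5-7) by simp
    qed
  qed
  finally show ?case .
qed

text \<open>A monomial of degree \<open>n\<close> is at most \<open>q ^ n\<close> on the shell, and the shell lies in a ball of radius \<open>q\<close>.\<close>

lemma norm_moment_le:
  assumes "0 < p" "p \<le> q" and "\<And>r. 0 < r \<Longrightarrow> r \<notin> {p..q} \<Longrightarrow> \<phi> r = 0"
    and "continuous_on (shell p q) w" "continuous_on {0<..} \<phi>" "0 \<le> A"
    and bd: "\<And>x. x \<in> shell p q \<Longrightarrow> norm (w x) * norm (\<phi> (norm x)) \<le> A"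
  shows "norm (moment w \<alpha> \<phi>) \<le> unit_ball_vol 3 * q ^ ((\<Sum>j\<in>UNIV. \<alpha> j) + 3) * A"
proof -
  define K where "K = (shell p q :: (real^3) set)"
  define M where "M = q ^ (\<Sum>j\<in>UNIV. \<alpha> j) * A"
  define f where "f = (\<lambda>x. w x * (of_real (monomial \<alpha> x) * \<phi> (norm x)))"
  have K: "compact K" using compact_shell by (simp add: K_def)
  have "continuous_on K f"
    unfolding f_def K_def
    by (intro continuous_intros assms continuous_on_radial) (use assms(1) in \<open>auto simp: shell_def\<close>)
  then have i: "integrable lborel (\<lambda>x. indicator K x *\<^sub>R f x)" using K by (intro borel_integrable_compact)
  have le: "norm (f x) \<le> M" if "x \<in> K" for x
  proof -
    have q: "norm x \<le> q" using that by (auto simp: K_def shell_def)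
    have "\<bar>monomial \<alpha> x\<bar> \<le> q ^ (\<Sum>j\<in>UNIV. \<alpha> j)"
      using abs_monomial_le[of \<alpha> x] power_mono[OF q] by (meson norm_ge_zero order_trans)
    then have "\<bar>monomial \<alpha> x\<bar> * (norm (w x) * norm (\<phi> (norm x))) \<le> M"
      unfolding M_def using bd that assms(1,2,6) by (intro mult_mono) (auto simp: K_def)
    then show ?thesis by (simp add: f_def norm_mult mult_ac)
  qed
  have M: "0 \<le> M" using assms by (simp add: M_def)
  have "norm (moment w \<alpha> \<phi>) = norm (LINT x|lborel. indicator K x *\<^sub>R f x)"
    unfolding f_def K_def set_lebesgue_integral_def[symmetric]
    by (rule arg_cong[of _ _ norm], rule moment_eq_shell) (use assms in auto)
  also have "\<dots> \<le> (LINT x|lborel. norm (indicator K x *\<^sub>R f x))" by (rule integral_norm_bound)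
  also have "\<dots> \<le> (LINT x::real^3|lborel. M * indicator (cball 0 q) x)"
  proof (rule integral_mono)
    show "integrable lborel (\<lambda>x. norm (indicator K x *\<^sub>R f x))" using i by (rule integrable_norm)
    show "integrable lborel (\<lambda>x::real^3. M * indicator (cball 0 q) x)"
      using emeasure_lborel_cball_finite[of "0::real^3" q]
      by (intro integrable_mult_right integrable_real_indicator) auto
    show "norm (indicator K x *\<^sub>R f x) \<le> M * indicator (cball 0 q) x" for x
      using le[of x] M by (auto simp: indicator_def K_def shell_def)
  qed
  also have "\<dots> = M * measure lborel (cball (0::real^3) q)" by simp
  also have "\<dots> = unit_ball_vol 3 * q ^ ((\<Sum>j\<in>UNIV. \<alpha> j) + 3) * A"
    using assms(1,2) by (subst content_cball) (auto simp: M_def power_add)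
  finally show ?thesis .
qed

text \<open>Induction on the degree. Take the solution \<open>\<rho>\<close> of the radial equation that vanishes to the left of the
support of \<open>\<psi>\<close> and cut it off between the radii \<open>R\<close> and \<open>4 R\<close>. There \<open>\<rho>\<close> and its derivative are of order
\<open>R ^ (- n - 1)\<close> and the derivatives of the cut-off of order \<open>1 / R\<close>, while \<open>w\<close> is of order \<open>R ^ (- 2)\<close>, the
monomial of order \<open>R ^ n\<close> and the volume of order \<open>R ^ 3\<close>. The error is thus of order \<open>1 / R\<close>.\<close>

lemma moment_eq_0_if_decaying:
  fixes w :: "real^3 \<Rightarrow> complex"
  assumes k: "k \<noteq> 0" and w: "C2_on {x. R0 < norm x} w" 
    and pde: "\<And>x. R0 < norm x \<Longrightarrow> laplacian w x + of_real (k\<^sup>2) * w x = 0"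
    and decay: "\<And>x. R0 < norm x \<Longrightarrow> norm (w x) \<le> C / (norm x)\<^sup>2" and "0 \<le> R0"
    and "R0 < p" "p \<le> q" "continuous_on {0<..} \<psi>" "\<And>r. 0 < r \<Longrightarrow> r \<notin> {p..q} \<Longrightarrow> \<psi> r = 0"
  shows "moment w \<alpha> \<psi> = 0"
  using assms(6-)
proof (induction "\<Sum>j\<in>UNIV. \<alpha> j" arbitrary: \<alpha> p q \<psi> rule: less_induct)
  case less
  define n where "n = (\<Sum>j\<in>UNIV. \<alpha> j)"
  have p: "0 < p" using less.prems(1) \<open>0 \<le> R0\<close> by simp
  have C: "0 \<le> C"
  proof -
    have "0 \<le> norm (w (p *\<^sub>R axis 1 1))" by simp
    also have "\<dots> \<le> C / p\<^sup>2" using decay[of "p *\<^sub>R axis 1 1"] less.prems(1) p by (simp add: norm_axis_1)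
    finally show ?thesis using p by (simp add: zero_le_divide_iff)
  qed
  obtain \<rho> \<rho>1 D R1 where \<rho>: "radial_solution k n \<psi> \<rho> \<rho>1" "\<And>r. 0 < r \<Longrightarrow> r < p \<Longrightarrow> \<rho> r = 0"
    and D: "\<And>r. r \<ge> R1 \<Longrightarrow> norm (\<rho> r) \<le> D / r ^ (n + 1) \<and> norm (\<rho>1 r) \<le> D / r ^ (n + 1)"
    using radial_ode(1)[OF k less.prems(3) p less.prems(2,4), of n] by blast
  obtain \<eta> \<eta>1 \<eta>2 :: "real \<Rightarrow> real" and B where \<eta>:
    "\<And>t. (\<eta> has_real_derivative \<eta>1 t) (at t)" "\<And>t. (\<eta>1 has_real_derivative \<eta>2 t) (at t)"
    "continuous_on UNIV \<eta>2"
    "\<And>t. t \<le> 0 \<Longrightarrow> \<eta> t = 0" "\<And>t. t \<ge> 1 \<Longrightarrow> \<eta> t = 1"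
    "\<And>t. t \<notin> {0<..<1} \<Longrightarrow> \<eta>1 t = 0" "\<And>t. t \<notin> {0<..<1} \<Longrightarrow> \<eta>2 t = 0"
    "0 \<le> B" "\<And>t. \<bar>\<eta>1 t\<bar> \<le> B" "\<And>t. \<bar>\<eta>2 t\<bar> \<le> B"
    by (rule cutoff_exists) blast
  have bound: "norm (moment w \<alpha> \<psi>) \<le> unit_ball_vol 3 * 4 ^ (n + 3) * (C * (D * (B * (2 * real n + 5)))) / R"
    if R: "R \<ge> R1" "R \<ge> q" "R \<ge> 1" for R
  proof -
    have D0: "0 \<le> D"
    proof -
      have "0 \<le> norm (\<rho> R)" by simp
      also have "\<dots> \<le> D / R ^ (n + 1)" using D[OF R(1)] by blast
      finally show ?thesis
        using R(3) pos_le_divide_eq[of "R ^ (n + 1)" 0 D] by (simp only: mult_zero_left zero_less_power)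
    qed
    \<comment> \<open>decreasing from 1 at radius \<open>R\<close> to 0 at radius \<open>4 R\<close>\<close>
    define l where "l = (\<lambda>r. (4 * R - r) / (3 * R))"
    have l: "(l has_real_derivative - (1 / (3 * R))) (at r)" for r
      unfolding l_def using R(3) by (auto intro!: derivative_eq_intros)
    define \<eta>1' where "\<eta>1' = (\<lambda>r. - (\<eta>1 (l r) / (3 * R)))"
    define \<eta>2' where "\<eta>2' = (\<lambda>r. \<eta>2 (l r) / (3 * R)\<^sup>2)"
    define E where "E = (\<lambda>r. 2 * \<rho>1 r * of_real (\<eta>1' r) + \<rho> r * of_real (\<eta>2' r + (2 * real n + 2) / r * \<eta>1' r))"
    have cl: "continuous_on S l" for S unfolding l_def using R(3) by (auto intro!: continuous_intros)
    have d1: "((\<lambda>r. \<eta> (l r)) has_real_derivative \<eta>1' t) (at t)" for t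
      using DERIV_chain2[OF \<eta>(1) l] by (simp add: \<eta>1'_def)
    have d2: "(\<eta>1' has_real_derivative \<eta>2' t) (at t)" for t
      unfolding \<eta>1'_def using DERIV_minus[OF DERIV_cdivide[OF DERIV_chain2[OF \<eta>(2) l], where c = "3 * R"]]
      by (simp add: \<eta>2'_def power2_eq_square)
    have c2: "continuous_on S \<eta>2'" for S
      unfolding \<eta>2'_def using R(3)
      by (intro continuous_on_divide[OF continuous_on_compose2[OF \<eta>(3) cl] continuous_on_const]) auto
    have c1: "continuous_on S \<eta>1'" for S
      using d2 by (auto intro!: continuous_at_imp_continuous_on intro: DERIV_isCont)
    have c\<rho>: "continuous_on {0<..} \<rho>" "continuous_on {0<..} \<rho>1"
      using \<rho>(1) unfolding radial_solution_def
      by (auto intro!: continuous_at_imp_continuous_on has_vector_derivative_continuous)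
    have cE: "continuous_on {0<..} E"
      unfolding E_def by (intro continuous_intros c\<rho> c1 c2) auto
    have E0: "E r = 0" if "0 < r" "r \<notin> {R..4 * R}" for r
    proof -
      have "l r \<notin> {0<..<1}" using that R(3) by (auto simp: l_def field_simps)
      then show ?thesis using \<eta>(6,7) by (simp add: E_def \<eta>1'_def \<eta>2'_def)
    qed
    have sub: "shell p (4 * R) \<subseteq> {x::real^3. R0 < norm x}" using less.prems(1) by (auto simp: shell_def)
    have cw: "continuous_on (shell p (4 * R)) w"
      using C2_on_continuous(1)[OF w] sub by (rule continuous_on_subset)
    have "moment w \<alpha> (\<lambda>r. \<psi> r * of_real (\<eta> (l r)) + E r) = 0"
      unfolding E_def n_def
    proof (rule moment_cutoff[OF _ w _ p sub less.prems(3) _ d1 d2 c2])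
      show "open {x::real^3. R0 < norm x}" by (intro open_Collect_less continuous_intros)
      show "radial_solution k (\<Sum>j\<in>UNIV. \<alpha> j) \<psi> \<rho> \<rho>1" using \<rho>(1) by (simp add: n_def)
      show "\<rho> r = 0 \<or> \<eta> (l r) = 0" if "0 < r" "r \<notin> {p..4 * R}" for r
        using that \<rho>(2)[of r] \<eta>(4)[of "l r"] R(3) by (auto simp: l_def divide_le_0_iff)
      show "moment w \<beta> \<phi> = 0" if "(\<Sum>j\<in>UNIV. \<beta> j) < (\<Sum>j\<in>UNIV. \<alpha> j)" "continuous_on {0<..} \<phi>"
        "\<And>r. 0 < r \<Longrightarrow> r \<notin> {p..4 * R} \<Longrightarrow> \<phi> r = 0" for \<beta> \<phi>
        by (rule less.hyps[OF that(1) less.prems(1) _ that(2,3)]) (use R less.prems(2) in auto)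
    qed (use pde in auto)
    moreover have "moment w \<alpha> (\<lambda>r. \<psi> r * of_real (\<eta> (l r)) + E r) = moment w \<alpha> (\<lambda>r. \<psi> r + E r)"
    proof (rule moment_cong)
      fix x :: "real^3" assume "x \<noteq> 0"
      have "\<psi> r * of_real (\<eta> (l r)) = \<psi> r" if "0 < r" for r
      proof (cases "r \<le> q")
        case True
        then have "l r \<ge> 1" using R by (simp add: l_def field_simps)
        then show ?thesis using \<eta>(5) by simp
      next
        case False
        then show ?thesis using less.prems(4)[of r] that by simp
      qed
      then show "w x * (\<psi> (norm x) * of_real (\<eta> (l (norm x))) + E (norm x)) = w x * (\<psi> (norm x) + E (norm x))"
        using \<open>x \<noteq> 0\<close> by simp
    qed
    moreover have "moment w \<alpha> (\<lambda>r. \<psi> r + E r) = moment w \<alpha> \<psi> + moment w \<alpha> E"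
    proof (rule moment_add[OF p cw less.prems(3) _ cE])
      show "\<psi> r = 0" if "0 < r" "r \<notin> {p..4 * R}" for r
        using less.prems(4)[of r] that R by auto
      show "E r = 0" if "0 < r" "r \<notin> {p..4 * R}" for r
        using E0[of r] that R less.prems(2) by auto
    qed
    ultimately have "norm (moment w \<alpha> \<psi>) = norm (moment w \<alpha> E)"
      by (simp add: add_eq_0_iff)
    also have "\<dots> \<le> unit_ball_vol 3 * (4 * R) ^ ((\<Sum>j\<in>UNIV. \<alpha> j) + 3) *
        (C / R\<^sup>2 * (D / R ^ (n + 1) * (B * (2 * real n + 5) / R)))"
    proof (rule norm_moment_le[where p = R])
      show "continuous_on (shell R (4 * R)) w"
        using cw by (rule continuous_on_subset) (use R less.prems(2) in \<open>auto simp: shell_def\<close>)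
      show "0 \<le> C / R\<^sup>2 * (D / R ^ (n + 1) * (B * (2 * real n + 5) / R))"
        using C D0 \<eta>(8) R(3) by simp
      fix x :: "real^3" assume "x \<in> shell R (4 * R)"
      then have x: "R \<le> norm x" by (simp add: shell_def)
      have "norm (w x) \<le> C / (norm x)\<^sup>2" using decay[of x] x R less.prems by linarith
      also have "\<dots> \<le> C / R\<^sup>2" using C x R(3) by (intro divide_left_mono power_mono mult_pos_pos) auto
      finally have wx: "norm (w x) \<le> C / R\<^sup>2" .
      define r where "r = norm x"
      have r: "r \<ge> R" "r > 0" using x R(3) by (auto simp: r_def)
      have "D / r ^ (n + 1) \<le> D / R ^ (n + 1)"
        using D0 r R(3) by (intro divide_left_mono power_mono mult_pos_pos) auto
      then have \<rho>r: "norm (\<rho> r) \<le> D / R ^ (n + 1)" "norm (\<rho>1 r) \<le> D / R ^ (n + 1)"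
        using D[of r] r R(1) by linarith+
      have e1: "\<bar>\<eta>1' r\<bar> \<le> B / R"
      proof -
        have "\<bar>\<eta>1 (l r)\<bar> / (3 * R) \<le> B / R"
          using \<eta>(8) \<eta>(9)[of "l r"] R(3) by (intro frac_le) auto
        then show ?thesis using R(3) by (simp add: \<eta>1'_def)
      qed
      have e2: "\<bar>\<eta>2' r\<bar> \<le> B / R"
      proof -
        have "R * 1 \<le> 3 * R * (3 * R)" using R(3) by (intro mult_mono) auto
        then have "\<bar>\<eta>2 (l r)\<bar> / (3 * R)\<^sup>2 \<le> B / R"
          using \<eta>(8) \<eta>(10)[of "l r"] R(3) by (intro frac_le) (auto simp: power2_eq_square)
        then show ?thesis using R(3) by (simp add: \<eta>2'_def)
      qed
      have e3: "\<bar>\<eta>2' r + (2 * real n + 2) / r * \<eta>1' r\<bar> \<le> B / R + (2 * real n + 2) * (B / R)"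
      proof -
        have "(2 * real n + 2) / r \<le> (2 * real n + 2) / 1" using r R(3) by (intro divide_left_mono) auto
        then have "\<bar>(2 * real n + 2) / r * \<eta>1' r\<bar> \<le> (2 * real n + 2) * (B / R)"
          unfolding abs_mult using r by (intro mult_mono e1) auto
        then show ?thesis using e2 by linarith
      qed
      have "norm (E r) \<le> norm (2 * \<rho>1 r * of_real (\<eta>1' r)) + norm (\<rho> r * of_real (\<eta>2' r + (2 * real n + 2) / r * \<eta>1' r))"
        unfolding E_def by (rule norm_triangle_ineq)
      also have "\<dots> = 2 * norm (\<rho>1 r) * \<bar>\<eta>1' r\<bar> + norm (\<rho> r) * \<bar>\<eta>2' r + (2 * real n + 2) / r * \<eta>1' r\<bar>"
        by (simp only: norm_mult norm_of_real) simp
      also have "\<dots> \<le> 2 * (D / R ^ (n + 1)) * (B / R) + (D / R ^ (n + 1)) * (B / R + (2 * real n + 2) * (B / R))"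
        using D0 R(3) by (intro add_mono mult_mono \<rho>r e1 e3) auto
      also have "\<dots> = D / R ^ (n + 1) * (B * (2 * real n + 5) / R)" using R(3) by (simp add: field_simps)
      finally show "norm (w x) * norm (E (norm x)) \<le> C / R\<^sup>2 * (D / R ^ (n + 1) * (B * (2 * real n + 5) / R))"
        using wx C R(3) by (intro mult_mono) (auto simp: r_def)
    qed (use R E0 cE in auto)
    also have "\<dots> = unit_ball_vol 3 * 4 ^ (n + 3) * (C * (D * (B * (2 * real n + 5)))) / R"
    proof -
      have cancel: "u * (f * (P * R ^ 3)) * (C / R\<^sup>2 * (D / (P * R) * (X / R))) = u * f * (C * (D * X)) / R"
        if "P \<noteq> 0" for u f P X :: real
        using that R(3) by (simp add: power2_eq_square power3_eq_cube)
      have "(4 * R) ^ (n + 3) = 4 ^ (n + 3) * (R ^ n * R ^ 3)" "R ^ (n + 1) = R ^ n * R"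
        by (simp_all only: power_mult_distrib power_add power_one_right mult_ac)
      then show ?thesis
        using cancel[of "R ^ n" "unit_ball_vol 3" "4 ^ (n + 3)" "B * (2 * real n + 5)"] R(3)
        by (simp only: n_def[symmetric]) simp
    qed
    finally show ?thesis .
  qed
  define M where "M = unit_ball_vol 3 * 4 ^ (n + 3) * (C * (D * (B * (2 * real n + 5))))"
  have "((\<lambda>R. M / R) \<longlongrightarrow> 0) at_top"
    by (rule tendsto_divide_0[OF tendsto_const filterlim_at_top_imp_at_infinity[OF filterlim_ident]])
  moreover have "\<forall>\<^sub>F R in at_top. norm (moment w \<alpha> \<psi>) \<le> M / R"
    unfolding M_def eventually_at_top_linorder
    by (rule exI[of _ "max R1 (max q 1)"]) (use bound in auto)
  ultimately have "norm (moment w \<alpha> \<psi>) \<le> 0"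
    by (rule tendsto_lowerbound) simp
  then show ?case by simp
qed

section \<open>Functions with vanishing moments\<close>

text \<open>This presentation of the polynomial functions matches the moments, which are linear in the monomial,
and is closed under products, as the Stone-Weierstrass theorem requires.\<close>

inductive polynomial_sum :: "(real^'n::finite \<Rightarrow> real) \<Rightarrow> bool" where
  "polynomial_sum (\<lambda>x. c * monomial \<alpha> x)"
| "polynomial_sum f \<Longrightarrow> polynomial_sum g \<Longrightarrow> polynomial_sum (\<lambda>x. f x + g x)"

lemma polynomial_sum_mult:
  assumes "polynomial_sum f" "polynomial_sum g"
  shows "polynomial_sum (\<lambda>x. f x * g x)"
  using assms
proof (induction arbitrary: g)
  case (1 c \<alpha>)
  from 1 show ?case
  proof induction
    case (1 d \<beta>)
    have "(\<lambda>x. c * monomial \<alpha> x * (d * monomial \<beta> x)) = (\<lambda>x. (c * d) * monomial (\<lambda>i. \<alpha> i + \<beta> i) x)"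
      by (auto simp: mult_ac simp flip: monomial_mult)
    then show ?case by (simp add: polynomial_sum.intros)
  next
    case (2 f g)
    then show ?case using polynomial_sum.intros(2)[OF 2(3,4)] by (simp add: distrib_left)
  qed
next
  case (2 f1 f2)
  then show ?case using polynomial_sum.intros(2)[OF 2(3,4)[OF 2(5)]] by (simp add: distrib_right)
qed

lemma polynomial_sum_const: "polynomial_sum (\<lambda>x. c)"
  using polynomial_sum.intros(1)[of c "\<lambda>_. 0"] by (simp add: monomial_def)

lemma polynomial_sum_component:
  fixes j :: "'n::finite"
  shows "polynomial_sum (\<lambda>x. c * x $ j)"
proof -
  have "monomial (\<lambda>i. if i = j then 1 else 0) x = x $ j" for x :: "real^'n"
    by (simp add: monomial_remove[of _ x j])
  then show ?thesis using polynomial_sum.intros(1)[of c "\<lambda>i. if i = j then 1 else 0"] by simp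
qed

lemma real_polynomial_function_imp_polynomial_sum:
  "real_polynomial_function f \<Longrightarrow> polynomial_sum f"
proof (induction rule: real_polynomial_function.induct)
  case (linear f)
  have fin: "polynomial_sum (\<lambda>x. \<Sum>j\<in>S. f (axis j 1) * x $ j)" if "finite S" for S
    using that by induction (auto intro: polynomial_sum_const polynomial_sum.intros(2) polynomial_sum_component)
  have "(\<Sum>j\<in>UNIV. f (axis j 1) * x $ j) = f x" for x
  proof -
    interpret bounded_linear f by fact
    have "f x = f (\<Sum>j\<in>UNIV. x $ j *\<^sub>R axis j 1)"
      using basis_expansion[of x] by (simp add: scalar_mult_eq_scaleR)
    then show ?thesis by (simp add: sum scaleR mult.commute)
  qed
  then show ?case using fin[OF finite[of UNIV]] by simp
qed (auto intro: polynomial_sum_const polynomial_sum.intros(2) polynomial_sum_mult)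

text \<open>By linearity \<open>w \<psi>(|x|)\<close> is orthogonal to all polynomials, for a weight \<open>\<psi>\<close> that is positive inside the
shell and vanishes at its boundary. Approximating the conjugate of \<open>w\<close> uniformly by polynomials gives
\<open>\<integral> |w|\<^sup>2 \<psi> = 0\<close>.\<close>

lemma moments_eq_0_imp_eq_0:
  assumes p: "0 < p" and w: "continuous_on (shell p q) w"
    and mom: "\<And>\<alpha> \<psi>. continuous_on {0<..} \<psi> \<Longrightarrow> (\<And>r. 0 < r \<Longrightarrow> r \<notin> {p..q} \<Longrightarrow> \<psi> r = 0) \<Longrightarrow> moment w \<alpha> \<psi> = 0"
    and x0: "p < norm x0" "norm x0 < q"
  shows "w x0 = 0"
proof -
  define \<psi> where "\<psi> = (\<lambda>r. max 0 ((r - p) * (q - r)))"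
  have \<psi>: "continuous_on S \<psi>" for S unfolding \<psi>_def by (intro continuous_intros)
  have \<psi>0: "\<psi> r = 0" if "r \<notin> {p..q}" for r
    using that x0 by (auto simp: \<psi>_def max_def mult_le_0_iff zero_le_mult_iff)
  have \<psi>pos: "\<psi> r \<ge> 0" for r by (simp add: \<psi>_def)
  define K where "K = (shell p q :: (real^3) set)"
  have K: "compact K" by (simp add: K_def compact_shell)
  define v where "v = (\<lambda>x. w x * of_real (\<psi> (norm x)))"
  have cv: "continuous_on K v"
    unfolding v_def K_def by (intro continuous_intros w continuous_on_compose2[OF \<psi>[of UNIV]]) auto
  have int: "set_integrable lborel K f" if "continuous_on K f" for f :: "real^3 \<Rightarrow> complex"
    unfolding set_integrable_def by (intro borel_integrable_compact K that)
  have poly: "polynomial_sum g \<Longrightarrow> continuous_on K g \<and> (LINT x:K|lborel. v x * of_real (g x)) = 0" for g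
  proof (induction rule: polynomial_sum.induct)
    case (1 c \<alpha>)
    have "0 = moment w \<alpha> (\<lambda>r. of_real (c * \<psi> r))"
      by (rule sym, rule mom, intro continuous_intros \<psi>) (simp add: \<psi>0)
    also have "\<dots> = (LINT x:K|lborel. w x * (of_real (monomial \<alpha> x) * of_real (c * \<psi> (norm x))))"
      unfolding K_def by (rule moment_eq_shell[OF p]) (use \<psi>0 in auto)
    also have "\<dots> = (LINT x:K|lborel. v x * of_real (c * monomial \<alpha> x))"
      by (intro arg_cong[of _ _ "set_lebesgue_integral lborel K"] ext) (simp add: v_def)
    finally show ?case by (auto intro!: continuous_intros)
  next
    case (2 f g)
    then have c: "continuous_on K f" "continuous_on K g" by auto
    have "(LINT x:K|lborel. v x * of_real (f x + g x)) = (LINT x:K|lborel. v x * of_real (f x) + v x * of_real (g x))"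
      by (simp add: distrib_left)
    also have "\<dots> = (LINT x:K|lborel. v x * of_real (f x)) + (LINT x:K|lborel. v x * of_real (g x))"
      by (intro set_integral_add int continuous_intros cv c)
    finally show ?case using 2 c by (auto intro!: continuous_intros)
  qed
  define I where "I = (LINT x:K|lborel. v x * cnj (w x))"
  define N where "N = (LINT x:K|lborel. norm (v x))"
  have "norm I \<le> 2 * e * N" if e: "e > 0" for e
  proof -
    have "continuous_on K (\<lambda>x. Re (w x))" "continuous_on K (\<lambda>x. Im (w x))"
      using w by (auto simp: K_def intro!: continuous_intros)
    note cont = this
    obtain g1 where g1: "real_polynomial_function g1" "\<And>x. x \<in> K \<Longrightarrow> \<bar>Re (w x) - g1 x\<bar> < e"
      by (rule Stone_Weierstrass_real_polynomial_function[OF K cont(1) e]) blast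
    obtain g2 where g2: "real_polynomial_function g2" "\<And>x. x \<in> K \<Longrightarrow> \<bar>Im (w x) - g2 x\<bar> < e"
      by (rule Stone_Weierstrass_real_polynomial_function[OF K cont(2) e]) blast
    note g = g1(1) g2(1) and ap = g1(2) g2(2)
    note g' = g[THEN real_polynomial_function_imp_polynomial_sum, THEN poly]
    define h where "h = (\<lambda>x. of_real (g1 x) - \<i> * of_real (g2 x))"
    have ch: "continuous_on K h" unfolding h_def using g' by (auto intro!: continuous_intros)
    have cw: "continuous_on K (\<lambda>x. cnj (w x))" using w by (auto simp: K_def intro!: continuous_intros)
    have "(LINT x:K|lborel. v x * h x) = (LINT x:K|lborel. v x * of_real (g1 x)) - (LINT x:K|lborel. \<i> * (v x * of_real (g2 x)))"
      unfolding h_def right_diff_distrib using g' 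
      by (subst set_integral_diff(2)[symmetric]) (auto intro!: int continuous_intros cv simp: mult_ac)
    also have "\<dots> = 0" using g' by simp
    finally have "I = (LINT x:K|lborel. v x * cnj (w x)) - (LINT x:K|lborel. v x * h x)"
      by (simp add: I_def)
    also have "\<dots> = (LINT x:K|lborel. v x * (cnj (w x) - h x))"
      unfolding right_diff_distrib
      by (subst set_integral_diff(2)[symmetric]) (auto intro!: int continuous_intros cv ch cw)
    finally have I_eq: "I = (LINT x:K|lborel. v x * (cnj (w x) - h x))" .
    have "norm I \<le> (LINT x|lborel. norm (indicator K x *\<^sub>R (v x * (cnj (w x) - h x))))"
      unfolding I_eq set_lebesgue_integral_def by (rule integral_norm_bound)
    also have "\<dots> \<le> (LINT x|lborel. 2 * e * (indicator K x *\<^sub>R norm (v x)))"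
    proof (rule integral_mono)
      show "integrable lborel (\<lambda>x. norm (indicator K x *\<^sub>R (v x * (cnj (w x) - h x))))"
        by (intro integrable_norm borel_integrable_compact K continuous_intros cv ch cw)
      show "integrable lborel (\<lambda>x. 2 * e * (indicator K x *\<^sub>R norm (v x)))"
        by (intro integrable_mult_right borel_integrable_compact K continuous_intros cv)
      fix x
      have "norm (cnj (w x) - h x) \<le> 2 * e" if "x \<in> K"
        using cmod_le[of "cnj (w x) - h x"] ap[OF that] by (simp add: h_def)
      then have "norm (v x) * norm (cnj (w x) - h x) \<le> norm (v x) * (2 * e)" if "x \<in> K"
        using that by (intro mult_left_mono) auto
      then show "norm (indicator K x *\<^sub>R (v x * (cnj (w x) - h x))) \<le> 2 * e * (indicator K x *\<^sub>R norm (v x))"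
        by (auto simp: indicator_def norm_mult mult_ac)
    qed
    also have "\<dots> = 2 * e * N" by (simp add: N_def set_lebesgue_integral_def)
    finally show ?thesis .
  qed
  note Ibd = this
  have I0: "I = 0"
  proof (rule ccontr)
    assume "I \<noteq> 0"
    have "N \<ge> 0" unfolding N_def set_lebesgue_integral_def by (intro integral_nonneg_AE) auto
    have "norm I \<le> norm I * (N / (2 * (N + 1)))"
    proof -
      have "2 * (a / (4 * b)) * N = a * (N / (2 * b))" for a b :: real by simp
      then show ?thesis
        using Ibd[of "norm I / (4 * (N + 1))"] \<open>I \<noteq> 0\<close> \<open>N \<ge> 0\<close>
        by (simp only:) simp
    qed
    also have "\<dots> \<le> norm I * (1 / 2)"
      using \<open>N \<ge> 0\<close> by (intro mult_left_mono) (auto simp: field_simps)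
    finally show False using \<open>I \<noteq> 0\<close> by simp
  qed
  define F where "F = (\<lambda>x. indicator K x *\<^sub>R ((norm (w x))\<^sup>2 * \<psi> (norm x)))"
  have pt: "of_real ((norm (w x))\<^sup>2 * \<psi> (norm x)) = v x * cnj (w x)" for x
    by (simp only: of_real_mult complex_norm_square v_def mult_ac)
  have "complex_of_real (LINT x|lborel. F x) = I"
    unfolding I_def set_lebesgue_integral_def F_def integral_complex_of_real[symmetric]
    by (intro Bochner_Integration.integral_cong)
      (auto simp: indicator_def pt simp del: of_real_mult of_real_power)
  then have "(LINT x|lborel. F x) = 0" using I0 by simp
  moreover have "integrable lborel F"
    unfolding F_def K_def using w
    by (intro borel_integrable_compact compact_shell continuous_intros continuous_on_compose2[OF \<psi>[of UNIV]]) auto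
  moreover have "AE x in lborel. 0 \<le> F x"
    by (intro AE_I2) (simp add: F_def \<psi>pos indicator_def)
  ultimately have ae: "AE x in lborel. F x = 0"
    using integral_nonneg_eq_0_iff_AE[of lborel F] by blast
  show ?thesis
  proof (rule ccontr)
    assume nz: "w x0 \<noteq> 0"
    define G where "G = {x::real^3. p < norm x \<and> norm x < q}"
    have G: "open G" "x0 \<in> G" "G \<subseteq> K"
      using x0 by (auto simp: G_def K_def shell_def open_Collect_conj open_Collect_less continuous_on_norm)
    have "continuous_on G w" using w G(3) by (auto simp: K_def intro: continuous_on_subset)
    then have "open (G \<inter> w -` (- {0}))"
      using G(1) by (intro continuous_open_preimage) auto
    moreover have "x0 \<in> G \<inter> w -` (- {0})" using G(2) nz by simp
    ultimately obtain e where e: "e > 0" "ball x0 e \<subseteq> G \<inter> w -` (- {0})"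
      by (meson openE)
    have "AE x in lborel. x \<notin> ball x0 e"
      using ae
    proof eventually_elim
      case (elim x)
      show ?case
      proof
        assume "x \<in> ball x0 e"
        then have x: "x \<in> G" "w x \<noteq> 0" using e(2) by auto
        then have "\<psi> (norm x) > 0" by (auto simp: \<psi>_def G_def)
        then show False using elim x G(3) by (auto simp: F_def)
      qed
    qed
    then have "emeasure lborel (ball x0 e) = 0"
      by (subst (asm) AE_iff_measurable[of "ball x0 e"]) auto
    then have "measure lborel (ball x0 e) = 0" by (simp add: measure_def)
    then show False using content_ball_pos[OF e(1), of x0] by simp
  qed
qed

section \<open>Unique continuation and the Rellich lemma\<close>

text \<open>After a translation the ball is centred at the origin, and all moments on shells inside it vanish.\<close>

lemma helmholtz_eq_0_ball:
  fixes u :: "real^3 \<Rightarrow> complex"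
  assumes k: "k \<noteq> 0" and u: "C2_on (ball a R) u"
    and pde: "\<And>x. x \<in> ball a R \<Longrightarrow> laplacian u x + of_real (k\<^sup>2) * u x = 0"
    and \<delta>: "0 < \<delta>" "\<And>x. x \<in> ball a \<delta> \<Longrightarrow> u x = 0" and x: "x \<in> ball a R"
  shows "u x = 0"
proof (cases "x \<in> ball a \<delta>")
  case False
  define w where "w = (\<lambda>x. u (a + x))"
  define y where "y = x - a"
  have y: "norm y < R" "\<delta> \<le> norm y" using x False by (auto simp: y_def dist_norm norm_minus_commute)
  have w: "C2_on (ball 0 R) w"
    unfolding w_def by (rule C2_on_translate[OF u]) (simp add: dist_norm)
  have wp: "laplacian w z + of_real (k\<^sup>2) * w z = 0" if "z \<in> ball 0 R" for z
    using pde[of "a + z"] that unfolding w_def laplacian_translate by (simp add: dist_norm)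
  have w0: "w z = 0" if "z \<in> ball 0 \<delta>" for z
    using \<delta>(2)[of "a + z"] that by (simp add: w_def dist_norm)
  have "w y = 0"
  proof (rule moments_eq_0_imp_eq_0)
    show "0 < \<delta> / 2" "\<delta> / 2 < norm y" "norm y < (norm y + R) / 2" using \<delta>(1) y by auto
    show "continuous_on (shell (\<delta> / 2) ((norm y + R) / 2)) w"
      using C2_on_continuous(1)[OF w] by (rule continuous_on_subset) (use y in \<open>auto simp: shell_def\<close>)
    show "moment w \<alpha> \<psi> = 0" if "continuous_on {0<..} \<psi>"
      "\<And>r. 0 < r \<Longrightarrow> r \<notin> {\<delta> / 2..(norm y + R) / 2} \<Longrightarrow> \<psi> r = 0" for \<alpha> \<psi>
      by (rule moment_eq_0_if_zero_near_center[OF k w wp \<delta>(1) w0 _ _ _ that(1),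
            where p = "\<delta> / 2" and q = "(norm y + R) / 2"]) (use \<delta>(1) y that(2) in auto)
  qed
  then show ?thesis by (simp add: w_def y_def)
qed (use \<delta> in auto)

text \<open>The interior of the zero set is closed relative to \<open>U\<close>: a limit point \<open>z\<close> has points \<open>y\<close> of the interior
so close that a ball around \<open>y\<close> inside \<open>U\<close> contains \<open>z\<close>, and the solution vanishes on that ball.\<close>

lemma helmholtz_unique_continuation:
  fixes u :: "real^3 \<Rightarrow> complex"
  assumes k: "k \<noteq> 0" and U: "open U" "connected U" and u: "C2_on U u"
    and pde: "\<And>x. x \<in> U \<Longrightarrow> laplacian u x + of_real (k\<^sup>2) * u x = 0"
    and V: "open V" "V \<noteq> {}" "V \<subseteq> U" "\<And>x. x \<in> V \<Longrightarrow> u x = 0" and x: "x \<in> U"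
  shows "u x = 0"
proof -
  define S where "S = interior {x \<in> U. u x = 0}"
  define T where "T = U - closure S"
  have S: "open S" "S \<subseteq> U" "\<And>y. y \<in> S \<Longrightarrow> u y = 0"
    using interior_subset[of "{x \<in> U. u x = 0}"] by (auto simp: S_def)
  have "V \<subseteq> S" unfolding S_def using V by (intro interior_maximal) auto
  have clos: "z \<in> S" if z: "z \<in> U" "z \<in> closure S" for z
  proof -
    obtain r where r: "r > 0" "ball z (2 * r) \<subseteq> U"
    proof -
      obtain e where "e > 0" "ball z e \<subseteq> U" using U(1) z(1) by (meson openE)
      then show ?thesis using that[of "e / 2"] by simp
    qed
    obtain y where y: "y \<in> S" "dist y z < r" using z(2) r(1) by (auto simp: closure_approachable)
    obtain \<delta> where \<delta>: "\<delta> > 0" "ball y \<delta> \<subseteq> S" using S(1) y(1) by (meson openE)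
    have sub: "ball y r \<subseteq> U"
    proof
      fix p assume "p \<in> ball y r"
      then have "dist z p < 2 * r" using y(2) dist_triangle[of z p y] by (simp add: dist_commute)
      then show "p \<in> U" using r(2) by auto
    qed
    have "u p = 0" if "p \<in> ball y r" for p
      by (rule helmholtz_eq_0_ball[OF k C2_on_subset[OF u sub] pde \<delta>(1) S(3) that]) (use sub \<delta>(2) in auto)
    then have "ball y r \<subseteq> S" unfolding S_def using sub by (intro interior_maximal) auto
    then show "z \<in> S" using y(2) by auto
  qed
  have T: "open T" "S \<inter> T \<inter> U = {}" "U \<subseteq> S \<union> T"
    using U(1) clos closure_subset[of S] by (auto simp: T_def)
  from connectedD[OF U(2) S(1) T] have "T \<inter> U = {}"
    using \<open>V \<subseteq> S\<close> V S(2) by blast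
  then show ?thesis using T(3) S(3) x by blast
qed

text \<open>All moments on shells outside the ball vanish. Decay like \<open>1 / r\<close> would not be enough: the spherical wave
\<open>exp (\<i> k r) / r\<close> is a solution.\<close>

lemma rellich:
  fixes w :: "real^3 \<Rightarrow> complex"
  assumes k: "k \<noteq> 0" and w: "C2_on {x. R0 < norm x} w" 
    and pde: "\<And>x. R0 < norm x \<Longrightarrow> laplacian w x + of_real (k\<^sup>2) * w x = 0"
    and decay: "\<And>x. R0 < norm x \<Longrightarrow> norm (w x) \<le> C / (norm x)\<^sup>2" and "0 \<le> R0"
    and x: "R0 < norm x"
  shows "w x = 0"
proof (rule moments_eq_0_imp_eq_0)
  show "0 < (R0 + norm x) / 2" "(R0 + norm x) / 2 < norm x" "norm x < norm x + 1"
    using x \<open>0 \<le> R0\<close> by auto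
  show "continuous_on (shell ((R0 + norm x) / 2) (norm x + 1)) w"
    using C2_on_continuous(1)[OF w] by (rule continuous_on_subset) (use x in \<open>auto simp: shell_def\<close>)
  show "moment w \<alpha> \<psi> = 0" if "continuous_on {0<..} \<psi>"
    "\<And>r. 0 < r \<Longrightarrow> r \<notin> {(R0 + norm x) / 2..norm x + 1} \<Longrightarrow> \<psi> r = 0" for \<alpha> \<psi>
    by (rule moment_eq_0_if_decaying[OF k w pde decay \<open>0 \<le> R0\<close> _ _ that(1),
          where p = "(R0 + norm x) / 2" and q = "norm x + 1"]) (use x that(2) in auto)
qed

section \<open>A maximum principle in slabs\<close>

text \<open>With a positive second derivative at a critical point the first derivative would be positive just to the
right of it, and the function would exceed its maximum.\<close>

lemma second_derivative_le_0_at_max: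
  fixes f f1 :: "real \<Rightarrow> real"
  assumes "d > 0" and f: "\<And>t. \<bar>t\<bar> < d \<Longrightarrow> (f has_real_derivative f1 t) (at t)"
    and f1: "(f1 has_real_derivative D) (at 0)" and max: "\<And>t. \<bar>t\<bar> < d \<Longrightarrow> f t \<le> f 0"
  shows "D \<le> 0"
proof (rule ccontr)
  assume "\<not> D \<le> 0"
  then have "D > 0" by simp
  have "f1 0 = 0"
    using DERIV_local_max[OF f[of 0] \<open>d > 0\<close>] max \<open>d > 0\<close> by auto
  obtain e where e: "e > 0" "\<And>h. 0 < h \<Longrightarrow> h < e \<Longrightarrow> f1 0 < f1 (0 + h)"
    using DERIV_pos_inc_right[OF f1 \<open>D > 0\<close>] by auto
  define t where "t = min d e / 2"
  have t: "0 < t" "t < d" "t < e" using \<open>d > 0\<close> e(1) by (auto simp: t_def)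
  have "f 0 < f t"
  proof (rule DERIV_pos_imp_increasing_open[OF t(1)])
    show "\<exists>y. (f has_real_derivative y) (at s) \<and> y > 0" if "0 < s" "s < t" for s
      using f[of s] e(2)[of s] that t \<open>f1 0 = 0\<close> by auto
    show "continuous_on {0..t} f"
    proof (intro continuous_at_imp_continuous_on ballI)
      show "isCont f s" if "s \<in> {0..t}" for s
        by (rule DERIV_isCont[OF f]) (use that t in auto)
    qed
  qed
  then show False using max[of t] t by auto
qed

text \<open>The function \<open>\<phi> x = cos (\<kappa> (x \<bullet> e - c))\<close> is positive on the closure of \<open>A\<close> and satisfies
\<open>\<Delta> \<phi> + \<kappa>\<^sup>2 \<phi> = 0\<close> with \<open>\<kappa>\<^sup>2\<close> above \<open>\<mu>\<close>. If \<open>v\<close> were positive somewhere, \<open>v / \<phi>\<close> would have a positive maximum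
\<open>M\<close>, attained inside \<open>A\<close> because of the boundary values. There \<open>v - M \<phi>\<close> has a maximum as well, so its
Laplacian is at most 0, whereas the equations give the positive value \<open>M \<phi> (\<kappa>\<^sup>2 - \<mu>)\<close>.\<close>

lemma slab_maximum_principle:
  fixes v :: "'a::euclidean_space \<Rightarrow> real" and dv ddv :: "'a \<Rightarrow> 'a \<Rightarrow> real"
  assumes A: "open A" "bounded A" and v: "continuous_on (closure A) v"
    and dv: "\<And>b x. b \<in> Basis \<Longrightarrow> x \<in> A \<Longrightarrow> has_dirderiv v b (dv b x) x"
    and ddv: "\<And>b x. b \<in> Basis \<Longrightarrow> x \<in> A \<Longrightarrow> has_dirderiv (dv b) b (ddv b x) x"
    and pde: "\<And>x. x \<in> A \<Longrightarrow> (\<Sum>b\<in>Basis. ddv b x) = - \<mu> * v x"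
    and bdry: "\<And>x. x \<in> frontier A \<Longrightarrow> v x \<le> 0"
    and e: "norm e = 1" and \<kappa>: "\<mu> < \<kappa>\<^sup>2" and slab: "\<And>x. x \<in> closure A \<Longrightarrow> \<bar>\<kappa> * (x \<bullet> e - c)\<bar> < pi / 2"
    and x0: "x0 \<in> A"
  shows "v x0 \<le> 0"
proof (rule ccontr)
  assume "\<not> v x0 \<le> 0"
  then have v0: "v x0 > 0" by simp
  define \<phi> where "\<phi> = (\<lambda>x. cos (\<kappa> * (x \<bullet> e - c)))"
  define \<phi>1 where "\<phi>1 = (\<lambda>b x. - \<kappa> * (b \<bullet> e) * sin (\<kappa> * (x \<bullet> e - c)))"
  define \<phi>2 where "\<phi>2 = (\<lambda>b x. - \<kappa>\<^sup>2 * (b \<bullet> e)\<^sup>2 * \<phi> x)"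
  have \<phi>pos: "\<phi> x > 0" if "x \<in> closure A" for x
    unfolding \<phi>_def using slab[OF that] by (intro cos_gt_zero_pi) auto
  have \<phi>1: "has_dirderiv \<phi> b (\<phi>1 b x) x" for b x
    unfolding has_dirderiv_def \<phi>_def \<phi>1_def has_real_derivative_iff_has_vector_derivative[symmetric]
    by (auto intro!: derivative_eq_intros simp: inner_add_left algebra_simps)
  have \<phi>2: "has_dirderiv (\<phi>1 b) b (\<phi>2 b x) x" for b x
    unfolding has_dirderiv_def \<phi>_def \<phi>1_def \<phi>2_def has_real_derivative_iff_has_vector_derivative[symmetric]
    by (auto intro!: derivative_eq_intros simp: inner_add_left algebra_simps power2_eq_square)
  have "continuous_on (closure A) (\<lambda>x. v x / \<phi> x)"
    using \<phi>pos unfolding \<phi>_def by (intro continuous_intros v) (fastforce simp: \<phi>_def)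
  moreover have "compact (closure A)" "closure A \<noteq> {}"
    using A x0 closure_subset by (auto simp: compact_closure)
  ultimately obtain x1 where x1: "x1 \<in> closure A" "\<And>x. x \<in> closure A \<Longrightarrow> v x / \<phi> x \<le> v x1 / \<phi> x1"
    using continuous_attains_sup[of "closure A" "\<lambda>x. v x / \<phi> x"] by blast
  define M where "M = v x1 / \<phi> x1"
  have x0c: "x0 \<in> closure A" using x0 closure_subset by auto
  have "0 < v x0 / \<phi> x0" using v0 \<phi>pos[OF x0c] by simp
  also have "\<dots> \<le> M" unfolding M_def by (rule x1(2)[OF x0c])
  finally have M: "M > 0" .
  then have "v x1 > 0" using \<phi>pos[OF x1(1)] by (simp add: M_def zero_less_divide_iff)
  then have x1A: "x1 \<in> A" using bdry[of x1] x1(1) A(1) by (auto simp: frontier_def interior_open)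
  have vM: "v x1 = M * \<phi> x1" using \<phi>pos[OF x1(1)] by (simp add: M_def)
  define g where "g = (\<lambda>x. v x - M * \<phi> x)"
  define g1 where "g1 = (\<lambda>b x. dv b x - M * \<phi>1 b x)"
  have g0: "g x \<le> g x1" if "x \<in> A" for x
  proof -
    have "x \<in> closure A" using that closure_subset by auto
    then have "v x / \<phi> x \<le> M" "\<phi> x > 0" using x1(2) \<phi>pos by (auto simp: M_def)
    then show ?thesis by (simp add: g_def vM field_simps)
  qed
  obtain d where d: "d > 0" "ball x1 d \<subseteq> A" using A(1) x1A by (meson openE)
  have le: "ddv b x1 - M * \<phi>2 b x1 \<le> 0" if b: "b \<in> Basis" for b
  proof (rule second_derivative_le_0_at_max[OF d(1)])
    have inA: "x1 + t *\<^sub>R b \<in> A" if "\<bar>t\<bar> < d" for t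
      using d(2) that b by (intro subsetD[OF d(2)]) (simp add: dist_norm)
    have dm: "has_dirderiv (\<lambda>x. f x - M * h x) b (f' - M * h') x"
      if "has_dirderiv f b f' x" "has_dirderiv h b h' x" for f h :: "'a \<Rightarrow> real" and f' h' x
      using that by (auto simp: has_dirderiv_def intro!: derivative_eq_intros)
    show "((\<lambda>t. g (x1 + t *\<^sub>R b)) has_real_derivative g1 b (x1 + t *\<^sub>R b)) (at t)" if "\<bar>t\<bar> < d" for t
      unfolding g_def g1_def
      by (rule has_dirderiv_real_line, rule dm) (rule dv[OF b inA[OF that]], rule \<phi>1)
    show "((\<lambda>t. g1 b (x1 + t *\<^sub>R b)) has_real_derivative ddv b x1 - M * \<phi>2 b x1) (at 0)"
      unfolding g1_def
      by (rule has_dirderiv_real_line, rule dm) (use ddv[OF b x1A] \<phi>2 in simp_all)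
    show "g (x1 + t *\<^sub>R b) \<le> g (x1 + 0 *\<^sub>R b)" if "\<bar>t\<bar> < d" for t
      using g0[OF inA[OF that]] by simp
  qed
  have "(\<Sum>b\<in>Basis. ddv b x1 - M * \<phi>2 b x1) \<le> 0" by (intro sum_nonpos le)
  moreover have "(\<Sum>b\<in>Basis. \<phi>2 b x1) = - \<kappa>\<^sup>2 * \<phi> x1"
  proof -
    have "(\<Sum>b\<in>Basis. (b \<bullet> e)\<^sup>2) = 1"
      using e by (simp add: norm_eq_1 euclidean_inner[of e e] power2_eq_square inner_commute)
    moreover have "(\<Sum>b\<in>Basis. \<phi>2 b x1) = (\<Sum>b\<in>Basis. (b \<bullet> e)\<^sup>2) * (- \<kappa>\<^sup>2 * \<phi> x1)"
      unfolding \<phi>2_def sum_distrib_right by (intro sum.cong) auto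
    ultimately show ?thesis by simp
  qed
  ultimately have "M * \<phi> x1 * (\<kappa>\<^sup>2 - \<mu>) \<le> 0"
    using pde[OF x1A] by (simp add: sum_subtractf vM algebra_simps flip: sum_distrib_left)
  moreover have "M * \<phi> x1 * (\<kappa>\<^sup>2 - \<mu>) > 0" using M \<phi>pos[OF x1(1)] \<kappa> by simp
  ultimately show False by simp
qed

section \<open>The first Dirichlet eigenvalue of an interval\<close>

lemma open_bounded_real_interval:
  fixes J :: "real set"
  assumes "J \<noteq> {}" "open J" "bounded J" "is_interval J"
  obtains a b where "a < b" "J = {a<..<b}"
proof -
  have bdd: "bdd_below J" "bdd_above J"
    using assms(3) by (auto simp: bounded_imp_bdd_below bounded_imp_bdd_above)
  have "Inf J < x \<and> x < Sup J" if x: "x \<in> J" for x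
  proof -
    obtain e where e: "e > 0" "ball x e \<subseteq> J" using assms(2) x by (meson openE)
    have "x - e / 2 \<in> J" "x + e / 2 \<in> J" using e by (auto simp: dist_real_def intro!: subsetD[OF e(2)])
    then have "Inf J \<le> x - e / 2" "x + e / 2 \<le> Sup J"
      using bdd by (auto intro: cInf_lower cSup_upper)
    then show ?thesis using e(1) by simp
  qed
  moreover have "x \<in> J" if x: "Inf J < x" "x < Sup J" for x
  proof -
    obtain y where "y \<in> J" "y < x" using cInf_lessD[OF assms(1) x(1)] by blast
    moreover obtain z where "z \<in> J" "x < z" using less_cSupD[OF assms(1) x(2)] by blast
    ultimately show ?thesis using mem_is_interval_1_I[OF assms(4), of y z x] by simp
  qed
  ultimately have "J = {Inf J<..<Sup J}" by auto
  moreover from this have "Inf J < Sup J" using assms(1) by (metis greaterThanLessThan_empty not_le_imp_less)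
  ultimately show ?thesis using that by blast
qed

lemma dirichlet_eigenvalue_sine:
  assumes "a < b"
  shows "dirichlet_eigenvalue {a<..<b} ((pi / (b - a))\<^sup>2)"
proof -
  define \<omega> where "\<omega> = pi / (b - a)"
  define s where "s = (\<lambda>t. sin (\<omega> * (t - a)))"
  define s1 where "s1 = (\<lambda>t. \<omega> * cos (\<omega> * (t - a)))"
  define s2 where "s2 = (\<lambda>t. - \<omega>\<^sup>2 * sin (\<omega> * (t - a)))"
  have fd: "f differentiable at t" "frechet_derivative f (at t) v = f' t * v"
    if "\<And>t. (f has_real_derivative f' t) (at t)" for f f' :: "real \<Rightarrow> real" and t v
    using that[of t, unfolded has_field_derivative_def] frechet_derivative_at[of f "(*) (f' t)" t]
    by (auto simp: differentiable_def dest: fun_cong)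
  have s: "(s has_real_derivative s1 t) (at t)" for t
    unfolding s_def s1_def by (auto intro!: derivative_eq_intros)
  have s1: "(s1 has_real_derivative s2 t) (at t)" for t
    unfolding s1_def s2_def by (auto intro!: derivative_eq_intros simp: power2_eq_square)
  have s1': "((\<lambda>t. s1 t * v) has_real_derivative s2 t * v) (at t)" for t v
    using DERIV_cmult_right[OF s1] .
  have C2: "C2_on {a<..<b} s"
    unfolding C2_on_def C1_on_def fd(2)[OF s] fd(2)[OF s1']
    using fd(1)[OF s] fd(1)[OF s1'] by (auto simp: s1_def s2_def intro!: continuous_intros)
  have "deriv s = s1" "deriv s1 = s2" using s s1 by (auto intro: DERIV_imp_deriv)
  moreover have "s a = 0" "s b = 0" using assms by (auto simp: s_def \<omega>_def)
  moreover have "s ((a + b) / 2) \<noteq> 0"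
  proof -
    have "\<omega> * ((a + b) / 2 - a) = pi / 2" using assms by (simp add: \<omega>_def field_simps)
    then show ?thesis by (simp add: s_def)
  qed
  moreover have "continuous_on S s" for S unfolding s_def by (intro continuous_intros)
  ultimately show ?thesis
    unfolding dirichlet_eigenvalue_def \<omega>_def[symmetric]
    using assms C2 by (intro exI[of _ s]) (auto simp: frontier_def s2_def s_def intro!: bexI[of _ "(a + b) / 2"])
qed

text \<open>For a smaller \<open>\<mu>\<close> there is room for a cosine with \<open>\<mu> < \<kappa>\<^sup>2\<close> that is positive on the closed interval,
and the maximum principle, applied to an eigenfunction and to its negative, shows that it is zero.\<close>

lemma dirichlet_eigenvalue_ge:
  assumes "a < b" "dirichlet_eigenvalue {a<..<b} \<mu>"
  shows "(pi / (b - a))\<^sup>2 \<le> \<mu>"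
proof (rule ccontr)
  assume "\<not> ?thesis"
  then have \<mu>: "\<mu> < (pi / (b - a))\<^sup>2" by simp
  define J where "J = {a<..<b}"
  obtain v where v: "continuous_on (closure J) v" "C2_on J v" "\<exists>t\<in>J. v t \<noteq> 0"
    "\<And>t. t \<in> frontier J \<Longrightarrow> v t = 0" "\<And>t. t \<in> J \<Longrightarrow> - deriv (deriv v) t = \<mu> * v t"
    using assms(2) unfolding dirichlet_eigenvalue_def J_def by blast
  \<comment> \<open>the eigenvalue \<open>\<mu>\<close> may be negative\<close>
  define r where "r = sqrt (max \<mu> 0)"
  have r: "0 \<le> r" "r < pi / (b - a)" "\<mu> \<le> r\<^sup>2"
    using \<mu> assms(1) by (auto simp: r_def intro!: real_less_lsqrt)
  obtain \<kappa> where \<kappa>: "r < \<kappa>" "\<kappa> < pi / (b - a)" using dense[OF r(2)] by blast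
  have \<mu>\<kappa>: "\<mu> < \<kappa>\<^sup>2" using r \<kappa> power_strict_mono[of r \<kappa> 2] by simp
  have d1: "has_dirderiv v 1 (frechet_derivative v (at t) 1) t"
    "has_dirderiv (\<lambda>t. frechet_derivative v (at t) 1) 1
       (frechet_derivative (\<lambda>y. frechet_derivative v (at y) 1) (at t) 1) t" if "t \<in> J" for t
    using C2_on_dirderiv[OF v(2) that] by auto
  have deriv: "deriv f t = f'" if "has_dirderiv f 1 f' t" for f :: "real \<Rightarrow> real" and f' t
    using has_dirderiv_real_line[of f 1 f' 0 t] that by (auto intro: DERIV_imp_deriv)
  have dd: "deriv (deriv v) t = frechet_derivative (\<lambda>y. frechet_derivative v (at y) 1) (at t) 1" if "t \<in> J" for t
  proof (rule deriv)
    show "has_dirderiv (deriv v) 1 (frechet_derivative (\<lambda>y. frechet_derivative v (at y) 1) (at t) 1) t"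
      by (rule has_dirderiv_cong_open[OF d1(2)[OF that], of J]) (use that deriv[OF d1(1)] in \<open>auto simp: J_def\<close>)
  qed
  have slab: "\<bar>\<kappa> * (t \<bullet> 1 - (a + b) / 2)\<bar> < pi / 2" if "t \<in> closure J" for t :: real
  proof -
    have "\<bar>t - (a + b) / 2\<bar> \<le> (b - a) / 2"
      using that assms(1) unfolding J_def by (auto simp: abs_le_iff field_simps)
    then have "\<kappa> * \<bar>t - (a + b) / 2\<bar> \<le> \<kappa> * ((b - a) / 2)" using r \<kappa> by (intro mult_left_mono) auto
    also have "\<dots> < pi / (b - a) * ((b - a) / 2)" using \<kappa>(2) assms(1) by (intro mult_strict_right_mono) auto
    finally show ?thesis using assms(1) r \<kappa> by (simp add: abs_mult)
  qed
  have le: "\<sigma> * v t \<le> 0" if "t \<in> J" for \<sigma> t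
  proof (rule slab_maximum_principle[where A = J and v = "\<lambda>t. \<sigma> * v t" and e = 1 and \<mu> = \<mu> and \<kappa> = \<kappa>
        and c = "(a + b) / 2"
        and dv = "\<lambda>b t. \<sigma> * frechet_derivative v (at t) 1" and ddv = "\<lambda>b t. \<sigma> * deriv (deriv v) t"])
    show "continuous_on (closure J) (\<lambda>t. \<sigma> * v t)" by (intro continuous_intros v)
    show "has_dirderiv (\<lambda>t. \<sigma> * v t) b (\<sigma> * frechet_derivative v (at t) 1) t" if "b \<in> Basis" "t \<in> J" for b t
      using d1(1)[OF that(2)] that(1) by (auto simp: has_dirderiv_def intro!: derivative_eq_intros)
    show "has_dirderiv (\<lambda>t. \<sigma> * frechet_derivative v (at t) 1) b (\<sigma> * deriv (deriv v) t) t" if "b \<in> Basis" "t \<in> J" for b t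
      using d1(2)[OF that(2)] that(1) unfolding dd[OF that(2)] by (auto simp: has_dirderiv_def intro!: derivative_eq_intros)
    show "(\<Sum>b\<in>(Basis :: real set). \<sigma> * deriv (deriv v) t) = - \<mu> * (\<sigma> * v t)" if "t \<in> J" for t
    proof -
      have "deriv (deriv v) t = - (\<mu> * v t)" using v(5)[OF that] by linarith
      then show ?thesis by (simp add: mult.left_commute)
    qed
    show "\<sigma> * v t \<le> 0" if "t \<in> frontier J" for t using v(4)[OF that] by simp
  qed (use that slab \<mu>\<kappa> in \<open>auto simp: J_def\<close>)
  then have "v t = 0" if "t \<in> J" for t using le[of t 1] le[of t "-1"] that by simp
  then show False using v(3) by blast
qed

lemma first_dirichlet_eigenvalue_interval:
  assumes "a < b"
  shows "first_dirichlet_eigenvalue {a<..<b} = (pi / (b - a))\<^sup>2"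
  unfolding first_dirichlet_eigenvalue_def
  by (rule Least_equality) (use dirichlet_eigenvalue_sine dirichlet_eigenvalue_ge assms in auto)

section \<open>The exterior of the two obstacles\<close>

text \<open>At a boundary point \<open>p\<close> the domain is the part above a graph. The part strictly below the graph is open
and misses \<open>D\<close>, hence also the closure of \<open>D\<close>, and it contains points arbitrarily close to \<open>p\<close>.\<close>

lemma interior_closure_C2_domain:
  assumes "open D" "C2_boundary D"
  shows "interior (closure D) = D"
proof
  show "D \<subseteq> interior (closure D)" using assms(1) closure_subset by (intro interior_maximal)
  show "interior (closure D) \<subseteq> D"
  proof
    fix p assume p: "p \<in> interior (closure D)"
    show "p \<in> D"
    proof (rule ccontr)
      assume "p \<notin> D"
      then have "p \<in> frontier D"
        using p interior_subset[of "closure D"] assms(1) by (auto simp: frontier_def interior_open)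
      then obtain r and T :: "real^3 \<Rightarrow> real^3" and \<gamma> where r: "r > 0" and T: "orthogonal_transformation T" and \<gamma>: "C2_on UNIV \<gamma>"
        and D: "D \<inter> ball p r = {x \<in> ball p r. T x $ 3 > \<gamma> (T x $ 1, T x $ 2)}"
        using assms(2) unfolding C2_boundary_def by blast
      have lin: "linear T" using T by (rule orthogonal_transformation_linear)
      have c\<gamma>: "continuous_on UNIV \<gamma>" using C2_on_continuous(1)[OF \<gamma>] .
      have cT: "continuous_on S T" for S using lin by (simp add: linear_continuous_on linear_conv_bounded_linear)
      have c1: "continuous_on UNIV (\<lambda>x. \<gamma> (T x $ 1, T x $ 2))"
        by (rule continuous_on_compose2[OF c\<gamma>]) (auto intro!: continuous_intros cT)
      define B where "B = ball p r \<inter> {x. T x $ 3 < \<gamma> (T x $ 1, T x $ 2)}"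
      have "open B" unfolding B_def by (intro open_Int open_ball open_Collect_less c1 continuous_intros cT)
      moreover have "\<gamma> (T x $ 1, T x $ 2) < T x $ 3" if "x \<in> D" "x \<in> ball p r" for x
        using D that by blast
      then have "B \<inter> D = {}" by (fastforce simp: B_def)
      ultimately have B: "B \<inter> closure D = {}" by (simp add: open_Int_closure_eq_empty)
      obtain e where e: "e > 0" "ball p e \<subseteq> interior (closure D)" using p open_interior by (meson openE)
      \<comment> \<open>moving \<open>p\<close> against \<open>q\<close> lowers the third rotated coordinate only\<close>
      define q where "q = inv T (axis 3 1)"
      have Tq: "T q = axis 3 1" unfolding q_def using orthogonal_transformation_surj[OF T] by (rule surj_f_inv_f)
      define s where "s = min e r / (2 * (norm q + 1))"
      have s: "s > 0" "s * norm q < min e r"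
      proof -
        show "s > 0" using e r by (auto simp: s_def intro!: divide_pos_pos add_nonneg_pos)
        have "s * norm q \<le> s * (norm q + 1)" using \<open>s > 0\<close> by simp
        also have "\<dots> = min e r / 2"
        proof -
          have "m / (2 * t) * t = m / 2" if "t \<noteq> 0" for m t :: real using that by simp
          moreover have "norm q + 1 \<noteq> 0" using norm_ge_zero[of q] by linarith
          ultimately show ?thesis unfolding s_def by blast
        qed
        also have "\<dots> < min e r"
        proof -
          have "0 < min e r" using e r by simp
          then show ?thesis by linarith
        qed
        finally show "s * norm q < min e r" .
      qed
      define y where "y = p - s *\<^sub>R q"
      have y: "y \<in> ball p e" "y \<in> ball p r" using s by (auto simp: y_def dist_norm)
      have Ty: "T y = T p - s *\<^sub>R axis 3 1" by (simp add: y_def linear_diff[OF lin] linear_scale[OF lin] Tq)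
      have "T p $ 3 \<le> \<gamma> (T p $ 1, T p $ 2)"
        using D r \<open>p \<notin> D\<close> by (metis (no_types, lifting) IntI centre_in_ball mem_Collect_eq not_le_imp_less IntD1)
      then have "y \<in> B" using y(2) s(1) by (auto simp: B_def Ty axis_def)
      moreover have "y \<in> closure D" using y(1) e(2) interior_subset by blast
      ultimately show False using B by blast
    qed
  qed
qed

text \<open>In the direction of incidence the scattered wave tends to zero, while the incident wave has modulus 1.\<close>

lemma exterior_wave_nonzero:
  assumes bd: "norm d = 1" and D: "bounded D" and F: "R > 0"
    "\<And>r \<phi>. r \<ge> R \<Longrightarrow> \<phi> \<in> sphere 0 1 \<Longrightarrow> norm ((u (r *\<^sub>R \<phi>) - incident_wave d k (r *\<^sub>R \<phi>))
                 - exp (\<i> * of_real (k * r)) / of_real r * F \<phi>) \<le> C / r\<^sup>2"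
  shows "\<exists>x\<in>- closure D. u x \<noteq> 0"
proof (rule ccontr)
  assume "\<not> ?thesis"
  then have u0: "\<And>x. x \<notin> closure D \<Longrightarrow> u x = 0" by auto
  have "bounded (closure D)" using D by (rule bounded_closure)
  then obtain R' where R': "\<And>x. x \<in> closure D \<Longrightarrow> norm x \<le> R'" unfolding bounded_iff by blast
  have "1 \<le> norm (F d) / r + C / r\<^sup>2" if r: "r \<ge> R" "r > R'" for r
  proof -
    have r0: "r > 0" using r F(1) by simp
    have "r *\<^sub>R d \<notin> closure D" using R'[of "r *\<^sub>R d"] r r0 bd by auto
    then have "norm (- incident_wave d k (r *\<^sub>R d) - exp (\<i> * of_real (k * r)) / of_real r * F d) \<le> C / r\<^sup>2"
      using F(2)[of r d] r bd u0[of "r *\<^sub>R d"] by simp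
    moreover have "norm (- incident_wave d k (r *\<^sub>R d)) = 1" by (simp add: incident_wave_def)
    moreover have "norm (exp (\<i> * of_real (k * r)) / of_real r * F d) = norm (F d) / r"
      using r0 by (simp add: norm_mult norm_divide)
    ultimately show ?thesis
      using norm_triangle_ineq2[of "- incident_wave d k (r *\<^sub>R d)" "exp (\<i> * of_real (k * r)) / of_real r * F d"]
      by linarith
  qed
  then have "\<forall>\<^sub>F r in at_top. 1 \<le> norm (F d) / r + C / r\<^sup>2"
    unfolding eventually_at_top_linorder by (intro exI[of _ "max R (R' + 1)"]) auto
  moreover have "((\<lambda>r. norm (F d) / r + C / r\<^sup>2) \<longlongrightarrow> 0 + 0) at_top"
    by (intro tendsto_add tendsto_divide_0[OF tendsto_const] filterlim_at_top_imp_at_infinity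
        filterlim_ident filterlim_pow_at_top) auto
  ultimately have "(1::real) \<le> 0 + 0" by (intro tendsto_lowerbound) auto
  then show False by simp
qed

text \<open>This is the argument with the bounded open set \<open>A\<close> from the introduction; it is needed once for each
obstacle in the role of \<open>D1\<close>. The set \<open>\<Omega>\<close> stands for the common exterior on which both fields agree.\<close>

lemma exterior_subset_closure:
  fixes D1 D2 \<Omega> :: "(real^3) set" and u1 u2 :: "real^3 \<Rightarrow> complex"
  assumes D: "open D1" "open D2" "connected (- closure D1)" and k: "0 < k"
    and u1: "C2_on (- closure D1) u1" "continuous_on (- D1) u1"
      "\<And>x. x \<in> - closure D1 \<Longrightarrow> laplacian u1 x + of_real (k\<^sup>2) * u1 x = 0" "\<And>x. x \<in> frontier D1 \<Longrightarrow> u1 x = 0"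
    and u2: "continuous_on (- D2) u2" "\<And>x. x \<in> frontier D2 \<Longrightarrow> u2 x = 0"
    and nz: "\<exists>x\<in>- closure D1. u1 x \<noteq> 0"
    and \<Omega>: "open \<Omega>" "\<Omega> \<subseteq> - (closure D1 \<union> closure D2)" "frontier \<Omega> \<subseteq> closure D1 \<union> closure D2" "bounded (- \<Omega>)"
    and slab: "\<And>x. x \<notin> \<Omega> \<Longrightarrow> m \<le> x $ 3 \<and> x $ 3 \<le> M" and ab: "a < m" "M < b" "a < b" "k \<le> pi / (b - a)"
    and eq: "\<And>x. x \<in> \<Omega> \<Longrightarrow> u1 x = u2 x"
  shows "- closure D1 \<subseteq> closure \<Omega>"
proof (rule ccontr)
  assume ne: "\<not> ?thesis"
  define A where "A = - closure D1 - closure \<Omega>"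
  have A: "open A" "A \<noteq> {}" "A \<subseteq> - closure D1" "A \<inter> \<Omega> = {}"
    using ne closure_subset[of \<Omega>] by (auto simp: A_def)
  have clA: "closure A \<subseteq> - D1" "closure A \<subseteq> - \<Omega>"
    using D(1) \<Omega>(1) A(3,4) closure_subset[of D1]
    by (intro closure_minimal; force simp: closed_Compl)+
  have "bounded A" using \<Omega>(4) clA closure_subset by (meson bounded_subset order_trans)
  have front: "u1 x = 0" if x: "x \<in> frontier A" for x
  proof (cases "x \<in> closure D1")
    case True
    have "x \<notin> D1" using x clA(1) by (auto simp: frontier_def)
    then show ?thesis using True D(1) u1(4) by (simp add: frontier_def interior_open)
  next
    case False
    have "x \<notin> A" using x A(1) by (simp add: frontier_def interior_open)
    then have xc: "x \<in> closure \<Omega>" using False by (auto simp: A_def)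
    have x\<Omega>: "x \<notin> \<Omega>" using x clA(2) by (auto simp: frontier_def)
    then have "x \<in> closure D2" using xc \<Omega>(1,3) False by (auto simp: frontier_def interior_open)
    moreover have cl: "closure \<Omega> \<subseteq> - D1" "closure \<Omega> \<subseteq> - D2"
      using D \<Omega>(2) closure_subset[of D1] closure_subset[of D2]
      by (intro closure_minimal; force simp: closed_Compl)+
    ultimately have "x \<in> frontier D2" using xc D(2) by (auto simp: frontier_def interior_open)
    then have u2x: "u2 x = 0" by (rule u2(2))
    have "continuous_on (closure \<Omega>) (\<lambda>y. u1 y - u2 y)"
      using cl by (intro continuous_on_diff continuous_on_subset[OF u1(2)] continuous_on_subset[OF u2(1)])
    then have "u1 x - u2 x = 0"
      by (rule continuous_constant_on_closure) (use eq xc in auto)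
    then show ?thesis using u2x by simp
  qed
  obtain \<kappa> where \<kappa>: "k < \<kappa>" "\<And>t. m \<le> t \<Longrightarrow> t \<le> M \<Longrightarrow> \<bar>\<kappa> * (t - (a + b) / 2)\<bar> < pi / 2"
  proof -
    \<comment> \<open>half the width of a strictly thinner slab around \<open>A\<close>; the term \<open>(b - a) / 4\<close> keeps it positive\<close>
    define h where "h = max ((b - a) / 4) (max (M - (a + b) / 2) ((a + b) / 2 - m))"
    have "0 < h" unfolding h_def using ab(3) by (intro less_max_iff_disj[THEN iffD2] disjI1) simp
    moreover have "h < (b - a) / 2"
      unfolding h_def max_less_iff_conj using ab by (intro conjI) (simp_all add: field_simps)
    ultimately have h: "0 < h" "2 * h < b - a" by simp_all
    have "pi / (b - a) < pi / (2 * h)" using h by (intro divide_strict_left_mono mult_pos_pos) auto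
    then obtain \<kappa> where \<kappa>: "k < \<kappa>" "\<kappa> < pi / (2 * h)" using ab(4) dense[of k "pi / (2 * h)"] by auto
    have "\<bar>\<kappa> * (t - (a + b) / 2)\<bar> < pi / 2" if "m \<le> t" "t \<le> M" for t
    proof -
      have "\<bar>t - (a + b) / 2\<bar> \<le> h" using that unfolding h_def by linarith
      then have "\<bar>\<kappa> * (t - (a + b) / 2)\<bar> \<le> \<kappa> * h" using \<kappa>(1) k by (auto simp: abs_mult intro!: mult_left_mono)
      also have "\<dots> < pi / (2 * h) * h" using \<kappa>(2) h(1) by (rule mult_strict_right_mono)
      finally show ?thesis using h(1) by simp
    qed
    then show ?thesis using that \<kappa>(1) by blast
  qed
  have zero: "u1 x0 = 0" if x0: "x0 \<in> A" for x0
  proof -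
    \<comment> \<open>this factor makes the value at \<open>x0\<close> real and nonnegative\<close>
    define c where "c = cnj (u1 x0)"
    define fd where "fd = (\<lambda>b x. frechet_derivative u1 (at x) b)"
    define fd2 where "fd2 = (\<lambda>b x. frechet_derivative (\<lambda>y. frechet_derivative u1 (at y) b) (at x) b)"
    have re: "has_dirderiv (\<lambda>y. Re (c * f y)) e (Re (c * f')) x" if "has_dirderiv f e f' x"
      for f :: "real^3 \<Rightarrow> complex" and e f' x
    proof -
      have "bounded_linear (\<lambda>z. Re (c * z))"
        by (rule bounded_linear_compose[OF bounded_linear_Re bounded_linear_mult_right])
      from bounded_linear.has_vector_derivative[OF this that[unfolded has_dirderiv_def]]
      show ?thesis by (simp add: has_dirderiv_def)
    qed
    have "Re (c * u1 x0) \<le> 0"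
    proof (rule slab_maximum_principle[where A = A and v = "\<lambda>x. Re (c * u1 x)" and e = "axis 3 1" and \<mu> = "k\<^sup>2"
          and \<kappa> = \<kappa> and c = "(a + b) / 2" and dv = "\<lambda>b x. Re (c * fd b x)" and ddv = "\<lambda>b x. Re (c * fd2 b x)"])
      show "open A" "bounded A" "x0 \<in> A" by fact+
      show "continuous_on (closure A) (\<lambda>x. Re (c * u1 x))"
        using clA(1) by (intro continuous_intros continuous_on_subset[OF u1(2)])
      show "has_dirderiv (\<lambda>x. Re (c * u1 x)) e (Re (c * fd e x)) x" if "x \<in> A" for e x
        unfolding fd_def by (rule re, rule C2_on_dirderiv[OF u1(1)]) (use that A(3) in auto)
      show "has_dirderiv (\<lambda>x. Re (c * fd e x)) e (Re (c * fd2 e x)) x" if "x \<in> A" for e x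
        unfolding fd_def fd2_def by (rule re, rule C2_on_dirderiv[OF u1(1)]) (use that A(3) in auto)
      show "(\<Sum>e\<in>Basis. Re (c * fd2 e x)) = - k\<^sup>2 * Re (c * u1 x)" if "x \<in> A" for x
      proof -
        have "(\<Sum>e\<in>Basis. Re (c * fd2 e x)) = Re (c * laplacian u1 x)"
          by (simp add: laplacian_def fd2_def sum_distrib_left)
        also have "laplacian u1 x = of_real (- k\<^sup>2) * u1 x"
          using u1(3)[of x] that A(3) by (auto simp: eq_neg_iff_add_eq_0)
        also have "Re (c * (of_real (- k\<^sup>2) * u1 x)) = - k\<^sup>2 * Re (c * u1 x)"
        proof -
          have "Re (c * (of_real r * z)) = r * Re (c * z)" for r z by (simp add: algebra_simps)
          then show ?thesis .
        qed
        finally show ?thesis .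
      qed
      show "Re (c * u1 x) \<le> 0" if "x \<in> frontier A" for x using front[OF that] by simp
      show "norm (axis 3 1 :: real^3) = 1" by simp
      show "k\<^sup>2 < \<kappa>\<^sup>2" using \<kappa>(1) k by (intro power_strict_mono) auto
      show "\<bar>\<kappa> * (x \<bullet> axis 3 1 - (a + b) / 2)\<bar> < pi / 2" if "x \<in> closure A" for x
        using \<kappa>(2)[of "x $ 3"] slab[of x] that clA(2) by (auto simp: inner_axis)
    qed
    moreover have "Re (c * u1 x0) = (norm (u1 x0))\<^sup>2"
      unfolding cmod_power2 by (simp add: c_def power2_eq_square)
    ultimately have "(norm (u1 x0))\<^sup>2 \<le> 0" by (simp only:)
    then show ?thesis by simp
  qed
  have "u1 x = 0" if "x \<in> - closure D1" for x
    by (rule helmholtz_unique_continuation[OF _ _ D(3) u1(1,3) A(1,2,3) zero that]) (use k in auto)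
  then show False using nz by blast
qed

text \<open>The component of the complement of \<open>K\<close> that contains the exterior of a large ball. Each half-space that
misses \<open>K\<close> is connected and leaves the ball, so it belongs to the same component.\<close>

lemma common_exterior_component:
  fixes K :: "(real^3) set"
  assumes "compact K" and R: "\<And>x. x \<in> K \<Longrightarrow> norm x \<le> R" "0 \<le> R" and mM: "\<And>x. x \<in> K \<Longrightarrow> m \<le> x $ 3 \<and> x $ 3 \<le> M"
  shows "\<exists>\<Omega>. open \<Omega> \<and> connected \<Omega> \<and> \<Omega> \<subseteq> - K \<and> frontier \<Omega> \<subseteq> K \<and> {x. R < norm x} \<subseteq> \<Omega> \<and>
    - \<Omega> \<subseteq> {x. m \<le> x $ 3 \<and> x $ 3 \<le> M}"
proof -
  define e where "e = (axis 3 1 :: real^3)"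
  define p where "p = (R + 1) *\<^sub>R e"
  define \<Omega> where "\<Omega> = connected_component_set (- K) p"
  have K: "open (- K)" using assms(1) by (simp add: compact_imp_closed open_Compl)
  have ext: "{x::real^3. R < norm x} = - cball 0 R" by auto
  have cext: "connected {x::real^3. R < norm x}"
    unfolding ext by (rule connected_complement_bounded_convex) auto
  have sub: "{x. R < norm x} \<subseteq> - K" using R(1) by force
  have pext: "p \<in> {x. R < norm x}" using R(2) by (simp add: p_def e_def)
  have far: "x \<in> \<Omega>" if "R < norm x" for x
    unfolding \<Omega>_def using connected_componentI[OF cext sub pext, of x] that by simp
  have half: "x \<in> \<Omega>" if "connected H" "H \<subseteq> - K" "x \<in> H" "y \<in> H" "R < norm y" for x y H
    using far[OF that(5)] connected_componentI[OF that(1,2,4,3)] 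
    unfolding \<Omega>_def by (auto intro: connected_component_trans)
  have low: "x \<in> \<Omega>" if "x $ 3 < m" for x
  proof (rule half[where H = "{x. x $ 3 < m}" and y = "- (R + 1 + \<bar>m\<bar>) *\<^sub>R e"])
    have "{x::real^3. x $ 3 < m} = {x. e \<bullet> x < m}" by (simp add: e_def inner_axis')
    then show "connected {x::real^3. x $ 3 < m}" by (simp add: convex_halfspace_lt convex_connected)
    show "{x. x $ 3 < m} \<subseteq> - K" using mM by fastforce
  qed (use that R(2) in \<open>auto simp: e_def\<close>)
  have high: "x \<in> \<Omega>" if "x $ 3 > M" for x
  proof (rule half[where H = "{x. x $ 3 > M}" and y = "(R + 1 + \<bar>M\<bar>) *\<^sub>R e"])
    have "{x::real^3. x $ 3 > M} = {x. e \<bullet> x > M}" by (simp add: e_def inner_axis')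
    then show "connected {x::real^3. x $ 3 > M}" by (simp add: convex_halfspace_gt convex_connected)
    show "{x. x $ 3 > M} \<subseteq> - K" using mM by fastforce
  qed (use that R(2) in \<open>auto simp: e_def\<close>)
  have open\<Omega>: "open \<Omega>" unfolding \<Omega>_def by (rule open_connected_component[OF K])
  have "x \<in> K" if x: "x \<in> frontier \<Omega>" for x
  proof (rule ccontr)
    assume "x \<notin> K"
    then obtain r where r: "r > 0" "ball x r \<subseteq> - K" using K by (meson ComplI openE)
    have "x \<in> closure \<Omega>" "x \<notin> \<Omega>" using x open\<Omega> by (auto simp: frontier_def interior_open)
    then obtain y where y: "y \<in> \<Omega>" "dist y x < r" using r(1) by (auto simp: closure_approachable)
    have "connected_component (- K) y x"
      by (rule connected_componentI[OF _ r(2)]) (use y r in \<open>auto simp: dist_commute\<close>)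
    then have "x \<in> \<Omega>" using y(1) unfolding \<Omega>_def by (auto intro: connected_component_trans)
    with \<open>x \<notin> \<Omega>\<close> show False ..
  qed
  then have "frontier \<Omega> \<subseteq> K" by blast
  moreover have "\<Omega> \<subseteq> - K" "connected \<Omega>" unfolding \<Omega>_def by (simp_all add: connected_component_subset)
  moreover have "{x. R < norm x} \<subseteq> \<Omega>" using far by blast
  moreover have "- \<Omega> \<subseteq> {x. m \<le> x $ 3 \<and> x $ 3 \<le> M}" using low high by (auto simp: not_less[symmetric])
  ultimately show ?thesis using open\<Omega> by blast
qed

section \<open>Uniqueness of the obstacle\<close>

lemma obstacle_subset_if_exterior_subset:
  assumes "open D1" "open D2" "C2_boundary D1" "\<Omega> \<subseteq> - closure D2" "- closure D1 \<subseteq> closure \<Omega>"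
  shows "D2 \<subseteq> D1"
proof -
  have "closure \<Omega> \<subseteq> - D2"
    using assms(2,4) closure_subset[of D2] by (intro closure_minimal) (auto simp: closed_Compl)
  then have "D2 \<subseteq> interior (closure D1)" using assms(2,5) by (intro interior_maximal) auto
  then show ?thesis using interior_closure_C2_domain[OF assms(1,3)] by simp
qed

theorem corollary1p3:
  fixes J :: "real set" and k :: real and d :: "real^3"
    and D\<^sub>1 D\<^sub>2 :: "(real^3) set" and F\<^sub>1 F\<^sub>2 :: "real^3 \<Rightarrow> complex"
  assumes "J \<noteq> {}" and "open J" and "bounded J" and "is_interval J"
    and "k > 0" and "k\<^sup>2 \<le> first_dirichlet_eigenvalue J"
    and "d \<in> sphere 0 1"
    and "obstacle D\<^sub>1" and "closure D\<^sub>1 \<subseteq> {x. x $ 3 \<in> J}"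
    and "obstacle D\<^sub>2" and "closure D\<^sub>2 \<subseteq> {x. x $ 3 \<in> J}"
    and "far_field_pattern D\<^sub>1 d k F\<^sub>1" and "far_field_pattern D\<^sub>2 d k F\<^sub>2"
    and "\<forall>\<phi>\<in>sphere 0 1. F\<^sub>1 \<phi> = F\<^sub>2 \<phi>"
  shows "D\<^sub>1 = D\<^sub>2"
proof -
  obtain a b where ab: "a < b" "J = {a<..<b}"
    using open_bounded_real_interval[OF assms(1-4)] .
  have "k\<^sup>2 \<le> (pi / (b - a))\<^sup>2"
    using assms(6) first_dirichlet_eigenvalue_interval[OF ab(1)] ab(2) by simp
  then have kab: "k \<le> pi / (b - a)" by (rule power2_le_imp_le) (use ab(1) in simp)
  note D1 = assms(8)[unfolded obstacle_def] and D2 = assms(10)[unfolded obstacle_def]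
  obtain u1 C1 R1 where u1: "total_field D\<^sub>1 d k u1" and R1: "R1 > 0"
    and far1: "\<And>r \<phi>. r \<ge> R1 \<Longrightarrow> \<phi> \<in> sphere 0 1 \<Longrightarrow>
      norm ((u1 (r *\<^sub>R \<phi>) - incident_wave d k (r *\<^sub>R \<phi>)) - exp (\<i> * of_real (k * r)) / of_real r * F\<^sub>1 \<phi>) \<le> C1 / r\<^sup>2"
    using assms(12) unfolding far_field_pattern_def by blast
  obtain u2 C2 R2 where u2: "total_field D\<^sub>2 d k u2" and R2: "R2 > 0"
    and far2: "\<And>r \<phi>. r \<ge> R2 \<Longrightarrow> \<phi> \<in> sphere 0 1 \<Longrightarrow>
      norm ((u2 (r *\<^sub>R \<phi>) - incident_wave d k (r *\<^sub>R \<phi>)) - exp (\<i> * of_real (k * r)) / of_real r * F\<^sub>2 \<phi>) \<le> C2 / r\<^sup>2"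
    using assms(13) unfolding far_field_pattern_def by blast
  note u1 = u1[unfolded total_field_def] and u2 = u2[unfolded total_field_def]
  define K where "K = closure D\<^sub>1 \<union> closure D\<^sub>2"
  have K: "compact K" "K \<noteq> {}" using D1 D2 by (auto simp: K_def compact_closure)
  have c3: "continuous_on K (\<lambda>x. x $ 3)" by (intro continuous_intros)
  obtain xm where xm: "xm \<in> K" "\<And>x. x \<in> K \<Longrightarrow> xm $ 3 \<le> x $ 3"
    using continuous_attains_inf[OF K c3] by blast
  obtain xM where xM: "xM \<in> K" "\<And>x. x \<in> K \<Longrightarrow> x $ 3 \<le> xM $ 3"
    using continuous_attains_sup[OF K c3] by blast
  have "K \<subseteq> {x. x $ 3 \<in> J}" using assms(9,11) by (simp add: K_def)
  then have mM: "a < xm $ 3" "xM $ 3 < b" using xm(1) xM(1) ab(2) by auto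
  obtain B where B: "\<And>x. x \<in> K \<Longrightarrow> norm x \<le> B" using compact_imp_bounded[OF K(1)] unfolding bounded_iff by auto
  define R where "R = max B (max R1 R2)"
  have R: "0 \<le> R" "R1 \<le> R" "R2 \<le> R" "\<And>x. x \<in> K \<Longrightarrow> norm x \<le> R"
    using R1 B by (auto simp: R_def intro: order_trans less_imp_le max.coboundedI1 max.coboundedI2)
  obtain \<Omega> where \<Omega>: "open \<Omega>" "connected \<Omega>" "\<Omega> \<subseteq> - K" "frontier \<Omega> \<subseteq> K" "{x. R < norm x} \<subseteq> \<Omega>"
    "\<And>x. x \<notin> \<Omega> \<Longrightarrow> xm $ 3 \<le> x $ 3 \<and> x $ 3 \<le> xM $ 3"
  proof -
    have "xm $ 3 \<le> x $ 3 \<and> x $ 3 \<le> xM $ 3" if "x \<in> K" for x using xm(2) xM(2) that by blast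
    from common_exterior_component[OF K(1) R(4,1) this] that show ?thesis by blast
  qed
  define w where "w = (\<lambda>x. u1 x - u2 x)"
  have "C2_on \<Omega> u1" "C2_on \<Omega> u2"
    using u1 u2 \<Omega>(3) by (auto simp: K_def intro: C2_on_subset)
  note w = C2_on_diff[OF \<Omega>(1) this]
  have C2w: "C2_on \<Omega> w" unfolding w_def by (rule w(1))
  have pdew: "laplacian w x + of_real (k\<^sup>2) * w x = 0" if "x \<in> \<Omega>" for x
  proof -
    have e: "laplacian u1 x + of_real (k\<^sup>2) * u1 x = 0" "laplacian u2 x + of_real (k\<^sup>2) * u2 x = 0"
      using u1 u2 \<Omega>(3) that by (auto simp: K_def)
    have "laplacian w x + of_real (k\<^sup>2) * w x
        = (laplacian u1 x + of_real (k\<^sup>2) * u1 x) - (laplacian u2 x + of_real (k\<^sup>2) * u2 x)"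
      unfolding w_def w(2)[OF that] by (simp add: algebra_simps)
    then show ?thesis unfolding e by simp
  qed
  have decay: "norm (w x) \<le> (C1 + C2) / (norm x)\<^sup>2" if x: "R < norm x" for x
  proof -
    define \<phi> where "\<phi> = x /\<^sub>R norm x"
    have nx: "norm x > 0" using x R(1) by linarith
    then have \<phi>: "\<phi> \<in> sphere 0 1" "x = norm x *\<^sub>R \<phi>" by (auto simp: \<phi>_def)
    define f where "f = exp (\<i> * of_real (k * norm x)) / of_real (norm x) * F\<^sub>1 \<phi>"
    have "norm ((u1 x - incident_wave d k x) - f) \<le> C1 / (norm x)\<^sup>2"
      using far1[of "norm x" \<phi>] \<phi> x R(2) by (simp add: f_def)
    moreover have "norm ((u2 x - incident_wave d k x) - f) \<le> C2 / (norm x)\<^sup>2"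
      using far2[of "norm x" \<phi>] \<phi> x R(3) assms(14) by (simp add: f_def)
    moreover have "w x = ((u1 x - incident_wave d k x) - f) - ((u2 x - incident_wave d k x) - f)"
      by (simp add: w_def)
    ultimately show ?thesis
      using norm_triangle_ineq4[of "(u1 x - incident_wave d k x) - f" "(u2 x - incident_wave d k x) - f"]
      by (simp only: add_divide_distrib)
  qed
  have k0: "k \<noteq> 0" using assms(5) by simp
  have w0: "w x = 0" if "R < norm x" for x
    by (rule rellich[OF k0 C2_on_subset[OF C2w \<Omega>(5)] _ decay R(1) that]) (use pdew \<Omega>(5) in auto)
  have eq: "u1 x = u2 x" if x: "x \<in> \<Omega>" for x
  proof -
    have "w x = 0"
    proof (rule helmholtz_unique_continuation[OF k0 \<Omega>(1,2) C2w pdew _ _ \<Omega>(5) _ x])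
      show "open {x::real^3. R < norm x}" by (intro open_Collect_less continuous_intros)
      show "{x::real^3. R < norm x} \<noteq> {}"
        using R(1) by (auto intro!: exI[of _ "(R + 1) *\<^sub>R axis 1 1"])
    qed (use w0 in auto)
    then show ?thesis by (simp add: w_def)
  qed
  have bd: "bounded (- \<Omega>)" by (rule bounded_subset[of "cball 0 R"]) (use \<Omega>(5) in \<open>auto simp: not_less[symmetric]\<close>)
  have nd: "norm d = 1" using assms(7) by simp
  have nz1: "\<exists>x\<in>- closure D\<^sub>1. u1 x \<noteq> 0" by (rule exterior_wave_nonzero[OF nd _ R1 far1]) (use D1 in auto)
  have nz2: "\<exists>x\<in>- closure D\<^sub>2. u2 x \<noteq> 0" by (rule exterior_wave_nonzero[OF nd _ R2 far2]) (use D2 in auto)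
  have sub1: "- closure D\<^sub>1 \<subseteq> closure \<Omega>"
    by (rule exterior_subset_closure[where ?D1.0 = "D\<^sub>1" and ?D2.0 = "D\<^sub>2" and ?u1.0 = u1 and ?u2.0 = u2 and k = k
          and a = a and b = b and m = "xm $ 3" and M = "xM $ 3"])
      (use D1 D2 assms(5) u1 u2 nz1 \<Omega> bd mM ab(1) kab eq in \<open>auto simp: K_def\<close>)
  have sub2: "- closure D\<^sub>2 \<subseteq> closure \<Omega>"
    by (rule exterior_subset_closure[where ?D1.0 = "D\<^sub>2" and ?D2.0 = "D\<^sub>1" and ?u1.0 = u2 and ?u2.0 = u1 and k = k
          and a = a and b = b and m = "xm $ 3" and M = "xM $ 3"])
      (use D1 D2 assms(5) u1 u2 nz2 \<Omega> bd mM ab(1) kab eq in \<open>auto simp: K_def\<close>)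
  show ?thesis
  proof
    show "D\<^sub>1 \<subseteq> D\<^sub>2"
      by (rule obstacle_subset_if_exterior_subset[OF _ _ _ _ sub2]) (use D1 D2 \<Omega>(3) in \<open>auto simp: K_def\<close>)
    show "D\<^sub>2 \<subseteq> D\<^sub>1"
      by (rule obstacle_subset_if_exterior_subset[OF _ _ _ _ sub1]) (use D1 D2 \<Omega>(3) in \<open>auto simp: K_def\<close>)
  qed
qed

end
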